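(* Let $d\geq 3$. For any $\varepsilon\in(0,1/2)$ and $u>u_*(\varepsilon)$, $$\mathbb P[0\leftrightarrow\infty\text{ in }\mathcal V^{u,\varepsilon}]=0.$$ In other words, for $\varepsilon\in(0,1/2)$, the $\varepsilon$-disordered vacant set $\mathcal V^{u,\varepsilon}$ undergoes a phase transition in $u$ at $u_*(\varepsilon)$. Moreover, there exists $\varepsilon_0>0$ such that for all $\varepsilon\in(0,\varepsilon_0]$, $$0<u_*(\varepsilon)<\infty.$$
   Context: Random interlacements. Let $P_x$ be the law of simple random walk $X$ on $\mathbb Z^d$ ($d\ge 3$) started at $x$. For finite $K\subset\mathbb Z^d$ let $\mathrm{cap}(K)=\sum_{x\in K}P_x[X(t)\notin K\text{ for all }t\geq 1]$. For $u>0$ the random interlacement $\mathcal I^u$ at level $u$ is the random subset of $\mathbb Z^d$ whose law is characterized by $\mathbb P[\mathcal I^u\cap K=\emptyset]=e^{-u\,\mathrm{cap}(K)}$ for all finite $K\subset\mathbb Z^d$ (for $u=0$, $\mathcal I^0=\emptyset$). The vacant set is $\mathcal V^u=\mathbb Z^d\setminus\mathcal I^u$. For $\varepsilon\in(0,1)$, let $\theta_x$, $x\in\mathbb Z^d$, be independent Bernoulli random variables with parameter $\varepsilon$, independent of $\mathcal I^u$. Define $\mathcal I^{u,\varepsilon}$ as the set of $x\in\mathbb Z^d$ such that either $x\in\mathcal I^u$ and $\theta_x=0$, or $x\in\mathcal V^u$ and $\theta_x=1$; and $\mathcal V^{u,\varepsilon}=\mathbb Z^d\setminus\mathcal I^{u,\varepsilon}$.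 $\{0\leftrightarrow\infty\text{ in }\mathcal V\}$ is the event that $0$ belongs to an infinite connected component of the subgraph of the nearest-neighbor lattice $\mathbb Z^d$ induced by $\mathcal V$. Define $$u_*(\varepsilon)=\inf\{u\geq 0: \mathbb P[0\leftrightarrow\infty\text{ in }\mathcal V^{u,\varepsilon}]=0\},$$ with $\inf\emptyset=\infty$. *)

theory Defs
  imports "HOL-Probability.Probability"
begin

text \<open>
  The dimension is \<open>d = CARD('d)\<close>.  A subset of the lattice is identified with its indicator
  configuration, so that the space of subsets carries the product sigma-algebra.
\<close>

type_synonym 'd site = "int ^ 'd"

abbreviation config_space :: "('d::finite site \<Rightarrow> bool) measure" where
  "config_space \<equiv> PiM UNIV (\<lambda>_. count_space UNIV)"

definition adjacent :: "'d::finite site \<Rightarrow> 'd site \<Rightarrow> bool" where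
  "adjacent x y \<longleftrightarrow> (\<Sum>i\<in>UNIV. \<bar>x $ i - y $ i\<bar>) = 1"


lemma finite_steps: "finite {e :: 'd::finite site. adjacent 0 e}"
proof (rule finite_subset)
  show "finite (vec_lambda ` (Pi\<^sub>E UNIV (\<lambda>_. {-1..1})) :: 'd site set)"
    by (intro finite_imageI finite_PiE) auto
  show "{e :: 'd site. adjacent 0 e} \<subseteq> vec_lambda ` (Pi\<^sub>E UNIV (\<lambda>_. {-1..1}))"
  proof
    fix e :: "'d site" assume "e \<in> {e. adjacent 0 e}"
    hence sum: "(\<Sum>i\<in>UNIV. \<bar>e $ i\<bar>) = 1" by (simp add: adjacent_def)
    have "\<bar>e $ i\<bar> \<le> 1" for i
      unfolding sum[symmetric] by (rule member_le_sum) auto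
    hence "vec_nth e \<in> Pi\<^sub>E UNIV (\<lambda>_. {-1..1})" by (auto simp: abs_le_iff minus_le_iff)
    thus "e \<in> vec_lambda ` (Pi\<^sub>E UNIV (\<lambda>_. {-1..1}))"
      by (intro image_eqI[where x = "vec_nth e"]) auto
  qed
qed

lemma steps_nonempty: "{e :: 'd::finite site. adjacent 0 e} \<noteq> {}"
proof -
  obtain j :: 'd where True by blast
  have "adjacent 0 (\<chi> i. if i = j then 1 else (0::int))"
    by (simp add: adjacent_def if_distrib[of abs] cong: if_cong)
  thus ?thesis by blast
qed


subsection \<open>Simple random walk and capacity\<close>

definition walk_path :: "'d::finite site \<Rightarrow> (nat \<Rightarrow> 'd site) \<Rightarrow> nat \<Rightarrow> 'd site" where
  "walk_path x \<xi> n = x + (\<Sum>i<n. \<xi> i)"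

definition srw :: "'d::finite site \<Rightarrow> (nat \<Rightarrow> 'd site) measure" where
  "srw x =
     distr (PiM UNIV (\<lambda>_. measure_pmf (pmf_of_set {e. adjacent 0 e})))
           (PiM UNIV (\<lambda>_. count_space UNIV)) (walk_path x)"

lemma measurable_walk_path [measurable]:
  "walk_path (x :: 'd::finite site) \<in>
     measurable (PiM UNIV (\<lambda>_. measure_pmf (pmf_of_set {e. adjacent 0 e})))
                (PiM UNIV (\<lambda>_. count_space UNIV))"
proof -
  let ?N = "PiM UNIV (\<lambda>_::nat. measure_pmf (pmf_of_set {e :: 'd site. adjacent 0 e}))"
  have "(\<lambda>\<xi>. walk_path x \<xi> n) \<in> measurable ?N (count_space UNIV)" for n
  proof (induction n)
    case 0
    show ?case by (simp add: walk_path_def)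
  next
    case (Suc n)
    have step: "(\<lambda>\<xi>. \<xi> n) \<in> measurable ?N (count_space UNIV)"
      using measurable_component_singleton[of n UNIV
          "\<lambda>_. measure_pmf (pmf_of_set {e :: 'd site. adjacent 0 e})"]
      by (simp cong: measurable_cong_sets)
    have "(\<lambda>\<xi>. walk_path x \<xi> n + \<xi> n) \<in> measurable ?N (count_space UNIV)"
    proof (rule measurable_compose_countable[OF _ Suc.IH])
      fix a :: "'d site"
      show "(\<lambda>\<xi>. a + \<xi> n) \<in> measurable ?N (count_space UNIV)"
        by (rule measurable_compose[OF step]) simp
    qed
    thus ?case by (simp add: walk_path_def add.assoc)
  qed
  thus ?thesis
    by (intro measurable_PiM_single') auto
qed

lemma prob_space_srw: "prob_space (srw x)"
  unfolding srw_def
  by (intro prob_space.prob_space_distr measurable_walk_path prob_space_PiM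
      measure_pmf.prob_space_axioms)

lemma escape_event_measurable:
  "{X \<in> space (srw x). \<forall>t\<ge>1. X t \<notin> K} \<in> sets (srw x)"
  unfolding srw_def sets_distr space_distr by measurable

definition cap :: "'d::finite site set \<Rightarrow> real" where
  "cap K = (\<Sum>x\<in>K. measure (srw x) {X \<in> space (srw x). \<forall>t\<ge>1. X t \<notin> K})"


subsection \<open>Random interlacements and quenched noise\<close>

text \<open>
  For \<open>u = 0\<close> the condition below says that \<open>I\<close> is almost surely empty.
\<close>

definition random_interlacement ::
    "'w measure \<Rightarrow> real \<Rightarrow> ('w \<Rightarrow> 'd::finite site set) \<Rightarrow> bool" where
  "random_interlacement M u I \<longleftrightarrow>
     (\<lambda>\<omega> x. x \<in> I \<omega>) \<in> measurable M config_space \<and>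
     (\<forall>K. finite K \<longrightarrow> measure M {\<omega> \<in> space M. I \<omega> \<inter> K = {}} = exp (- u * cap K))"

definition bernoulli_field ::
    "'w measure \<Rightarrow> real \<Rightarrow> ('d::finite site \<Rightarrow> 'w \<Rightarrow> bool) \<Rightarrow> bool" where
  "bernoulli_field M \<epsilon> \<theta> \<longleftrightarrow>
     prob_space.indep_vars M (\<lambda>_. count_space UNIV) \<theta> UNIV \<and>
     (\<forall>x. distr M (count_space UNIV) (\<theta> x) = measure_pmf (bernoulli_pmf \<epsilon>))"

definition noise_independent ::
    "'w measure \<Rightarrow> ('w \<Rightarrow> 'd::finite site set) \<Rightarrow> ('d site \<Rightarrow> 'w \<Rightarrow> bool) \<Rightarrow> bool" where
  "noise_independent M I \<theta> \<longleftrightarrow>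
     prob_space.indep_var M config_space (\<lambda>\<omega> x. x \<in> I \<omega>) config_space (\<lambda>\<omega> x. \<theta> x \<omega>)"

definition disordered_interlacement ::
    "('w \<Rightarrow> 'd::finite site set) \<Rightarrow> ('d site \<Rightarrow> 'w \<Rightarrow> bool) \<Rightarrow> 'w \<Rightarrow> 'd site set" where
  "disordered_interlacement I \<theta> \<omega> =
     {x. (x \<in> I \<omega> \<and> \<not> \<theta> x \<omega>) \<or> (x \<in> - I \<omega> \<and> \<theta> x \<omega>)}"

definition disordered_vacant ::
    "('w \<Rightarrow> 'd::finite site set) \<Rightarrow> ('d site \<Rightarrow> 'w \<Rightarrow> bool) \<Rightarrow> 'w \<Rightarrow> 'd site set" where
  "disordered_vacant I \<theta> \<omega> = - disordered_interlacement I \<theta> \<omega>"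


subsection \<open>Percolation\<close>

definition component :: "'d::finite site set \<Rightarrow> 'd site \<Rightarrow> 'd site set" where
  "component V x =
     {y. x \<in> V \<and> (\<lambda>a b. a \<in> V \<and> b \<in> V \<and> adjacent a b)\<^sup>*\<^sup>* x y}"

definition percolates :: "'d::finite site set \<Rightarrow> bool" where
  "percolates V \<longleftrightarrow> infinite (component V 0)"

lemma measurable_percolates [measurable]:
  "Measurable.pred config_space (\<lambda>v. percolates {x :: 'd::finite site. v x})"
proof -
  let ?R = "\<lambda>v a b. a \<in> {x. v x} \<and> b \<in> {x. v x} \<and> adjacent a (b :: 'd site)"
  have P: "Measurable.pred config_space (\<lambda>v. ((?R v) ^^ n) a b)" for n a b
  proof (induction n arbitrary: b)
    case 0
    show ?case by simp
  next
    case (Suc n)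
    note Suc.IH [measurable]
    have "Measurable.pred config_space (\<lambda>v. \<exists>c. ((?R v) ^^ n) a c \<and> v c \<and> v b \<and> adjacent c b)"
      by measurable
    thus ?case by (simp add: relcompp_apply)
  qed
  note P [measurable]
  have *: "y \<in> component {x. v x} 0 \<longleftrightarrow> v 0 \<and> (\<exists>n. ((?R v) ^^ n) 0 y)" for v y
    by (simp add: component_def rtranclp_power)
  have C [measurable]: "Measurable.pred config_space (\<lambda>v. y \<in> component {x. v x} 0)" for y :: "'d site"
    unfolding * by measurable
  have inf: "infinite A \<longleftrightarrow> (\<forall>F\<in>{F. finite F}. \<exists>y. y \<in> A \<and> y \<notin> F)" for A :: "'d site set"
    by (metis finite_subset mem_Collect_eq subsetI)
  have "countable {F :: 'd site set. finite F}"
    by (simp add: countable_Collect_finite)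
  note this [measurable]
  show ?thesis
    unfolding percolates_def inf by measurable
qed

lemma percolation_event_measurable:
  fixes I :: "'w \<Rightarrow> 'd::finite site set"
  assumes I: "(\<lambda>\<omega> x. x \<in> I \<omega>) \<in> measurable M config_space"
    and T: "(\<lambda>\<omega> x. \<theta> x \<omega>) \<in> measurable M config_space"
  shows "{\<omega> \<in> space M. percolates (disordered_vacant I \<theta> \<omega>)} \<in> sets M"
proof -
  have [measurable]: "Measurable.pred M (\<lambda>\<omega>. x \<in> I \<omega>)" "Measurable.pred M (\<theta> x)" for x
    using measurable_compose[OF I measurable_component_singleton[of x UNIV]]
      measurable_compose[OF T measurable_component_singleton[of x UNIV]] by simp_all
  have "(\<lambda>\<omega> x. (x \<in> I \<omega>) = \<theta> x \<omega>) \<in> measurable M config_space"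
    by (intro measurable_PiM_single') auto
  from measurable_compose[OF this measurable_percolates]
  have "Measurable.pred M (\<lambda>\<omega>. percolates {x. (x \<in> I \<omega>) = \<theta> x \<omega>})" .
  moreover have "disordered_vacant I \<theta> \<omega> = {x. (x \<in> I \<omega>) = \<theta> x \<omega>}" for \<omega>
    by (auto simp: disordered_vacant_def disordered_interlacement_def)
  ultimately show ?thesis by simp
qed

definition perc_prob ::
    "'w measure \<Rightarrow> ('w \<Rightarrow> 'd::finite site set) \<Rightarrow> ('d site \<Rightarrow> 'w \<Rightarrow> bool) \<Rightarrow> real" where
  "perc_prob M I \<theta> = measure M {\<omega> \<in> space M. percolates (disordered_vacant I \<theta> \<omega>)}"

text \<open>
  \<open>I u\<close> and \<open>\<theta> \<epsilon>\<close> realize the interlacement at level \<open>u\<close> and the noise of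
  parameter \<open>\<epsilon>\<close>.  The percolation probability depends only on their joint law, which is
  determined by \<open>u\<close>, \<open>\<epsilon>\<close> and the dimension; hence the value below does not depend on the
  choice of realization.
  The infimum is taken in \<open>ereal\<close>, so it is \<open>\<infinity>\<close> for the empty set.
\<close>

definition u_star ::
    "'w measure \<Rightarrow> (real \<Rightarrow> 'w \<Rightarrow> 'd::finite site set) \<Rightarrow>
     (real \<Rightarrow> 'd site \<Rightarrow> 'w \<Rightarrow> bool) \<Rightarrow> real \<Rightarrow> ereal" where
  "u_star M I \<theta> \<epsilon> = Inf {ereal u | u. 0 \<le> u \<and> perc_prob M (I u) (\<theta> \<epsilon>) = 0}"

end

theory Submission
  imports Defs
begin

text \<open>
  Monotonicity in \<open>u\<close> follows by coupling: the union of independent interlacements at levels \<open>u\<close>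
  and \<open>v\<close> has the law of the interlacement at level \<open>u + v\<close>, and for a fixed obstacle set the noise
  fields can be coupled so that adding obstacles only shrinks the vacant set.

  For the two bounds on \<open>u\<^sub>*\<close>, a long star-connected set contains the \<open>2\<^sup>n\<close> leaves of a
  dyadic tree of well separated points, and there are at most \<open>C ^ (2\<^sup>n)\<close> such trees (Rath's
  method for the vacant set without noise). For large \<open>u\<close> the leaves are unlikely to be
  vacant, since their capacity is comparable to their number. For small \<open>u\<close>, non-percolation in a
  coordinate plane produces by planar duality a closed star-connected circuit on a coarse planar
  lattice, whose sites carry crosses made of two segments of length \<open>N\<close>. The number of crosses hit
  by a random walk has exponential moments as large as desired once \<open>N\<close> is large: the chance to
  hit another cross of the tree is of order \<open>1 / log N\<close> already in dimension 3. The moment bounds use only the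
  superharmonic function \<open>(|x|\<^sup>2 + 5) powr (-1/2)\<close> and the sweeping identity for capacities.
\<close>

subsection \<open>Hitting probabilities of the walk\<close>

text \<open>The interlacement enters only through its avoidance probabilities, so the law of the set
  of hit obstacles has to be recovered from signed sums of \<open>exp (- u * cap ...)\<close> over
  subfamilies. Differentiating such a sum in \<open>u\<close> brings down capacities, and sweeping
  turns their signed sum into an expectation over one walk started from the equilibrium measure. The
  walk is handled by finite-horizon recursions; the price is that sweeping holds only after
  summation over the splittings of the horizon.

  The union bound over trees asks for a factor \<open>1 / \<rho>\<close> per leaf well below the
  reciprocal of the tree entropy, while the moment bound asks that \<open>\<rho>\<close> times the
  expected number of further obstacles hit stay below 1/2. For single sites at separation
  \<open>s\<close> the bound on that number is of order \<open>1 / s\<close>, but the entropy in the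
  plane grows like \<open>s ^ 4\<close>, so a larger \<open>s\<close> does not help. Crosses break
  the tie: on the coarse lattice the separation stays at 2, hence the entropy is fixed, while
  \<open>\<rho>\<close> may grow with the length of the segments. For large \<open>u\<close> single
  sites suffice, because the cost per leaf can be made as small as desired.\<close>

definition steps :: "'d::finite site set" where
  "steps = {e. adjacent 0 e}"

definition avg :: "('d::finite site \<Rightarrow> real) \<Rightarrow> 'd site \<Rightarrow> real" where
  "avg f x = (\<Sum>e\<in>steps. f (x + e)) / card (steps :: 'd site set)"

text \<open>Probability that the walk from \<open>x\<close> meets \<open>K\<close> by time
  \<open>n\<close>, in the form of its first-step recursion, so that estimates become inductions on
  \<open>n\<close>. The link with the walk is \<open>avoid_prob\<close>.\<close>

primrec hit :: "'d::finite site set \<Rightarrow> nat \<Rightarrow> 'd site \<Rightarrow> real" where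
  "hit K 0 x = of_bool (x \<in> K)"
| "hit K (Suc n) x = (if x \<in> K then 1 else avg (hit K n) x)"

text \<open>Probability of avoiding \<open>K\<close> at the times 1 to \<open>n\<close>. Time 0 is
  left out, so that the value is of interest at the points of \<open>K\<close>, where it decreases
  to the summand of \<open>cap\<close>.\<close>

primrec esc :: "'d::finite site set \<Rightarrow> nat \<Rightarrow> 'd site \<Rightarrow> real" where
  "esc K 0 x = 1"
| "esc K (Suc n) x = 1 - avg (hit K n) x"

lemma finite_steps' [simp]: "finite steps"
  and steps_nonempty' [simp]: "steps \<noteq> {}"
  using finite_steps steps_nonempty by (auto simp: steps_def)

lemma card_steps_pos [simp]: "0 < card (steps :: 'd::finite site set)"
  by (simp add: card_gt_0_iff)

lemma avg_mono: "(\<And>x. f x \<le> g x) \<Longrightarrow> avg f x \<le> avg g x"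
  unfolding avg_def by (intro divide_right_mono sum_mono) auto

lemma avg_nonneg: "(\<And>x. 0 \<le> f x) \<Longrightarrow> 0 \<le> avg f x"
  unfolding avg_def by (intro divide_nonneg_nonneg sum_nonneg) auto

lemma avg_const [simp]: "avg (\<lambda>_. c) x = c"
  by (simp add: avg_def)

lemma avg_add: "avg (\<lambda>x. f x + g x) x = avg f x + avg g x"
  by (simp add: avg_def sum.distrib add_divide_distrib)

lemma avg_diff: "avg (\<lambda>x. f x - g x) x = avg f x - avg g x"
  by (simp add: avg_def sum_subtractf diff_divide_distrib)

lemma avg_cmult: "avg (\<lambda>x. c * f x) x = c * avg f x"
  by (simp add: avg_def sum_distrib_left)

lemma avg_sum: "avg (\<lambda>x. \<Sum>i\<in>A. f i x) x = (\<Sum>i\<in>A. avg (f i) x)"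
  unfolding avg_def by (subst sum.swap) (simp add: sum_divide_distrib)

lemma avg_translate: "avg (\<lambda>y. f (y - a)) x = avg f (x - a)"
  by (simp add: avg_def algebra_simps)

lemma hit_in [simp]: "x \<in> K \<Longrightarrow> hit K n x = 1"
  by (cases n) auto

lemma hit_nonneg: "0 \<le> hit K n x"
  by (induction n arbitrary: x) (auto intro: avg_nonneg)

lemma hit_le_1: "hit K n x \<le> 1"
proof (induction n arbitrary: x)
  case (Suc n)
  have "avg (hit K n) x \<le> avg (\<lambda>_. 1) x" by (intro avg_mono Suc)
  thus ?case by simp
qed auto

lemma esc_nonneg: "0 \<le> esc K n x"
proof (cases n)
  case (Suc m)
  have "avg (hit K m) x \<le> avg (\<lambda>_. 1) x" by (intro avg_mono hit_le_1)
  thus ?thesis using Suc by simp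
qed auto

lemma esc_le_1: "esc K n x \<le> 1"
  by (cases n) (auto intro: avg_nonneg hit_nonneg)

subsection \<open>The capacity as a limit\<close>

abbreviation step_seq :: "(nat \<Rightarrow> 'd::finite site) measure" where
  "step_seq \<equiv> PiM UNIV (\<lambda>_. measure_pmf (pmf_of_set {e. adjacent 0 e}))"

lemma walk_path_measurable_n [measurable]:
  "(\<lambda>\<xi>. walk_path x \<xi> n) \<in> measurable step_seq (count_space UNIV)"
  using measurable_compose[OF measurable_walk_path measurable_component_singleton[of n UNIV "\<lambda>_. count_space UNIV"], of x]
  by simp

lemma walk_path_case_nat:
  "walk_path x (case_nat e \<xi>) (Suc t) = walk_path (x + e) \<xi> t"
  by (simp add: walk_path_def sum.lessThan_Suc_shift add.assoc del: sum.lessThan_Suc)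

text \<open>Markov property at time 1: an i.i.d. sequence is its first entry followed by an
  independent copy of the sequence.\<close>

lemma prob_step_seq_iter:
  fixes A :: "(nat \<Rightarrow> 'd::finite site) set"
  assumes "A \<in> sets step_seq"
  shows "measure step_seq A = (\<Sum>e\<in>steps. measure step_seq {\<xi>. case_nat e \<xi> \<in> A}) / card (steps :: 'd site set)"
proof -
  let ?p = "pmf_of_set {e :: 'd site. adjacent 0 e}"
  interpret T: prob_space "step_seq :: (nat \<Rightarrow> 'd site) measure"
    by (intro prob_space_PiM measure_pmf.prob_space_axioms)
  interpret S: sequence_space "measure_pmf ?p" ..
  interpret P: pair_prob_space "measure_pmf ?p" "step_seq :: (nat \<Rightarrow> 'd site) measure" ..
  have sp: "space step_seq = (UNIV :: (nat \<Rightarrow> 'd site) set)"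
    by (simp add: space_PiM)
  have meas: "(\<lambda>(s, \<omega>). case_nat s \<omega>) \<in> measurable (measure_pmf ?p \<Otimes>\<^sub>M step_seq) step_seq"
    by measurable
  let ?B = "(\<lambda>(s, \<omega>). case_nat s \<omega>) -` A \<inter> space (measure_pmf ?p \<Otimes>\<^sub>M step_seq)"
  have B: "?B \<in> sets (measure_pmf ?p \<Otimes>\<^sub>M step_seq)"
    using meas assms by (rule measurable_sets)
  have "emeasure step_seq A = emeasure (distr (measure_pmf ?p \<Otimes>\<^sub>M step_seq) step_seq (\<lambda>(s, \<omega>). case_nat s \<omega>)) A"
    using S.PiM_iter by simp
  also have "\<dots> = emeasure (measure_pmf ?p \<Otimes>\<^sub>M step_seq) ?B"
    by (rule emeasure_distr[OF meas assms])
  also have "\<dots> = (\<integral>\<^sup>+e. emeasure step_seq (Pair e -` ?B) \<partial>measure_pmf ?p)"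
    by (rule T.emeasure_pair_measure_alt[OF B])
  also have "\<dots> = (\<integral>\<^sup>+e. ennreal (measure step_seq {\<xi>. case_nat e \<xi> \<in> A}) \<partial>measure_pmf ?p)"
    by (intro nn_integral_cong)
       (auto simp: T.emeasure_eq_measure vimage_def space_pair_measure sp intro!: arg_cong[where f="measure step_seq"])
  also have "\<dots> = ennreal (\<integral>e. measure step_seq {\<xi>. case_nat e \<xi> \<in> A} \<partial>measure_pmf ?p)"
    by (intro nn_integral_eq_integral measure_pmf.integrable_const_bound[where B=1]) auto
  finally have "measure step_seq A = (\<integral>e. measure step_seq {\<xi>. case_nat e \<xi> \<in> A} \<partial>measure_pmf ?p)"
    by (simp add: T.emeasure_eq_measure integral_nonneg_AE)
  also have "\<dots> = (\<Sum>e\<in>steps. measure step_seq {\<xi>. case_nat e \<xi> \<in> A}) / card (steps :: 'd site set)"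
    using finite_steps' steps_nonempty' unfolding steps_def
    by (subst integral_pmf_of_set) auto
  finally show ?thesis .
qed

lemma sets_step_seq_avoid [measurable]:
  fixes K :: "'d::finite site set"
  shows "{\<xi>. \<forall>t\<in>T. walk_path x \<xi> t \<notin> K} \<in> sets step_seq"
proof -
  have "{\<xi> \<in> space step_seq. \<forall>t\<in>T. walk_path x \<xi> t \<notin> K} \<in> sets step_seq"
    by measurable
  thus ?thesis by (simp add: space_PiM)
qed

lemma avoid_prob: "measure step_seq {\<xi>. \<forall>t\<in>{..n}. walk_path x \<xi> t \<notin> K} = 1 - hit K n x"
proof (induction n arbitrary: x)
  case 0
  have "prob_space (step_seq :: (nat \<Rightarrow> 'a site) measure)"
    by (intro prob_space_PiM measure_pmf.prob_space_axioms)
  from prob_space.prob_space[OF this] show ?case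
    by (auto simp: walk_path_def space_PiM)
next
  case (Suc n)
  show ?case
  proof (cases "x \<in> K")
    case True
    hence "walk_path x \<xi> 0 \<in> K" for \<xi>
      by (simp add: walk_path_def)
    hence "{\<xi>. \<forall>t\<in>{..Suc n}. walk_path x \<xi> t \<notin> K} = {}"
      by (metis (mono_tags, lifting) atMost_iff empty_Collect_eq zero_le)
    from arg_cong[OF this, of "measure step_seq"] show ?thesis using True by (simp del: atMost_iff)
  next
    case False
    have "walk_path x (case_nat e \<xi>) 0 \<notin> K" for e \<xi>
      using False by (simp add: walk_path_def)
    hence *: "(\<forall>t\<in>{..Suc n}. walk_path x (case_nat e \<xi>) t \<notin> K) \<longleftrightarrow> (\<forall>t\<in>{..n}. walk_path (x + e) \<xi> t \<notin> K)" for e \<xi>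
      by (simp only: atMost_Suc_eq_insert_0 ball_simps walk_path_case_nat image_iff)
         (auto simp: walk_path_case_nat simp del: atMost_iff)
    show ?thesis
      using False by (subst prob_step_seq_iter)
         (auto simp: * Suc avg_def sum_subtractf diff_divide_distrib simp del: atMost_iff)
  qed
qed

lemma avoid_prob_from_1:
  "measure step_seq {\<xi>. \<forall>t\<in>{1..n}. walk_path x \<xi> t \<notin> K} = esc K n x"
proof (cases n)
  case 0
  have "prob_space (step_seq :: (nat \<Rightarrow> 'a site) measure)"
    by (intro prob_space_PiM measure_pmf.prob_space_axioms)
  from prob_space.prob_space[OF this] show ?thesis using 0
    by (auto simp: space_PiM)
next
  case (Suc m)
  have "{1..Suc m} = Suc ` {..m}"
    by (simp add: image_Suc_atMost)
  hence *: "(\<forall>t\<in>{1..Suc m}. walk_path x (case_nat e \<xi>) t \<notin> K) \<longleftrightarrow> (\<forall>t\<in>{..m}. walk_path (x + e) \<xi> t \<notin> K)" for e \<xi>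
    by (simp only: ball_simps) (simp add: walk_path_case_nat del: atMost_iff)
  have "measure step_seq {\<xi>. \<forall>t\<in>{1..Suc m}. walk_path x \<xi> t \<notin> K} =
     (\<Sum>e\<in>steps. measure step_seq {\<xi>. \<forall>t\<in>{..m}. walk_path (x + e) \<xi> t \<notin> K}) / card (steps :: 'a site set)"
    using prob_step_seq_iter[OF sets_step_seq_avoid[where T = "{1..Suc m}" and x = x and K = K]]
    by (simp only: mem_Collect_eq *)
  also have "\<dots> = esc K (Suc m) x"
    by (simp add: avoid_prob avg_def sum_subtractf diff_divide_distrib del: atMost_iff)
  finally show ?thesis unfolding Suc .
qed

text \<open>Continuity from above along the decreasing avoidance events. Both capacity estimates,
  \<open>cap_ge\<close> and \<open>cap_alternating_le\<close>, pass through this limit.\<close>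

lemma esc_tendsto_cap:
  fixes K :: "'d::finite site set"
  shows "(\<lambda>n. \<Sum>x\<in>K. esc K n x) \<longlonglongrightarrow> cap K"
  unfolding cap_def
proof (rule tendsto_sum)
  fix x assume "x \<in> K"
  let ?A = "\<lambda>n. {\<xi>. \<forall>t\<in>{1..n}. walk_path x \<xi> t \<notin> K}"
  interpret prob_space "step_seq :: (nat \<Rightarrow> 'd site) measure"
    by (intro prob_space_PiM measure_pmf.prob_space_axioms)
  have "(\<lambda>n. measure step_seq (?A n)) \<longlonglongrightarrow> measure step_seq (\<Inter>n. ?A n)"
    by (rule finite_Lim_measure_decseq) (auto simp: decseq_def)
  also have "(\<Inter>n. ?A n) = {\<xi>. \<forall>t\<ge>1. walk_path x \<xi> t \<notin> K}"
    by auto (metis One_nat_def Suc_le_eq atLeastAtMost_iff order_refl)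
  also have "\<dots> = walk_path x -` {X \<in> space (srw x). \<forall>t\<ge>1. X t \<notin> K} \<inter> space step_seq"
    by (auto simp: srw_def space_PiM)
  also have "measure step_seq \<dots> = measure (srw x) {X \<in> space (srw x). \<forall>t\<ge>1. X t \<notin> K}"
    using escape_event_measurable[of x K] unfolding srw_def
    by (subst measure_distr) auto
  finally show "(\<lambda>n. esc K n x) \<longlonglongrightarrow> measure (srw x) {X \<in> space (srw x). \<forall>t\<ge>1. X t \<notin> K}"
    by (simp only: avoid_prob_from_1)
qed

subsection \<open>Reversibility\<close>

lemma uminus_steps: "uminus ` steps = steps"
proof -
  have "- e \<in> steps" if "e \<in> steps" for e :: "'a site"
    using that by (simp add: steps_def adjacent_def)
  thus ?thesis
    by (auto intro!: image_eqI[where x = "- x" for x])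
qed

text \<open>Translating the summation by a step \<open>e\<close> moves it from one function to the
  other as \<open>- e\<close>, and the set of steps is symmetric. Finite support makes the
  translation legitimate on a finite sum.\<close>

lemma avg_symmetric:
  assumes F: "finite F" and f: "\<And>x. x \<notin> F \<Longrightarrow> f x = 0" and g: "\<And>x. x \<notin> F \<Longrightarrow> g x = 0"
  shows "(\<Sum>x\<in>F. f x * avg g x) = (\<Sum>x\<in>F. avg f x * g x)"
proof -
  have shift: "(\<Sum>x\<in>F. f x * g (x + e)) = (\<Sum>x\<in>F. f (x + - e) * g x)" for e
  proof -
    have "(\<Sum>x\<in>F. f x * g (x + e)) = (\<Sum>x\<in>{x\<in>F. x + e \<in> F}. f x * g (x + e))"
      using F g by (intro sum.mono_neutral_right) auto
    also have "\<dots> = (\<Sum>x\<in>{x\<in>F. x + - e \<in> F}. f (x + - e) * g x)"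
      by (rule sum.reindex_bij_witness[of _ "\<lambda>x. x + - e" "\<lambda>x. x + e"]) auto
    also have "\<dots> = (\<Sum>x\<in>F. f (x + - e) * g x)"
      using F f by (intro sum.mono_neutral_left) auto
    finally show ?thesis .
  qed
  have "(\<Sum>x\<in>F. f x * avg g x) = (\<Sum>e\<in>steps. \<Sum>x\<in>F. f x * g (x + e)) / card (steps :: 'a site set)"
    by (subst sum.swap) (simp add: avg_def sum_divide_distrib sum_distrib_left)
  also have "(\<Sum>e\<in>steps. \<Sum>x\<in>F. f x * g (x + e)) = (\<Sum>e\<in>uminus ` steps. \<Sum>x\<in>F. f (x + e) * g x)"
    by (subst sum.reindex) (auto simp: shift)
  also have "\<dots> / card (steps :: 'a site set) = (\<Sum>x\<in>F. avg f x * g x)"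
    unfolding uminus_steps
    by (subst sum.swap) (simp add: avg_def sum_divide_distrib sum_distrib_right)
  finally show ?thesis .
qed

lemma finite_support_hit: "finite K \<Longrightarrow> finite {x. hit K n x \<noteq> 0}"
proof (induction n)
  case 0
  have "{x. hit K 0 x \<noteq> 0} \<subseteq> K" by auto
  thus ?case using 0 finite_subset by blast
next
  case (Suc n)
  have "x \<in> K \<union> (\<Union>e\<in>steps. (\<lambda>y. y - e) ` {x. hit K n x \<noteq> 0})" if "hit K (Suc n) x \<noteq> 0" for x
  proof (cases "x \<in> K")
    case False
    hence "(\<Sum>e\<in>steps. hit K n (x + e)) \<noteq> 0" using that by (auto simp: avg_def)
    then obtain e where "e \<in> steps" "hit K n (x + e) \<noteq> 0"
      by (rule sum.not_neutral_contains_not_neutral)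
    thus ?thesis by (auto intro!: bexI[of _ e] image_eqI[of _ _ "x + e"])
  qed auto
  hence "{x. hit K (Suc n) x \<noteq> 0} \<subseteq> K \<union> (\<Union>e\<in>steps. (\<lambda>y. y - e) ` {x. hit K n x \<noteq> 0})"
    by blast
  thus ?case using Suc by (elim finite_subset) auto
qed

text \<open>The discrete Poisson equation: the hitting function minus the average of its predecessor
  is carried by \<open>K\<close>, where it equals the escape probability.\<close>

lemma esc_eq_hit:
  "of_bool (x \<in> K) * esc K n x = hit K n x - (if n = 0 then 0 else avg (hit K (n - 1)) x)"
  by (cases n) auto

text \<open>
  A finite-horizon form of the sweeping identity
  \<open>cap K' = (\<Sum>x\<in>K. e\<^sub>K x * P\<^sub>x[hit K'])\<close>: both sides come from the
  self-adjointness of the generator applied to the two hitting functions.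
\<close>

lemma sweeping:
  assumes K: "finite K" and K': "K' \<subseteq> K"
  shows "(\<Sum>j\<le>n. \<Sum>x\<in>K. esc K j x * hit K' (n - j) x) = (\<Sum>j\<le>n. \<Sum>x\<in>K'. esc K' j x)"
proof -
  have K'f: "finite K'" using K K' finite_subset by blast
  \<comment> \<open>A finite region outside of which all the hitting functions up to the horizon
    vanish, so that \<open>avg_symmetric\<close> applies to each pair of them.\<close>
  define F where "F = K \<union> (\<Union>j\<le>n. {x. hit K j x \<noteq> 0}) \<union> (\<Union>j\<le>n. {x. hit K' j x \<noteq> 0})"
  have F: "finite F"
    unfolding F_def using K K'f finite_support_hit by auto
  have KF: "K \<subseteq> F" by (auto simp: F_def)
  have h0: "hit K j x = 0" "hit K' j x = 0" if "x \<notin> F" "j \<le> n" for x j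
    using that by (auto simp: F_def)
  define D where "D j k = (\<Sum>x\<in>F. hit K j x * hit K' k x)" for j k
  define B where "B j k = (\<Sum>x\<in>F. avg (hit K j) x * hit K' k x)" for j k
  have B': "B j k = (\<Sum>x\<in>F. hit K j x * avg (hit K' k) x)" if "j \<le> n" "k \<le> n" for j k
    unfolding B_def using that h0 F by (intro avg_symmetric[symmetric]) auto
  have 1: "(\<Sum>x\<in>K. esc K j x * hit K' (n - j) x) = D j (n - j) - (if j = 0 then 0 else B (j - 1) (n - j))"
    if "j \<le> n" for j
  proof -
    have "(\<Sum>x\<in>K. esc K j x * hit K' (n - j) x) = (\<Sum>x\<in>F. (of_bool (x \<in> K) * esc K j x) * hit K' (n - j) x)"
      using F KF by (intro sum.mono_neutral_cong_left) auto
    thus ?thesis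
      by (auto simp: esc_eq_hit D_def B_def left_diff_distrib sum_subtractf)
  qed
  have 2: "(\<Sum>x\<in>K'. esc K' (n - j) x) = D j (n - j) - (if n - j = 0 then 0 else B j (n - j - 1))"
    if "j \<le> n" for j
  proof -
    have "(\<Sum>x\<in>K'. esc K' (n - j) x) = (\<Sum>x\<in>F. hit K j x * (of_bool (x \<in> K') * esc K' (n - j) x))"
      using F KF K' by (intro sum.mono_neutral_cong_left) auto
    thus ?thesis using that
      by (auto simp: esc_eq_hit D_def B' right_diff_distrib sum_subtractf)
  qed
  \<comment> \<open>The two horizons always add up to \<open>n\<close>. Taking one averaging step
    off the first or off the second function yields the same family of terms, shifted by one in
    \<open>j\<close>; this is why the identity needs the sum over \<open>j\<close>.\<close>
  have 3: "(\<Sum>j\<le>n. if j = 0 then 0 else B (j - 1) (n - j)) = (\<Sum>j\<le>n. if n - j = 0 then 0 else B j (n - j - 1))"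
    (is "?L = ?R")
  proof -
    have "?L = (\<Sum>j\<in>{1..n}. B (j - 1) (n - j))"
      by (intro sum.mono_neutral_cong_right) auto
    also have "\<dots> = (\<Sum>j\<in>{..<n}. B j (n - j - 1))"
      by (rule sum.reindex_bij_witness[of _ Suc "\<lambda>j. j - 1"]) auto
    also have "\<dots> = ?R"
      by (intro sum.mono_neutral_cong_left) auto
    finally show ?thesis .
  qed
  have "(\<Sum>j\<le>n. \<Sum>x\<in>K'. esc K' j x) = (\<Sum>j\<le>n. \<Sum>x\<in>K'. esc K' (n - j) x)"
    by (rule sum.reindex_bij_witness[of _ "\<lambda>j. n - j" "\<lambda>j. n - j"]) auto
  also have "\<dots> = (\<Sum>j\<le>n. D j (n - j) - (if n - j = 0 then 0 else B j (n - j - 1)))"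
    by (intro sum.cong refl 2) auto
  also have "\<dots> = (\<Sum>j\<le>n. D j (n - j) - (if j = 0 then 0 else B (j - 1) (n - j)))"
    by (simp only: sum_subtractf 3)
  also have "\<dots> = (\<Sum>j\<le>n. \<Sum>x\<in>K. esc K j x * hit K' (n - j) x)"
    by (intro sum.cong refl 1[symmetric]) auto
  finally show ?thesis by simp
qed

subsection \<open>A superharmonic function\<close>

lemma steps_eq: "(steps :: 'd::finite site set) = range (\<lambda>i. axis i 1) \<union> range (\<lambda>i. axis i (-1))"
proof (intro equalityI subsetI)
  fix e :: "'d site" assume "e \<in> steps"
  hence s: "(\<Sum>i\<in>UNIV. \<bar>e $ i\<bar>) = 1" by (simp add: steps_def adjacent_def)
  then obtain i where i: "e $ i \<noteq> 0"
    by (metis (no_types, lifting) abs_zero sum.neutral zero_neq_one)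
  have s': "(\<Sum>j\<in>UNIV. \<bar>e $ j\<bar>) = \<bar>e $ i\<bar> + (\<Sum>j\<in>UNIV - {i}. \<bar>e $ j\<bar>)"
    by (subst sum.remove[of _ i]) auto
  have nn: "0 \<le> (\<Sum>j\<in>UNIV - {i}. \<bar>e $ j\<bar>)" by (intro sum_nonneg) auto
  have a: "\<bar>e $ i\<bar> = 1" and "(\<Sum>j\<in>UNIV - {i}. \<bar>e $ j\<bar>) = 0"
    using s s' nn i by linarith+
  hence "\<forall>j\<in>UNIV - {i}. \<bar>e $ j\<bar> = 0"
    by (subst (asm) sum_nonneg_eq_0_iff) auto
  hence "e = axis i (e $ i)"
    by (auto simp: vec_eq_iff axis_def)
  moreover have "e $ i = 1 \<or> e $ i = -1" using a by linarith
  ultimately show "e \<in> range (\<lambda>i. axis i 1) \<union> range (\<lambda>i. axis i (-1))" by auto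
next
  fix e :: "'d site" assume "e \<in> range (\<lambda>i. axis i 1) \<union> range (\<lambda>i. axis i (-1))"
  thus "e \<in> steps"
    by (auto simp: steps_def adjacent_def axis_def if_distrib[of abs] if_distrib[of uminus] cong: if_cong)
qed

lemma sum_steps:
  fixes f :: "'d::finite site \<Rightarrow> 'a::comm_monoid_add"
  shows "(\<Sum>e\<in>steps. f e) = (\<Sum>i\<in>UNIV. f (axis i 1) + f (axis i (-1)))"
proof -
  have "inj (\<lambda>i. axis i c :: 'd site)" if "c \<noteq> 0" for c
    using that by (auto simp: inj_on_def axis_eq_axis)
  moreover have "range (\<lambda>i. axis i 1 :: 'd site) \<inter> range (\<lambda>i. axis i (-1)) = {}"
    by (auto simp: axis_eq_axis)
  ultimately show ?thesis
    unfolding steps_eq by (simp add: sum.union_disjoint sum.reindex sum.distrib)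
qed

lemma card_steps: "card (steps :: 'd::finite site set) = 2 * CARD('d)"
  using sum_steps[of "\<lambda>_::'d site. 1::nat"] by simp

definition normsq :: "'d::finite site \<Rightarrow> real" where
  "normsq x = (\<Sum>i\<in>UNIV. (of_int (x $ i))\<^sup>2)"

text \<open>In the continuum \<open>1 / |x|\<close> is harmonic in dimension 3 and superharmonic in
  higher dimensions, so this one function serves all dimensions \<ge> 3.\<close>

definition pot :: "'d::finite site \<Rightarrow> real" where
  "pot x = 1 / sqrt (normsq x + 5)"

lemma normsq_nonneg [simp]: "0 \<le> normsq x"
  by (simp add: normsq_def sum_nonneg)

lemma pot_pos: "0 < pot x"
  using normsq_nonneg[of x] by (simp add: pot_def add_nonneg_pos)

lemma normsq_axis_add: "normsq (x + axis i c) = normsq x + 2 * of_int c * of_int (x $ i) + (of_int c)\<^sup>2"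
proof -
  have "normsq (x + axis i c) = (\<Sum>j\<in>UNIV. (of_int (x $ j))\<^sup>2 + (if j = i then 2 * of_int c * of_int (x $ i) + (of_int c)\<^sup>2 else 0))"
    unfolding normsq_def by (intro sum.cong) (auto simp: axis_def power2_eq_square algebra_simps)
  thus ?thesis by (simp add: sum.distrib normsq_def)
qed

text \<open>The odd terms cancel and the expansion starts with 2 + 3/4 t^2 + 35/64 t^4, so the
  coefficient 1 leaves room for the tail. Squaring the sum leaves only functions of
  \<open>v = t\<^sup>2\<close>, which are bounded by polynomials.\<close>

lemma inverse_sqrt_pair_le:
  fixes t :: real
  assumes "\<bar>t\<bar> \<le> 1/2"
  shows "1 / sqrt (1 + t) + 1 / sqrt (1 - t) \<le> 2 + 3/4 * t^2 + t^4"
proof -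
  define v where "v = t\<^sup>2"
  have v: "0 \<le> v" "v \<le> 1/4"
    using assms power_mono[of "\<bar>t\<bar>" "1/2" 2] by (auto simp: v_def power2_eq_square)
  have pos: "1 + t > 0" "1 - t > 0" using assms by linarith+
  have sq: "sqrt (1 + t) * sqrt (1 - t) = sqrt (1 - v)"
    by (simp add: real_sqrt_mult[symmetric] v_def power2_eq_square algebra_simps)
  have 1: "1 / sqrt (1 - v) \<le> 1 + v/2 + v^2/2"
  proof -
    have "1 \<le> (1 + v/2 + v^2/2)^2 * (1 - v)"
    proof -
      have "(1 + v/2 + v^2/2)^2 * (1 - v) = 1 + v^2 * (1/4 - 3/4 * v - v^2/4 - v^3/4)"
        by (simp add: power2_eq_square power3_eq_cube algebra_simps diff_divide_distrib)
      moreover have "v^2 \<le> 1/16" "v^3 \<le> 1/64"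
        using power_mono[OF v(2) v(1), of 2] power_mono[OF v(2) v(1), of 3] by (auto simp: power_divide)
      hence "1/4 - 3/4 * v - v^2/4 - v^3/4 \<ge> 0" using v by linarith
      ultimately show ?thesis by simp
    qed
    hence "1 / (1 - v) \<le> (1 + v/2 + v^2/2)^2" using v by (simp add: divide_le_eq)
    hence "sqrt (1 / (1 - v)) \<le> 1 + v/2 + v^2/2"
      using v by (intro real_le_lsqrt) auto
    thus ?thesis by (simp add: real_sqrt_divide)
  qed
  have 2: "1 / (1 - v) \<le> 1 + v + 4/3 * v^2"
  proof -
    have "(1 + v + 4/3 * v^2) * (1 - v) = 1 + v^2 * (1/3 - 4/3 * v)"
      by (simp add: power2_eq_square algebra_simps diff_divide_distrib)
    moreover have "0 \<le> v^2 * (1/3 - 4/3 * v)" using v by (intro mult_nonneg_nonneg) auto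
    ultimately show ?thesis using v by (simp add: divide_le_eq)
  qed
  have "(1 / sqrt (1 + t) + 1 / sqrt (1 - t))^2 = 1 / (1 + t) + 1 / (1 - t) + 2 / (sqrt (1 + t) * sqrt (1 - t))"
    using pos by (simp add: power2_sum power_divide)
  also have "1 / (1 + t) + 1 / (1 - t) = 2 / (1 - v)"
    using pos by (simp add: v_def power2_eq_square field_simps)
  also have "2 / (1 - v) + 2 / (sqrt (1 + t) * sqrt (1 - t)) \<le> 2 * (1 + v + 4/3 * v^2) + 2 * (1 + v/2 + v^2/2)"
    using 1 2 unfolding sq by simp
  also have "\<dots> \<le> (2 + 3/4 * v + v^2)^2"
  proof -
    have "(2 + 3/4 * v + v^2)^2 = 4 + 3 * v + (4 + 9/16) * v^2 + 3/2 * v^3 + v^4"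
      by (simp add: power2_eq_square power3_eq_cube power4_eq_xxxx algebra_simps)
    moreover have "2 * (1 + v + 4/3 * v^2) + 2 * (1 + v/2 + v^2/2) = 4 + 3 * v + 11/3 * v^2"
      by (simp add: algebra_simps)
    moreover have "0 \<le> 3/2 * v^3" "0 \<le> v^4" using v by auto
    moreover have "11/3 * v^2 \<le> (4 + 9/16) * v^2" by (intro mult_right_mono) auto
    ultimately show ?thesis by linarith
  qed
  finally have "1 / sqrt (1 + t) + 1 / sqrt (1 - t) \<le> 2 + 3/4 * v + v^2"
    by (rule power2_le_imp_le) (use v in auto)
  thus ?thesis by (simp add: v_def power_mult[symmetric])
qed

text \<open>
  The constant 5 in \<open>pot\<close> makes the negative second-order term dominate the fourth-order
  Taylor remainder of the discrete Laplacian.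
\<close>

lemma avg_pot_le:
  fixes x :: "'d::finite site"
  assumes d: "3 \<le> CARD('d)"
  shows "avg pot x \<le> pot x"
proof -
  \<comment> \<open>A step changes \<open>normsq\<close> by 1 \<plusminus> 2 \<open>x $ i\<close>.
    With this centre the values at the two neighbours along axis \<open>i\<close> are those of
    \<open>1 / sqrt (R * (1 + t))\<close> at \<open>t = t i\<close> and
    \<open>t = - t i\<close>.\<close>
  define R where "R = normsq x + 6"
  have R: "R \<ge> 6" by (simp add: R_def)
  define t where "t i = 2 * of_int (x $ i) / R" for i
  have le: "(of_int (x $ i))\<^sup>2 \<le> normsq x" for i
    unfolding normsq_def by (rule member_le_sum) auto
  have t: "\<bar>t i\<bar> \<le> 1/2" for i
  proof -
    define a where "a = \<bar>real_of_int (x $ i)\<bar>"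
    have "0 \<le> (a - 2)\<^sup>2" by simp
    hence "4 * a \<le> a\<^sup>2 + 4" by (simp add: power2_diff)
    also have "\<dots> \<le> R" using le[of i] by (simp add: R_def a_def)
    finally show ?thesis using R by (simp add: t_def abs_mult a_def)
  qed
  have p: "pot (x + axis i c) = 1 / sqrt R * (1 / sqrt (1 + of_int c * t i))" if "c = 1 \<or> c = -1" for i c
  proof -
    have "normsq (x + axis i c) + 5 = R * (1 + of_int c * t i)"
    proof -
      have "normsq x = R - 6" by (simp add: R_def)
      thus ?thesis using that R by (auto simp: normsq_axis_add t_def field_simps)
    qed
    thus ?thesis using R by (simp add: pot_def real_sqrt_mult)
  qed
  have t2: "(\<Sum>i\<in>UNIV. (t i)^2) = 4 * (R - 6) / R^2"
    unfolding t_def R_def normsq_def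
    by (simp add: power_mult_distrib power_divide sum_divide_distrib sum_distrib_left)
  have t4: "(\<Sum>i\<in>UNIV. (t i)^4) \<le> 16 / R^2"
  proof -
    have "(t i)^4 \<le> (t i)^2 * (4 / R)" for i
    proof -
      have "(t i)^2 = 4 * (of_int (x $ i))\<^sup>2 / R^2"
        by (simp add: t_def power_mult_distrib power_divide)
      also have "\<dots> \<le> 4 * R / R^2" using le[of i] R by (intro divide_right_mono) (auto simp: R_def)
      also have "\<dots> = 4 / R" using R by (simp add: power2_eq_square)
      finally have "(t i)^2 \<le> 4 / R" .
      hence "(t i)^2 * (t i)^2 \<le> (t i)^2 * (4 / R)" by (intro mult_left_mono) auto
      thus ?thesis by (simp add: power2_eq_square power4_eq_xxxx mult.assoc)
    qed
    hence "(\<Sum>i\<in>UNIV. (t i)^4) \<le> (\<Sum>i\<in>UNIV. (t i)^2) * (4 / R)"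
      unfolding sum_distrib_right by (intro sum_mono)
    also have "\<dots> = 16 * (R - 6) / R / R^2" unfolding t2 using R by (simp add: field_simps)
    also have "\<dots> \<le> 16 / R^2" using R by (intro divide_right_mono) (auto simp: field_simps)
    finally show ?thesis .
  qed
  have "avg pot x = (\<Sum>i\<in>UNIV. 1 / sqrt R * (1 / sqrt (1 + t i) + 1 / sqrt (1 - t i))) / (2 * real CARD('d))"
    unfolding avg_def sum_steps card_steps by (simp add: p distrib_left)
  also have "\<dots> \<le> (\<Sum>i\<in>UNIV. 1 / sqrt R * (2 + 3/4 * (t i)^2 + (t i)^4)) / (2 * real CARD('d))"
    using R t by (intro divide_right_mono sum_mono mult_left_mono inverse_sqrt_pair_le) auto
  also have "\<dots> = 1 / sqrt R * (2 * real CARD('d) + 3/4 * (\<Sum>i\<in>UNIV. (t i)^2) + (\<Sum>i\<in>UNIV. (t i)^4)) / (2 * real CARD('d))"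
    unfolding sum_distrib_left[symmetric] sum.distrib by simp
  \<comment> \<open>The dimension enters here: second and fourth order terms together are at most
    3/R, hence at most d/R. The resulting factor 1 + 1/(2R) is then absorbed by passing from
    \<open>R\<close> to \<open>R - 1 = normsq x + 5\<close>.\<close>
  also have "\<dots> \<le> 1 / sqrt R * (2 * real CARD('d) + real CARD('d) / R) / (2 * real CARD('d))"
  proof (intro divide_right_mono mult_left_mono)
    have "3/4 * (\<Sum>i\<in>UNIV. (t i)^2) + (\<Sum>i\<in>UNIV. (t i)^4) \<le> 3/4 * (4 * (R - 6) / R^2) + 16 / R^2"
      using t4 t2 by simp
    also have "\<dots> = (3 * R - 2) / R^2" using R by (simp add: field_simps)
    also have "\<dots> \<le> 3 * R / R^2" by (intro divide_right_mono) auto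
    also have "\<dots> = 3 / R" using R by (simp add: power2_eq_square)
    also have "\<dots> \<le> real CARD('d) / R" using d R by (intro divide_right_mono) auto
    finally show "2 * real CARD('d) + 3/4 * (\<Sum>i\<in>UNIV. (t i)^2) + (\<Sum>i\<in>UNIV. (t i)^4) \<le> 2 * real CARD('d) + real CARD('d) / R"
      by simp
  qed (use R in auto)
  also have "\<dots> = 1 / sqrt R * (1 + 1 / (2 * R))"
  proof -
    have "2 * real CARD('d) + real CARD('d) / R = 2 * real CARD('d) * (1 + 1 / (2 * R))"
      using R by (simp add: field_simps)
    thus ?thesis using d by simp
  qed
  also have "\<dots> \<le> 1 / sqrt (R - 1)"
  proof -
    have "(R - 1) * (1 + 1 / (2 * R))^2 \<le> R"
      using R by (simp add: power2_eq_square field_simps)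
    hence "sqrt ((R - 1) * (1 + 1 / (2 * R))^2) \<le> sqrt R" by simp
    hence "sqrt (R - 1) * (1 + 1 / (2 * R)) \<le> sqrt R" using R by (simp add: real_sqrt_mult)
    thus ?thesis using R by (simp add: field_simps)
  qed
  also have "\<dots> = pot x" by (simp add: pot_def R_def)
  finally show ?thesis .
qed

lemma avg_pot_0: "avg pot (0 :: 'd::finite site) = 1 / sqrt 6"
proof -
  have "pot (0 + e) = 1 / sqrt 6" if "e \<in> steps" for e :: "'d site"
  proof -
    have "normsq (0 :: 'd site) = 0" by (simp add: normsq_def)
    hence "normsq (0 + e) = 1"
      using that normsq_axis_add[of "0 :: 'd site" _ 1] normsq_axis_add[of "0 :: 'd site" _ "-1"]
      unfolding steps_eq by auto
    thus ?thesis by (simp add: pot_def)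
  qed
  thus ?thesis by (simp add: avg_def)
qed

lemma pot_0: "pot 0 = 1 / sqrt 5"
  by (simp add: pot_def normsq_def)

text \<open>The maximum principle, as an induction on the horizon.\<close>

lemma hit_le_superharmonic:
  assumes sh: "\<And>x. avg W x \<le> W x" and nn: "\<And>x. 0 \<le> W x" and K: "\<And>x. x \<in> K \<Longrightarrow> 1 \<le> W x"
  shows "hit K n x \<le> W x"
proof (induction n arbitrary: x)
  case 0
  show ?case using K nn by (auto simp: of_bool_def)
next
  case (Suc n)
  have "avg (hit K n) x \<le> avg W x" by (intro avg_mono Suc)
  thus ?case using K sh[of x] by (auto intro: order_trans)
qed

text \<open>The sum of the potentials normalised to 1 at their centres dominates the hitting
  probability of \<open>S\<close>. After one step from \<open>x\<close> the term centred at
  \<open>x\<close> has dropped from 1 to \<open>sqrt 5 / sqrt 6\<close>, and the others contribute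
  at most \<open>\<delta>\<close>; what remains is a lower bound for the escape probability.\<close>

lemma cap_ge:
  fixes S :: "'d::finite site set"
  assumes d: "3 \<le> CARD('d)" and S: "finite S"
    and spread: "\<And>x. x \<in> S \<Longrightarrow> (\<Sum>y\<in>S - {x}. sqrt 5 * pot (x - y)) \<le> \<delta>"
  shows "(1 - sqrt 5 / sqrt 6 - \<delta>) * card S \<le> cap S"
proof (rule LIMSEQ_le_const[OF esc_tendsto_cap])
  define W where "W x = (\<Sum>y\<in>S. sqrt 5 * pot (x - y))" for x
  have avgW: "avg W x = (\<Sum>y\<in>S. sqrt 5 * avg pot (x - y))" for x
    unfolding W_def avg_sum avg_cmult avg_translate[of pot] ..
  have "hit S n x \<le> W x" for n x
  proof (rule hit_le_superharmonic)
    show "avg W x \<le> W x" for x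
      unfolding avgW unfolding W_def by (intro sum_mono mult_left_mono avg_pot_le d) auto
    show "0 \<le> W x" for x
      unfolding W_def by (intro sum_nonneg mult_nonneg_nonneg) (auto intro: less_imp_le pot_pos)
    fix x assume "x \<in> S"
    have "sqrt 5 * pot (x - x) \<le> W x" unfolding W_def
      by (rule member_le_sum[where f="\<lambda>y. sqrt 5 * pot (x - y)", OF \<open>x \<in> S\<close>])
         (simp_all add: S mult_nonneg_nonneg less_imp_le[OF pot_pos])
    thus "1 \<le> W x" by (simp add: pot_0)
  qed
  hence hit: "avg (hit S n) x \<le> avg W x" for n x by (intro avg_mono)
  have "1 - sqrt 5 / sqrt 6 - \<delta> \<le> esc S (Suc n) x" if x: "x \<in> S" for n x
  proof -
    have "avg W x = sqrt 5 * avg pot (0 :: 'd site) + (\<Sum>y\<in>S - {x}. sqrt 5 * avg pot (x - y))"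
      unfolding avgW using S x by (subst sum.remove[of _ x]) auto
    also have "(\<Sum>y\<in>S - {x}. sqrt 5 * avg pot (x - y)) \<le> (\<Sum>y\<in>S - {x}. sqrt 5 * pot (x - y))"
      by (intro sum_mono mult_left_mono avg_pot_le d) auto
    also have "\<dots> \<le> \<delta>" by (rule spread[OF x])
    finally show ?thesis using hit[of n x] by (simp add: avg_pot_0)
  qed
  hence "(\<Sum>x\<in>S. (1 - sqrt 5 / sqrt 6 - \<delta>)) \<le> (\<Sum>x\<in>S. esc S n x)" if "1 \<le> n" for n
    using that by (intro sum_mono) (metis Suc_pred' le_trans less_eq_Suc_le One_nat_def)
  thus "\<exists>N. \<forall>n\<ge>N. (1 - sqrt 5 / sqrt 6 - \<delta>) * card S \<le> (\<Sum>x\<in>S. esc S n x)"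
    by (auto simp: mult.commute)
qed

subsection \<open>The number of obstacles hit by the walk\<close>

text \<open>Expansion of the product of \<open>(1 - \<rho>) + \<rho>\<close> over \<open>R\<close>.
  The same expansion of the product of
  \<open>\<rho> + (1 - \<rho>) * of_bool (z is not hit)\<close>, which is \<open>\<rho>\<close> to
  the number of hit \<open>z\<close>, explains the definition of \<open>hits_mgf\<close>. The
  weights are signed for \<open>\<rho> > 1\<close>.\<close>

lemma sum_Pow_weights:
  fixes \<rho> :: real
  assumes "finite R"
  shows "(\<Sum>A\<in>Pow R. \<rho> ^ card (R - A) * (1 - \<rho>) ^ card A) = 1"
  using prod_add[OF assms, of "\<lambda>_. 1 - \<rho>" "\<lambda>_. \<rho>"] by (simp add: mult.commute)

text \<open>\<open>hits_mgf \<rho> K R n x\<close> is the expectation of \<open>\<rho> ^ N\<close>, where \<open>N\<close> is the number of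
  \<open>z \<in> R\<close> such that the walk from \<open>x\<close> hits \<open>K z\<close> up to time \<open>n\<close>.\<close>

definition hits_mgf :: "real \<Rightarrow> ('i \<Rightarrow> 'd::finite site set) \<Rightarrow> 'i set \<Rightarrow> nat \<Rightarrow> 'd site \<Rightarrow> real" where
  "hits_mgf \<rho> K R n x = (\<Sum>A\<in>Pow R. \<rho> ^ card (R - A) * (1 - \<rho>) ^ card A * (1 - hit (\<Union>z\<in>A. K z) n x))"

text \<open>The obstacle \<open>z\<close> is hit at time 0: it contributes one factor
  \<open>\<rho>\<close> and can be removed from the family.\<close>

lemma hits_mgf_in:
  assumes R: "finite R" "z \<in> R" and x: "x \<in> K z"
  shows "hits_mgf \<rho> K R n x = \<rho> * hits_mgf \<rho> K (R - {z}) n x"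
proof -
  have "hits_mgf \<rho> K R n x = (\<Sum>A\<in>Pow (R - {z}). \<rho> ^ card (R - A) * (1 - \<rho>) ^ card A * (1 - hit (\<Union>z\<in>A. K z) n x))"
    unfolding hits_mgf_def
  proof (rule sum.mono_neutral_right)
    show "\<forall>A\<in>Pow R - Pow (R - {z}). \<rho> ^ card (R - A) * (1 - \<rho>) ^ card A * (1 - hit (\<Union>z\<in>A. K z) n x) = 0"
    proof
      fix A assume "A \<in> Pow R - Pow (R - {z})"
      hence "x \<in> (\<Union>z\<in>A. K z)" using x by auto
      thus "\<rho> ^ card (R - A) * (1 - \<rho>) ^ card A * (1 - hit (\<Union>z\<in>A. K z) n x) = 0" by simp
    qed
  qed (use R in auto)
  also have "\<dots> = \<rho> * hits_mgf \<rho> K (R - {z}) n x"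
    unfolding hits_mgf_def sum_distrib_left
  proof (intro sum.cong refl)
    fix A assume "A \<in> Pow (R - {z})"
    hence "R - A = insert z (R - {z} - A)" "z \<notin> R - {z} - A" using R by auto
    hence "card (R - A) = Suc (card (R - {z} - A))" using R by simp
    thus "\<rho> ^ card (R - A) * (1 - \<rho>) ^ card A * (1 - hit (\<Union>z\<in>A. K z) n x) =
        \<rho> * (\<rho> ^ card (R - {z} - A) * (1 - \<rho>) ^ card A * (1 - hit (\<Union>z\<in>A. K z) n x))"
      by simp
  qed
  finally show ?thesis .
qed

text \<open>Off the obstacles nothing is counted at time 0, so the moment is an average over the
  first step.\<close>

lemma hits_mgf_Suc:
  assumes x: "x \<notin> (\<Union>z\<in>R. K z)"
  shows "hits_mgf \<rho> K R (Suc n) x = avg (hits_mgf \<rho> K R n) x"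
proof -
  have "avg (hits_mgf \<rho> K R n) x =
    (\<Sum>A\<in>Pow R. \<rho> ^ card (R - A) * (1 - \<rho>) ^ card A * (1 - avg (hit (\<Union>z\<in>A. K z) n) x))"
    unfolding hits_mgf_def avg_sum avg_cmult avg_diff avg_const ..
  also have "\<dots> = hits_mgf \<rho> K R (Suc n) x"
    unfolding hits_mgf_def using x by (intro sum.cong) auto
  finally show ?thesis ..
qed

lemma hits_mgf_0:
  assumes "finite R" "x \<notin> (\<Union>z\<in>R. K z)"
  shows "hits_mgf \<rho> K R 0 x = 1"
proof -
  have "hits_mgf \<rho> K R 0 x = (\<Sum>A\<in>Pow R. \<rho> ^ card (R - A) * (1 - \<rho>) ^ card A)"
    unfolding hits_mgf_def using assms by (intro sum.cong) auto
  thus ?thesis by (simp add: sum_Pow_weights assms)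
qed

text \<open>\<open>W z\<close> is a superharmonic majorant of the probability of hitting
  \<open>K z\<close>. By \<open>sparse\<close>, a walk that stands on one obstacle hits at most
  \<open>\<delta>\<close> further ones in expectation.\<close>

locale sparse_obstacles =
  fixes K :: "'i \<Rightarrow> 'd::finite site set" and S :: "'i set" and W :: "'i \<Rightarrow> 'd site \<Rightarrow> real"
    and \<rho> \<delta> :: real and k :: nat
  assumes finite_S: "finite S" and finite_K: "\<And>z. finite (K z)" and card_K: "\<And>z. card (K z) \<le> k"
    and superharmonic: "\<And>z x. avg (W z) x \<le> W z x"
    and W_nonneg: "\<And>z x. 0 \<le> W z x"
    and W_ge_1: "\<And>z x. x \<in> K z \<Longrightarrow> 1 \<le> W z x"
    and sparse: "\<And>z x. z \<in> S \<Longrightarrow> x \<in> K z \<Longrightarrow> (\<Sum>z'\<in>S - {z}. W z' x) \<le> \<delta>"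
    and lambda: "1 \<le> \<rho>" "\<rho> * \<delta> \<le> 1/2"
begin

text \<open>The right-hand side is a Lyapunov function for the recursion of \<open>hits_mgf\<close>.\<close>

lemma hits_mgf_le:
  "R \<subseteq> S \<Longrightarrow> hits_mgf \<rho> K R n x \<le> 1 + 2 * (\<rho> - 1) * (\<Sum>z\<in>R. W z x)"
  "R \<subseteq> S \<Longrightarrow> z \<in> R \<Longrightarrow> x \<in> K z \<Longrightarrow> hits_mgf \<rho> K R n x \<le> 1 + 2 * (\<rho> - 1)"
proof -
  \<comment> \<open>The factor 2 in the bound is what reproduces itself: \<open>\<rho> * (1 + 2 *
    (\<rho> - 1) * \<delta>) \<le> \<rho> + (\<rho> - 1)\<close> by the assumption on
    \<open>\<rho> * \<delta>\<close>.\<close>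
  have in_case: "hits_mgf \<rho> K R n x \<le> 1 + 2 * (\<rho> - 1)"
    if IH: "hits_mgf \<rho> K (R - {z}) n x \<le> 1 + 2 * (\<rho> - 1) * (\<Sum>z'\<in>R - {z}. W z' x)"
      and R: "R \<subseteq> S" "z \<in> R" "x \<in> K z" for R z n x
  proof -
    have fin: "finite R" using R finite_S finite_subset by blast
    have "(\<Sum>z'\<in>R - {z}. W z' x) \<le> (\<Sum>z'\<in>S - {z}. W z' x)"
      using R finite_S W_nonneg by (intro sum_mono2) auto
    also have "\<dots> \<le> \<delta>" using R by (intro sparse) auto
    finally have s: "(\<Sum>z'\<in>R - {z}. W z' x) \<le> \<delta>" .
    have "hits_mgf \<rho> K R n x \<le> \<rho> * (1 + 2 * (\<rho> - 1) * (\<Sum>z'\<in>R - {z}. W z' x))"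
      unfolding hits_mgf_in[where K = K and z = z and x = x, OF fin R(2,3)] using lambda IH by (intro mult_left_mono) auto
    also have "\<dots> \<le> \<rho> * (1 + 2 * (\<rho> - 1) * \<delta>)"
      using lambda s by (intro mult_left_mono add_left_mono) auto
    also have "\<dots> = \<rho> + 2 * (\<rho> - 1) * (\<rho> * \<delta>)" by (simp add: algebra_simps)
    also have "\<dots> \<le> \<rho> + 2 * (\<rho> - 1) * (1/2)"
      using lambda by (intro add_left_mono mult_left_mono) auto
    finally show ?thesis by (simp add: algebra_simps)
  qed
  \<comment> \<open>Induction on the time and, for fixed time, on \<open>R\<close>: a start inside
    an obstacle removes that obstacle but uses up no step.\<close>
  have out_case: "hits_mgf \<rho> K R n x \<le> 1 + 2 * (\<rho> - 1) * (\<Sum>z\<in>R. W z x)" if "R \<subseteq> S" for R n x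
    using that
  proof (induction n arbitrary: R x)
    case (0 R x)
    have fin: "finite R" using 0 finite_S finite_subset by blast
    from fin 0 show ?case
    proof (induction R arbitrary: x rule: finite_psubset_induct)
      case (psubset R)
      show ?case
      proof (cases "x \<in> (\<Union>z\<in>R. K z)")
        case True
        then obtain z where z: "z \<in> R" "x \<in> K z" by auto
        have "hits_mgf \<rho> K R 0 x \<le> 1 + 2 * (\<rho> - 1) * 1"
          using in_case[OF psubset.IH[of "R - {z}"]] z psubset.prems by auto
        also have "1 + 2 * (\<rho> - 1) * 1 \<le> 1 + 2 * (\<rho> - 1) * (\<Sum>z\<in>R. W z x)"
        proof (intro add_left_mono mult_left_mono)
          show "1 \<le> (\<Sum>z\<in>R. W z x)"
            using W_ge_1[OF z(2)] member_le_sum[of z R "\<lambda>z. W z x"] z psubset.hyps W_nonneg by fastforce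
        qed (use lambda in auto)
        finally show ?thesis .
      next
        case False
        thus ?thesis using lambda psubset.hyps W_nonneg by (simp add: hits_mgf_0 sum_nonneg)
      qed
    qed
  next
    case (Suc n R x)
    have fin: "finite R" using Suc.prems finite_S finite_subset by blast
    from fin Suc.prems show ?case
    proof (induction R arbitrary: x rule: finite_psubset_induct)
      case (psubset R)
      show ?case
      proof (cases "x \<in> (\<Union>z\<in>R. K z)")
        case True
        then obtain z where z: "z \<in> R" "x \<in> K z" by auto
        have "hits_mgf \<rho> K R (Suc n) x \<le> 1 + 2 * (\<rho> - 1) * 1"
          using in_case[OF psubset.IH[of "R - {z}"]] z psubset.prems by auto
        also have "1 + 2 * (\<rho> - 1) * 1 \<le> 1 + 2 * (\<rho> - 1) * (\<Sum>z\<in>R. W z x)"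
        proof (intro add_left_mono mult_left_mono)
          show "1 \<le> (\<Sum>z\<in>R. W z x)"
            using W_ge_1[OF z(2)] member_le_sum[of z R "\<lambda>z. W z x"] z psubset.hyps W_nonneg by fastforce
        qed (use lambda in auto)
        finally show ?thesis .
      next
        case False
        have "hits_mgf \<rho> K R (Suc n) x = avg (hits_mgf \<rho> K R n) x"
          by (rule hits_mgf_Suc[OF False])
        also have "\<dots> \<le> avg (\<lambda>x. 1 + 2 * (\<rho> - 1) * (\<Sum>z\<in>R. W z x)) x"
          by (intro avg_mono Suc.IH psubset.prems)
        also have "\<dots> = 1 + 2 * (\<rho> - 1) * (\<Sum>z\<in>R. avg (W z) x)"
          unfolding avg_add avg_cmult avg_sum avg_const ..
        also have "\<dots> \<le> 1 + 2 * (\<rho> - 1) * (\<Sum>z\<in>R. W z x)"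
          using lambda superharmonic by (intro add_left_mono mult_left_mono sum_mono) auto
        finally show ?thesis .
      qed
    qed
  qed
  show "R \<subseteq> S \<Longrightarrow> hits_mgf \<rho> K R n x \<le> 1 + 2 * (\<rho> - 1) * (\<Sum>z\<in>R. W z x)"
    by (rule out_case)
  show "R \<subseteq> S \<Longrightarrow> z \<in> R \<Longrightarrow> x \<in> K z \<Longrightarrow> hits_mgf \<rho> K R n x \<le> 1 + 2 * (\<rho> - 1)"
    by (rule in_case[OF out_case]) auto
qed

end

text \<open>A bound on Cesaro averages passes to the limit of the sequence. It is needed because
  \<open>sweeping\<close> controls only sums over all horizons up to \<open>n\<close>.\<close>

lemma limit_le_of_partial_sums_le:
  fixes s :: "nat \<Rightarrow> real"
  assumes s: "s \<longlonglongrightarrow> L" and le: "\<And>n. (\<Sum>j\<le>n. s j) \<le> (real n + 1) * c"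
  shows "L \<le> c"
proof (rule ccontr)
  assume "\<not> L \<le> c"
  define h where "h = (L - c) / 2"
  have h: "h > 0" using \<open>\<not> L \<le> c\<close> by (simp add: h_def)
  have "c + h < L" using \<open>\<not> L \<le> c\<close> by (simp add: h_def field_simps)
  from order_tendstoD(1)[OF s this] obtain N where N: "\<And>n. n \<ge> N \<Longrightarrow> c + h < s n"
    by (auto simp: eventually_sequentially)
  define B where "B = (\<Sum>j<N. s j) - real N * c"
  have le_0: "B + real m * h \<le> 0" for m
  proof -
    have "(\<Sum>j\<le>N + m. s j) = (\<Sum>j<N. s j) + (\<Sum>j=N..N + m. s j)"
      by (subst sum.union_disjoint[symmetric]) (auto intro!: sum.cong)
    moreover have "(\<Sum>j=N..N + m. c + h) \<le> (\<Sum>j=N..N + m. s j)"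
      using N by (intro sum_mono) (auto intro: less_imp_le)
    hence "(real m + 1) * (c + h) \<le> (\<Sum>j=N..N + m. s j)" by (simp add: add.commute)
    ultimately have "(\<Sum>j<N. s j) + (real m + 1) * (c + h) \<le> (real N + real m + 1) * c"
      using le[of "N + m"] by (simp add: add.assoc)
    thus ?thesis using h by (simp add: B_def algebra_simps)
  qed
  obtain m where "- B < real m * h"
    using h reals_Archimedean3 by blast
  thus False using le_0[of m] by linarith
qed

text \<open>By sweeping, every capacity is an integral of a hitting probability against the same
  measure, the equilibrium measure of the union over \<open>R\<close>. The signed sum is thus the
  integral of the moment minus 1. Its integrand is at most \<open>2 * (\<rho> - 1)\<close> on the
  obstacles, which have at most \<open>k * card R\<close> points.\<close>

lemma (in sparse_obstacles) cap_alternating_le: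
  assumes R: "R \<subseteq> S"
  shows "- (\<Sum>A\<in>Pow R. \<rho> ^ card (R - A) * (1 - \<rho>) ^ card A * cap (\<Union>z\<in>A. K z)) \<le> 2 * (\<rho> - 1) * k * card R"
proof -
  let ?K = "\<lambda>A. \<Union>z\<in>A. K z"
  let ?c = "\<lambda>A. \<rho> ^ card (R - A) * (1 - \<rho>) ^ card A"
  let ?s = "\<lambda>n. - (\<Sum>A\<in>Pow R. ?c A * (\<Sum>x\<in>?K A. esc (?K A) n x))"
  have fin: "finite R" using R finite_S finite_subset by blast
  have lim: "?s \<longlonglongrightarrow> - (\<Sum>A\<in>Pow R. ?c A * cap (?K A))"
    by (intro tendsto_intros esc_tendsto_cap)
  have "(\<Sum>j\<le>n. ?s j) \<le> (real n + 1) * (2 * (\<rho> - 1) * k * card R)" for n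
  proof -
    have "(\<Sum>j\<le>n. ?s j) = - (\<Sum>A\<in>Pow R. ?c A * (\<Sum>j\<le>n. \<Sum>x\<in>?K A. esc (?K A) j x))"
      unfolding sum_negf sum_distrib_left by (subst sum.swap) simp
    also have "\<dots> = - (\<Sum>A\<in>Pow R. ?c A * (\<Sum>j\<le>n. \<Sum>x\<in>?K R. esc (?K R) j x * hit (?K A) (n - j) x))"
      using fin finite_K by (intro arg_cong[where f=uminus] sum.cong refl arg_cong2[where f="(*)"] sweeping[symmetric]) auto
    also have "\<dots> = - (\<Sum>j\<le>n. \<Sum>x\<in>?K R. \<Sum>A\<in>Pow R. ?c A * (esc (?K R) j x * hit (?K A) (n - j) x))"
      unfolding sum_distrib_left by (subst sum.swap, subst (2) sum.swap) simp
    also have "\<dots> = (\<Sum>j\<le>n. \<Sum>x\<in>?K R. esc (?K R) j x * (hits_mgf \<rho> K R (n - j) x - 1))"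
    proof -
      have "hits_mgf \<rho> K R m x - 1 = - (\<Sum>A\<in>Pow R. ?c A * hit (?K A) m x)" for m x
        unfolding hits_mgf_def right_diff_distrib sum_subtractf using sum_Pow_weights[OF fin, of \<rho>] by simp
      thus ?thesis by (simp add: sum_negf sum_distrib_left mult.left_commute)
    qed
    also have "\<dots> \<le> (\<Sum>j\<le>n. \<Sum>x\<in>?K R. 2 * (\<rho> - 1))"
    proof (intro sum_mono)
      fix j x assume "x \<in> ?K R"
      then obtain z where z: "z \<in> R" "x \<in> K z" by auto
      have "esc (?K R) j x * (hits_mgf \<rho> K R (n - j) x - 1) \<le> esc (?K R) j x * (2 * (\<rho> - 1))"
        using hits_mgf_le(2)[OF R z] by (intro mult_left_mono esc_nonneg) (simp add: algebra_simps)
      also have "\<dots> \<le> 1 * (2 * (\<rho> - 1))"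
        using lambda by (intro mult_right_mono esc_le_1) auto
      finally show "esc (?K R) j x * (hits_mgf \<rho> K R (n - j) x - 1) \<le> 2 * (\<rho> - 1)" by simp
    qed
    also have "\<dots> = (real n + 1) * (2 * (\<rho> - 1) * card (?K R))" by (simp add: algebra_simps)
    also have "\<dots> \<le> (real n + 1) * (2 * (\<rho> - 1) * (real k * real (card R)))"
    proof (intro mult_left_mono)
      have "card (?K R) \<le> (\<Sum>z\<in>R. card (K z))" by (rule card_UN_le[OF fin])
      also have "\<dots> \<le> (\<Sum>z\<in>R. k)" by (intro sum_mono card_K)
      finally have "card (?K R) \<le> k * card R" by (simp add: mult.commute)
      thus "real (card (?K R)) \<le> real k * real (card R)"
        by (metis of_nat_le_iff of_nat_mult)
    qed (use lambda in auto)
    finally show ?thesis by (simp add: mult.assoc)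
  qed
  from limit_le_of_partial_sums_le[OF lim this] show ?thesis .
qed

section \<open>The sup norm on the lattice\<close>

definition linf :: "int ^ 'n::finite \<Rightarrow> int" where
  "linf x = Max (range (\<lambda>i. \<bar>x $ i\<bar>))"

lemma linf_le_iff: "linf x \<le> r \<longleftrightarrow> (\<forall>i. \<bar>x $ i\<bar> \<le> r)"
  unfolding linf_def by (subst Max_le_iff) auto

lemma component_le_linf: "\<bar>x $ i\<bar> \<le> linf x"
  using linf_le_iff[of x "linf x"] by auto

lemma linf_nonneg [simp]: "0 \<le> linf x"
  using component_le_linf[of x undefined] by linarith

lemma linf_0 [simp]: "linf 0 = 0"
  using linf_le_iff[of "0 :: int ^ 'a" 0] linf_nonneg[of "0 :: int ^ 'a"] by (auto intro: antisym)

lemma linf_eq_0_iff [simp]: "linf x = 0 \<longleftrightarrow> x = 0"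
proof
  assume "linf x = 0"
  thus "x = 0" using component_le_linf[of x] by (auto simp: vec_eq_iff)
qed auto

lemma linf_add: "linf (x + y) \<le> linf x + linf y"
  unfolding linf_le_iff
proof
  fix i
  show "\<bar>(x + y) $ i\<bar> \<le> linf x + linf y"
    using component_le_linf[of x i] component_le_linf[of y i] by simp
qed

lemma linf_minus_commute: "linf (x - y) = linf (y - x)"
  by (simp add: linf_def abs_minus_commute)

lemma linf_triangle: "linf (x - z) \<le> linf (x - y) + linf (y - z)"
  using linf_add[of "x - y" "y - z"] by simp

lemma linf_triangle3: "linf (x - w) \<le> linf (x - y) + linf (y - z) + linf (z - w)"
  using linf_triangle[of x w y] linf_triangle[of y w z] by linarith

lemma linf_attained: "\<exists>i. linf x = \<bar>x $ i\<bar>"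
proof -
  have "linf x \<in> range (\<lambda>i. \<bar>x $ i\<bar>)" unfolding linf_def by (rule Max_in) auto
  thus ?thesis by auto
qed

lemma linf_scale: "0 \<le> c \<Longrightarrow> linf (c *s x) = c * linf x"
proof (rule antisym)
  assume c: "0 \<le> c"
  show "linf (c *s x) \<le> c * linf x"
    unfolding linf_le_iff using c component_le_linf[of x] by (auto simp: abs_mult intro: mult_left_mono)
  obtain i where "linf x = \<bar>x $ i\<bar>" using linf_attained by blast
  thus "c * linf x \<le> linf (c *s x)"
    using component_le_linf[of "c *s x" i] c by (simp add: abs_mult)
qed

lemma finite_linf_ball: "finite {a :: int ^ 'n::finite. linf a \<le> r}"
proof (rule finite_subset)
  show "finite (vec_lambda ` (Pi\<^sub>E UNIV (\<lambda>_. {-r..r})) :: (int ^ 'n) set)"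
    by (intro finite_imageI finite_PiE) auto
  show "{a :: int ^ 'n. linf a \<le> r} \<subseteq> vec_lambda ` (Pi\<^sub>E UNIV (\<lambda>_. {-r..r}))"
  proof
    fix a :: "int ^ 'n" assume "a \<in> {a. linf a \<le> r}"
    hence "vec_nth a \<in> Pi\<^sub>E UNIV (\<lambda>_. {-r..r})" by (auto simp: linf_le_iff abs_le_iff minus_le_iff)
    thus "a \<in> vec_lambda ` (Pi\<^sub>E UNIV (\<lambda>_. {-r..r}))"
      by (intro image_eqI[where x = "vec_nth a"]) auto
  qed
qed

subsection \<open>Leaf sets of dyadic trees\<close>

text \<open>Why the ratio is \<open>2 * s + 8\<close>: with \<open>L = scale s n\<close>, a point at
  distance \<open>(2 * s + 8) * L\<close> from the root and one within half of that are at least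
  \<open>(s + 4) * L\<close> apart. Rounding both to multiples of \<open>L\<close> costs
  \<open>L\<close>, which gives the bound \<open>s + 3\<close> in \<open>tree_offsets\<close>, and
  two subtrees of radius 3/2 \<open>L\<close> cost another \<open>3 * L\<close>. This leaves a
  separation of \<open>s * L\<close>. The bound \<open>2 * s + 9\<close> is the ratio plus
  rounding.\<close>

definition scale :: "nat \<Rightarrow> nat \<Rightarrow> int" where
  "scale s n = (2 * int s + 8) ^ n"

definition tree_offsets :: "nat \<Rightarrow> ((int ^ 'n::finite) \<times> (int ^ 'n)) set" where
  "tree_offsets s = {(a, b). linf a \<le> 2 * int s + 9 \<and> linf b \<le> 2 * int s + 9 \<and> int s + 3 \<le> linf (a - b)}"

primrec trees :: "nat \<Rightarrow> nat \<Rightarrow> int ^ 'n::finite \<Rightarrow> (int ^ 'n) set set" where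
  "trees s 0 z = {{z}}"
| "trees s (Suc n) z = (\<Union>(a, b)\<in>tree_offsets s.
     (\<lambda>(A, B). A \<union> B) ` (trees s n (z + scale s n *s a) \<times> trees s n (z + scale s n *s b)))"

lemma scale_pos [simp]: "0 < scale s n"
  by (simp add: scale_def)

lemma scale_Suc: "scale s (Suc n) = (2 * int s + 8) * scale s n"
  by (simp add: scale_def)

lemma trees_SucE:
  assumes "C \<in> trees s (Suc n) z"
  obtains a b A B where "C = A \<union> B" "A \<in> trees s n (z + scale s n *s a)" "B \<in> trees s n (z + scale s n *s b)"
    "linf a \<le> 2 * int s + 9" "linf b \<le> 2 * int s + 9" "int s + 3 \<le> linf (a - b)"
  using assms by (auto simp: tree_offsets_def)

text \<open>The radius 3/2 in units of the scale reproduces itself, since (2s + 9) + 3/2 \<le> 3/2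
  (2s + 8).\<close>

lemma trees_near: "A \<in> trees s n z \<Longrightarrow> x \<in> A \<Longrightarrow> 2 * linf (x - z) \<le> 3 * scale s n"
proof (induction n arbitrary: A x z)
  case (Suc n C)
  have *: "2 * linf (x - z) \<le> 3 * scale s (Suc n)"
    if "2 * linf (x - (z + scale s n *s a)) \<le> 3 * scale s n" "linf a \<le> 2 * int s + 9" for a
  proof -
    have "linf (x - z) \<le> linf (x - (z + scale s n *s a)) + scale s n * linf a"
      using linf_triangle[of x z "z + scale s n *s a"] by (simp add: linf_scale less_imp_le)
    moreover have "scale s n * linf a \<le> scale s n * (2 * int s + 9)"
      using that(2) by (intro mult_left_mono) (auto simp: less_imp_le)
    moreover have "0 \<le> int s * scale s n" by (simp add: less_imp_le)
    ultimately show ?thesis using that(1) scale_pos[of s n]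
      unfolding scale_Suc by (simp only: algebra_simps)
  qed
  from Suc.prems(1) obtain a b A B where "C = A \<union> B" "A \<in> trees s n (z + scale s n *s a)"
    "B \<in> trees s n (z + scale s n *s b)" "linf a \<le> 2 * int s + 9" "linf b \<le> 2 * int s + 9"
    by (rule trees_SucE)
  thus ?case using Suc.IH Suc.prems(2) * by blast
qed (auto simp: scale_def)

lemma trees_separated:
  assumes "A \<in> trees s n (z + scale s n *s a)" "B \<in> trees s n (z + scale s n *s b)"
    and "int s + 3 \<le> linf (a - b)" "x \<in> A" "y \<in> B"
  shows "int s * scale s n \<le> linf (x - y)"
proof -
  define L where "L = scale s n"
  have L: "0 < L" by (simp add: L_def)
  have "(int s + 3) * L \<le> linf (a - b) * L" using assms(3) L by (intro mult_right_mono) auto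
  also have "\<dots> = linf (L *s (a - b))"
    using linf_scale[of L "a - b"] L by (simp only: less_imp_le mult.commute)
  also have "L *s (a - b) = (z + L *s a) - (z + L *s b)"
    by (simp add: vec_eq_iff algebra_simps)
  also have "linf \<dots> \<le> linf (z + L *s a - x) + linf (x - y) + linf (y - (z + L *s b))"
    by (rule linf_triangle3)
  finally have "2 * (int s + 3) * L \<le> 2 * linf (z + L *s a - x) + 2 * linf (x - y) + 2 * linf (y - (z + L *s b))"
    by (simp add: algebra_simps)
  moreover have "2 * linf (x - (z + L *s a)) \<le> 3 * L" "2 * linf (y - (z + L *s b)) \<le> 3 * L"
    using trees_near assms unfolding L_def by blast+
  ultimately show ?thesis
    by (simp add: linf_minus_commute[of x] L_def algebra_simps)
qed

lemma trees_finite_card: "0 < s \<Longrightarrow> A \<in> trees s n z \<Longrightarrow> finite A \<and> card A = 2 ^ n"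
proof (induction n arbitrary: A z)
  case (Suc n C)
  from Suc.prems(2) obtain a b A B where C: "C = A \<union> B" "A \<in> trees s n (z + scale s n *s a)"
    "B \<in> trees s n (z + scale s n *s b)" "int s + 3 \<le> linf (a - b)"
    by (rule trees_SucE)
  have "A \<inter> B = {}"
  proof (rule ccontr)
    assume "A \<inter> B \<noteq> {}"
    then obtain x where "x \<in> A" "x \<in> B" by blast
    from trees_separated[OF C(2-4) this] have "int s * scale s n \<le> 0" by simp
    thus False using Suc.prems(1) scale_pos[of s n] by (simp add: mult_le_0_iff)
  qed
  thus ?case using C Suc.IH Suc.prems(1) by (auto simp: card_Un_disjoint)
qed auto

lemma trees_spread:
  assumes "0 < s" "A \<in> trees s n z" "x \<in> A" "y \<in> A" "x \<noteq> y"
  shows "int s \<le> linf (x - y)"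
  using assms
proof (induction n arbitrary: A z)
  case (Suc n C)
  from Suc.prems(2) obtain a b A B where C: "C = A \<union> B" "A \<in> trees s n (z + scale s n *s a)"
    "B \<in> trees s n (z + scale s n *s b)" "int s + 3 \<le> linf (a - b)"
    by (rule trees_SucE)
  have 1: "1 \<le> scale s n" using scale_pos[of s n] by linarith
  have "int s * 1 \<le> int s * scale s n" using 1 by (intro mult_left_mono) auto
  hence sep: "int s \<le> linf (u - v)" if "u \<in> A" "v \<in> B" for u v
    using trees_separated[OF C(2-4) that] by linarith
  show ?case
  proof (cases "x \<in> A"; cases "y \<in> A")
    assume "x \<in> A" "y \<in> A" thus ?thesis using Suc C by blast
  next
    assume "x \<in> A" "y \<notin> A" thus ?thesis using sep Suc C by blast
  next
    assume "x \<notin> A" "y \<in> A"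
    thus ?thesis using sep[of y x] Suc.prems C by (auto simp: linf_minus_commute[of x])
  next
    assume "x \<notin> A" "y \<notin> A"
    hence "x \<in> B" "y \<in> B" using Suc.prems C by auto
    thus ?thesis using Suc C by blast
  qed
qed auto

text \<open>A sibling subtree of depth \<open>n\<close> has \<open>2 ^ n\<close> leaves at distance
  at least \<open>s * 4 ^ n\<close> and so adds at most \<open>(1/2) ^ n / s\<close>. The bound is
  the partial sum of this geometric series.\<close>

lemma trees_energy:
  assumes "0 < s" "A \<in> trees s n z" "x \<in> A"
  shows "(\<Sum>y\<in>A - {x}. 1 / real_of_int (linf (x - y))) \<le> 2 / s * (1 - (1/2) ^ n)"
  using assms
proof (induction n arbitrary: A z)
  case (Suc n C)
  from Suc.prems(2) obtain a b A B where C: "C = A \<union> B" "A \<in> trees s n (z + scale s n *s a)"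
    "B \<in> trees s n (z + scale s n *s b)" "int s + 3 \<le> linf (a - b)"
    by (rule trees_SucE)
  have *: "(\<Sum>y\<in>C - {x}. 1 / real_of_int (linf (x - y))) \<le> 2 / s * (1 - (1/2) ^ Suc n)"
    if C: "C = A \<union> B" "A \<in> trees s n za" "B \<in> trees s n zb"
       and sep: "\<And>u v. u \<in> A \<Longrightarrow> v \<in> B \<Longrightarrow> int s * scale s n \<le> linf (u - v)" and x: "x \<in> A" for A B za zb
  proof -
    have fin: "finite A" "finite B" "card B = 2 ^ n" using trees_finite_card C Suc.prems by blast+
    have pos: "0 < real s * real_of_int (scale s n)" using Suc.prems by simp
    have sep': "real s * real_of_int (scale s n) \<le> real_of_int (linf (x - y))" if "y \<in> B" for y
      using sep[OF x that] by (metis of_int_le_iff of_int_mult of_int_of_nat_eq)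
    have "(\<Sum>y\<in>C - {x}. 1 / real_of_int (linf (x - y))) \<le> (\<Sum>y\<in>(A - {x}) \<union> B. 1 / real_of_int (linf (x - y)))"
      using fin C by (intro sum_mono2) auto
    also have "\<dots> \<le> (\<Sum>y\<in>A - {x}. 1 / real_of_int (linf (x - y))) + (\<Sum>y\<in>B. 1 / real_of_int (linf (x - y)))"
      using fin by (subst sum.union_inter[symmetric]) (auto intro!: sum_nonneg)
    also have "(\<Sum>y\<in>A - {x}. 1 / real_of_int (linf (x - y))) \<le> 2 / s * (1 - (1/2) ^ n)"
      using Suc.IH Suc.prems(1) C(2) x by blast
    also have "(\<Sum>y\<in>B. 1 / real_of_int (linf (x - y))) \<le> (\<Sum>y\<in>B. 1 / (real s * real_of_int (scale s n)))"
      by (intro sum_mono frac_le pos sep') auto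
    also have "\<dots> = 1 / s * (2 ^ n / real_of_int (scale s n))" using fin by simp
    also have "\<dots> \<le> 1 / s * (1/2) ^ n"
    proof (intro mult_left_mono)
      have "(4::real) ^ n \<le> real_of_int (2 * int s + 8) ^ n" by (intro power_mono) auto
      hence "2 ^ n * 2 ^ n \<le> real_of_int (scale s n)"
        by (simp add: scale_def power_mult_distrib[symmetric])
      thus "2 ^ n / real_of_int (scale s n) \<le> (1/2) ^ n"
        by (simp add: field_simps power_one_over)
    qed auto
    finally show ?thesis by (simp add: algebra_simps)
  qed
  show ?case
  proof (cases "x \<in> A")
    case True
    show ?thesis by (rule *[OF C(1-3) trees_separated[OF C(2-4)] True])
  next
    case False
    hence x: "x \<in> B" using C Suc.prems by auto
    have "C = B \<union> A" using C by auto
    moreover have "int s * scale s n \<le> linf (u - v)" if "u \<in> B" "v \<in> A" for u v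
      using trees_separated[OF C(2-4) that(2,1)] by (simp add: linf_minus_commute[of u])
    ultimately show ?thesis using *[OF _ C(3,2) _ x] by blast
  qed
qed auto

definition tree_entropy :: "'n::finite itself \<Rightarrow> nat \<Rightarrow> nat" where
  "tree_entropy _ s = card (tree_offsets s :: ((int ^ 'n) \<times> (int ^ 'n)) set) + 1"

lemma finite_tree_offsets: "finite (tree_offsets s)"
proof (rule finite_subset)
  show "tree_offsets s \<subseteq> {a. linf a \<le> 2 * int s + 9} \<times> {b. linf b \<le> 2 * int s + 9}"
    by (auto simp: tree_offsets_def)
qed (intro finite_cartesian_product finite_linf_ball)

text \<open>A binary tree with \<open>2 ^ n\<close> leaves has \<open>2 ^ n - 1\<close> branchings,
  each with fewer than \<open>tree_entropy\<close> choices. The extra factor on the left states this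
  without subtraction in the exponent.\<close>

lemma card_trees:
  fixes z :: "int ^ 'n::finite"
  shows "finite (trees s n z) \<and> card (trees s n z) * tree_entropy TYPE('n) s \<le> tree_entropy TYPE('n) s ^ (2 ^ n)"
proof (induction n arbitrary: z)
  case (Suc n)
  let ?c = "tree_entropy TYPE('n) s"
  have fin: "finite (trees s n z)" and le: "card (trees s n z) * ?c \<le> ?c ^ (2 ^ n)" for z :: "int ^ 'n"
    using Suc by auto
  define m where "m = ?c ^ (2 ^ n) div ?c"
  have cpos: "0 < ?c" by (simp add: tree_entropy_def)
  have le': "card (trees s n z) \<le> m" for z :: "int ^ 'n"
    using le[of z] cpos by (simp add: m_def less_eq_div_iff_mult_less_eq)
  have mc: "m * ?c \<le> ?c ^ (2 ^ n)" by (simp add: m_def)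
  have "card (trees s (Suc n) z) \<le> (\<Sum>(a, b)\<in>(tree_offsets s :: ((int ^ 'n) \<times> (int ^ 'n)) set). m * m)"
    unfolding trees.simps
  proof (rule order_trans[OF card_UN_le[OF finite_tree_offsets]], rule sum_mono, clarify)
    fix a b :: "int ^ 'n"
    have "card ((\<lambda>(A, B). A \<union> B) ` (trees s n (z + scale s n *s a) \<times> trees s n (z + scale s n *s b)))
       \<le> card (trees s n (z + scale s n *s a) \<times> trees s n (z + scale s n *s b))"
      using fin by (intro card_image_le) auto
    also have "\<dots> \<le> m * m"
      unfolding card_cartesian_product by (intro mult_mono le') auto
    finally show "card ((\<lambda>(A, B). A \<union> B) ` (trees s n (z + scale s n *s a) \<times> trees s n (z + scale s n *s b))) \<le> m * m" .
  qed
  also have "\<dots> \<le> ?c * (m * m)" by (simp add: tree_entropy_def split_def)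
  finally have "card (trees s (Suc n) z) * ?c \<le> ?c * (m * m) * ?c" by (rule mult_right_mono) simp
  also have "\<dots> = (m * ?c) * (m * ?c)" by simp
  also have "\<dots> \<le> ?c ^ (2 ^ n) * ?c ^ (2 ^ n)" by (intro mult_mono mc) auto
  also have "\<dots> = ?c ^ (2 ^ Suc n)" by (simp add: power_add[symmetric] mult_2)
  finally show ?case
    unfolding trees.simps using fin
    by (auto intro!: finite_UN_I finite_tree_offsets simp: split_beta)
qed auto

lemma card_trees_le:
  fixes z :: "int ^ 'n::finite"
  shows "card (trees s n z) \<le> tree_entropy TYPE('n) s ^ (2 ^ n)"
proof -
  have "card (trees s n z) * 1 \<le> card (trees s n z) * tree_entropy TYPE('n) s"
    by (intro mult_left_mono) (auto simp: tree_entropy_def)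
  thus ?thesis using card_trees[of s n z] by linarith
qed

subsection \<open>Crossings contain leaf sets\<close>

definition star_connected :: "(int ^ 'n::finite) set \<Rightarrow> bool" where
  "star_connected C \<longleftrightarrow> (\<forall>x\<in>C. \<forall>y\<in>C. (\<lambda>a b. a \<in> C \<and> b \<in> C \<and> linf (a - b) \<le> 1)\<^sup>*\<^sup>* x y)"

lemma discrete_intermediate_value:
  fixes f :: "'a \<Rightarrow> int"
  assumes "R\<^sup>*\<^sup>* x y" and R: "\<And>a b. R a b \<Longrightarrow> f b \<le> f a + 1" and "f x \<le> m" "m \<le> f y"
  shows "\<exists>v. R\<^sup>*\<^sup>* x v \<and> f v = m"
  using assms(1,4)
proof (induction rule: rtranclp_induct)
  case base
  thus ?case using assms(3) by auto
next
  case (step y w)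
  show ?case
  proof (cases "m \<le> f y")
    case False
    hence "f w = m" using R[OF step(2)] step.prems by linarith
    moreover have "R\<^sup>*\<^sup>* x w" using step(1,2) by (rule rtranclp.rtrancl_into_rtrancl)
    ultimately show ?thesis by blast
  qed (use step in auto)
qed

lemma nearest_multiple:
  fixes v :: "int ^ 'n::finite"
  assumes "0 < L"
  shows "\<exists>a. 2 * linf (v - L *s a) \<le> L"
proof -
  define a :: "int ^ 'n" where "a = (\<chi> i. (2 * v $ i + L) div (2 * L))"
  have "2 * \<bar>(v - L *s a) $ i\<bar> \<le> L" for i
  proof -
    define q where "q = (2 * v $ i + L) div (2 * L)"
    have "2 * v $ i + L = (2 * L) * q + (2 * v $ i + L) mod (2 * L)"
      by (simp add: q_def)
    moreover have "0 \<le> (2 * v $ i + L) mod (2 * L)" "(2 * v $ i + L) mod (2 * L) < 2 * L"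
      using assms by auto
    ultimately have "2 * (v $ i - L * q) \<le> L \<and> - (2 * (v $ i - L * q)) \<le> L" by (simp add: algebra_simps)
    hence "2 * \<bar>v $ i - L * q\<bar> \<le> L" by linarith
    thus ?thesis by (simp add: a_def q_def)
  qed
  hence "2 * linf (v - L *s a) \<le> L" using linf_attained[of "v - L *s a"] by metis
  thus ?thesis by blast
qed

text \<open>Along the way from \<open>p\<close> to \<open>q\<close> there is a point
  \<open>v\<close> of \<open>C\<close> at distance exactly the next scale from \<open>z\<close>. The
  points \<open>p\<close> and \<open>v\<close> are rounded to two offsets, and each rounded point is
  the root of a smaller crossing.\<close>

lemma crossing_contains_tree:
  assumes C: "star_connected C" and p: "p \<in> C" "2 * linf (p - z) \<le> scale s n"
    and q: "q \<in> C" "scale s n \<le> linf (q - z)" and s: "2 \<le> s"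
  shows "\<exists>A\<in>trees s n z. A \<subseteq> C"
  using p q
proof (induction n arbitrary: p q z)
  case 0
  hence "2 * linf (p - z) \<le> 1" by (simp add: scale_def)
  hence "linf (p - z) = 0" using linf_nonneg[of "p - z"] by linarith
  thus ?case using 0 by auto
next
  case (Suc n)
  define L where "L = scale s n"
  have L: "0 < L" by (simp add: L_def)
  let ?l = "2 * int s + 8"
  have sL0: "0 \<le> L * int s" using L by simp
  have sL: "scale s (Suc n) = ?l * L" by (simp add: scale_Suc L_def)
  let ?R = "\<lambda>a b. a \<in> C \<and> b \<in> C \<and> linf (a - b) \<le> 1"
  have "?R\<^sup>*\<^sup>* p q" using C Suc.prems by (auto simp: star_connected_def)
  moreover have "linf (b - z) \<le> linf (a - z) + 1" if "?R a b" for a b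
    using that linf_triangle[of b z a] by (auto simp: linf_minus_commute[of b])
  moreover have "linf (p - z) \<le> ?l * L"
    using Suc.prems(2) linf_nonneg[of "p - z"] unfolding sL by linarith
  ultimately have "\<exists>v. ?R\<^sup>*\<^sup>* p v \<and> linf (v - z) = ?l * L"
    using Suc.prems(4) unfolding sL by (intro discrete_intermediate_value[where y = q and f = "\<lambda>v. linf (v - z)"])
  then obtain v where v: "?R\<^sup>*\<^sup>* p v" "linf (v - z) = ?l * L" by blast
  from v(1) have vC: "v \<in> C" using Suc.prems(1) by (induction rule: rtranclp_induct) auto
  have dist: "?l * L \<le> 2 * linf (v - p)"
    using linf_triangle[of v z p] v(2) Suc.prems(2) unfolding sL by linarith
  obtain a where a: "2 * linf (p - z - L *s a) \<le> L" using nearest_multiple[OF L] by blast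
  obtain b where b: "2 * linf (v - z - L *s b) \<le> L" using nearest_multiple[OF L] by blast
  have a': "2 * linf (p - (z + L *s a)) \<le> L" and b': "2 * linf (v - (z + L *s b)) \<le> L"
    using a b by (simp_all add: diff_diff_add)
  have la: "L * linf a \<le> linf (p - z) + linf (p - (z + L *s a))"
    using linf_triangle[of "z + L *s a" z p] L by (simp add: linf_scale linf_minus_commute[of p])
  have lb: "L * linf b \<le> linf (v - z) + linf (v - (z + L *s b))"
    using linf_triangle[of "z + L *s b" z v] L by (simp add: linf_scale linf_minus_commute[of v])
  have "L * (2 * linf a) \<le> L * (2 * (2 * int s + 9))"
    using la a' Suc.prems(2) L linf_nonneg[of "p - z"] sL0 unfolding sL
    by (simp only: algebra_simps)
  hence la': "linf a \<le> 2 * int s + 9" using L by simp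
  have "L * (2 * linf b) \<le> L * (2 * (2 * int s + 9))"
    using lb b' v(2) L by (simp add: algebra_simps)
  hence lb': "linf b \<le> 2 * int s + 9" using L by simp
  have "linf (v - p) \<le> linf (v - (z + L *s b)) + L * linf (a - b) + linf (p - (z + L *s a))"
  proof -
    have "(z + L *s b) - (z + L *s a) = L *s (b - a)" by (simp add: vec_eq_iff algebra_simps)
    hence "linf ((z + L *s b) - (z + L *s a)) = L * linf (b - a)" using L by (simp only: linf_scale less_imp_le)
    moreover have "linf (v - p) \<le> linf (v - (z + L *s b)) + linf ((z + L *s b) - (z + L *s a)) + linf (z + L *s a - p)"
      by (rule linf_triangle3)
    ultimately show ?thesis
      by (simp only: linf_minus_commute[of p] linf_minus_commute[of a])
  qed
  hence "L * (2 * int s + 6) \<le> L * (2 * linf (a - b))"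
    using dist a' b' by (simp add: algebra_simps)
  hence lab: "int s + 3 \<le> linf (a - b)" using L by simp
  have "0 \<le> int s * L" using L by simp
  hence far: "4 * L \<le> linf (v - p)" using dist by (simp add: algebra_simps)
  \<comment> \<open>Both subtrees use the same two points with exchanged roles: \<open>p\<close>
    starts the crossing around its rounded position and \<open>v\<close> is its far end, and
    conversely.\<close>
  have "L \<le> linf (v - (z + L *s a))"
    using far linf_triangle[of v p "z + L *s a"] a' L by (simp add: linf_minus_commute[of p])
  then obtain A where A: "A \<in> trees s n (z + L *s a)" "A \<subseteq> C"
    using Suc.IH[of p "z + L *s a" v] Suc.prems(1) vC a' unfolding L_def by blast
  have "L \<le> linf (p - (z + L *s b))"
    using far linf_triangle[of v p "z + L *s b"] b' L by (simp add: linf_minus_commute[of p])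
  then obtain B where B: "B \<in> trees s n (z + L *s b)" "B \<subseteq> C"
    using Suc.IH[of v "z + L *s b" p] Suc.prems(1) vC b' unfolding L_def by blast
  have "(a, b) \<in> tree_offsets s" using la' lb' lab by (simp add: tree_offsets_def)
  hence "A \<union> B \<in> trees s (Suc n) z"
    using A(1) B(1) unfolding L_def trees.simps by (intro UN_I[of "(a, b)"]) (auto intro!: image_eqI[of _ _ "(A, B)"])
  thus ?case using A B by blast
qed

subsection \<open>Planar duality\<close>

text \<open>The primitive is the parity of the number of marked edges between 0 and
  \<open>x\<close>.\<close>

lemma int_primitive:
  fixes h :: "int \<Rightarrow> bool"
  obtains F where "\<And>x. F (x + 1) = (F x \<noteq> h x)"
proof -
  define F where "F x = odd (card {j. (0 \<le> j \<and> j < x \<or> x \<le> j \<and> j < 0) \<and> h j})" for x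
  have "F (x + 1) = (F x \<noteq> h x)" for x
  proof -
    define A where "A x = {j. (0 \<le> j \<and> j < x \<or> x \<le> j \<and> j < 0) \<and> h j}" for x
    have fin: "finite (A x)" for x
      by (rule finite_subset[of _ "{min 0 x..max 0 x}"]) (auto simp: A_def)
    have F': "F y = odd (card (A y))" for y by (simp add: F_def A_def)
    show ?thesis
    proof (cases "0 \<le> x")
      case True
      have "A (x + 1) = (if h x then insert x (A x) else A x)" "x \<notin> A x"
        using True by (auto simp: A_def order.order_iff_strict)
      thus ?thesis using fin by (simp add: F')
    next
      case False
      have "A x = (if h x then insert x (A (x + 1)) else A (x + 1))" "x \<notin> A (x + 1)"
        using False by (auto simp: A_def order.order_iff_strict)
      thus ?thesis using fin by (simp add: F')
    qed
  qed
  thus ?thesis by (rule that)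
qed

text \<open>\<open>h x y\<close> and \<open>v x y\<close> are the values on the edges from \<open>(x, y)\<close> to \<open>(x + 1, y)\<close> and \<open>(x, y + 1)\<close>;
  the hypothesis says that a \<open>\<int>/2\<close>-valued cochain vanishes around every unit square.\<close>

lemma closed_imp_exact:
  fixes h v :: "int \<Rightarrow> int \<Rightarrow> bool"
  assumes closed: "\<And>x y. ((h x y \<noteq> v (x + 1) y) \<noteq> (h x (y + 1) \<noteq> v x y)) = False"
  obtains F where "\<And>x y. F (x + 1) y = (F x y \<noteq> h x y)" "\<And>x y. F x (y + 1) = (F x y \<noteq> v x y)"
proof -
  obtain F0 where F0: "\<And>x. F0 (x + 1) = (F0 x \<noteq> h x 0)"
    using int_primitive[of "\<lambda>x. h x 0"] by metis
  have "\<exists>G. \<forall>y. G (y + 1) = (G y \<noteq> v x y)" for x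
    using int_primitive[of "v x"] by metis
  then obtain G where G: "\<And>x y. G x (y + 1) = (G x y \<noteq> v x y)" by metis
  \<comment> \<open>Integration along row 0 and then up the column. The vertical relation holds by
    construction; the horizontal one spreads from row 0 to the other rows through the square
    condition.\<close>
  define F where "F x y = (F0 x \<noteq> (G x y \<noteq> G x 0))" for x y
  have 2: "F x (y + 1) = (F x y \<noteq> v x y)" for x y
    using G by (auto simp: F_def)
  have "F (x + 1) y = (F x y \<noteq> h x y)" for x y
  proof (induction y rule: int_induct[where k = 0])
    case base
    show ?case using F0 by (auto simp: F_def)
  next
    case (step1 y)
    thus ?case using 2[of x y] 2[of "x + 1" y] closed[of x y] by argo
  next
    case (step2 y)
    have "y - 1 + 1 = y" by simp
    thus ?case using step2(2) 2[of x "y - 1"] 2[of "x + 1" "y - 1"] closed[of x "y - 1"] by (simp only:) argo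
  qed
  thus ?thesis using 2 by (rule that)
qed

abbreviation pt :: "int \<Rightarrow> int \<Rightarrow> int ^ 2" where
  "pt x y \<equiv> vector [x, y]"

lemma pt_cases: obtains x y where "p = pt x y"
proof
  show "p = pt (p $ 1) (p $ 2)" by (simp add: vec_eq_iff forall_2)
qed

lemma adjacent_pt: "adjacent (pt x y) (pt x' y') \<longleftrightarrow> \<bar>x - x'\<bar> + \<bar>y - y'\<bar> = 1"
  by (simp add: adjacent_def sum_2)

lemma adjacent_sym: "adjacent x y \<Longrightarrow> adjacent y x"
  by (simp add: adjacent_def abs_minus_commute)

lemma adjacent_commute: "adjacent x y = adjacent y x"
  by (simp add: adjacent_def abs_minus_commute)

lemma linf_pt: "linf (pt x y - pt x' y') \<le> r \<longleftrightarrow> \<bar>x - x'\<bar> \<le> r \<and> \<bar>y - y'\<bar> \<le> r"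
  by (simp add: linf_le_iff forall_2)

abbreviation nn_path :: "(int ^ 'n::finite) set \<Rightarrow> int ^ 'n \<Rightarrow> int ^ 'n \<Rightarrow> bool" where
  "nn_path E \<equiv> (\<lambda>a b. a \<in> E \<and> b \<in> E \<and> adjacent a b)\<^sup>*\<^sup>*"

definition nn_connected :: "(int ^ 'n::finite) set \<Rightarrow> bool" where
  "nn_connected C \<longleftrightarrow> (\<forall>x\<in>C. \<forall>y\<in>C. nn_path C x y)"

definition inner_boundary :: "(int ^ 'n::finite) set \<Rightarrow> (int ^ 'n) set" where
  "inner_boundary D = {x \<in> D. \<exists>y. y \<notin> D \<and> adjacent y x}"

lemma const_on_connected:
  assumes "nn_connected C" and "\<And>a b. a \<in> C \<Longrightarrow> b \<in> C \<Longrightarrow> adjacent a b \<Longrightarrow> f a = f b"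
    and "x \<in> C" "y \<in> C"
  shows "f x = f y"
proof -
  have "nn_path C x y"
    using assms by (auto simp: nn_connected_def)
  thus ?thesis by (induction rule: rtranclp_induct) (use assms(2) in auto)
qed

text \<open>
  If the boundary split into two parts that are not star-adjacent, the cut edges ending in one of
  the parts would form a closed cochain, since any two vertices of a unit square are
  star-adjacent. Its primitive is constant on \<open>D\<close> and on the complement, so either all cut edges
  belong to the cochain or none does.
\<close>

lemma inner_boundary_no_split:
  fixes D :: "(int ^ 2) set"
  assumes D: "nn_connected D" and C: "nn_connected (- D)"
    and A: "A \<subseteq> inner_boundary D" "A \<noteq> {}"
    and sep: "\<And>a b. a \<in> A \<Longrightarrow> b \<in> inner_boundary D - A \<Longrightarrow> \<not> linf (a - b) \<le> 1"
  shows "A = inner_boundary D"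
proof (rule ccontr)
  assume "A \<noteq> inner_boundary D"
  then obtain b0 where b0: "b0 \<in> inner_boundary D" "b0 \<notin> A" using A by blast
  obtain a0 where a0: "a0 \<in> A" using A by blast
  define \<sigma> where "\<sigma> p q \<longleftrightarrow> adjacent p q \<and> (p \<notin> D \<and> q \<in> A \<or> q \<notin> D \<and> p \<in> A)" for p q
  have AD: "A \<subseteq> D" using A by (auto simp: inner_boundary_def)
  define h where "h x y = \<sigma> (pt x y) (pt (x + 1) y)" for x y
  define v where "v x y = \<sigma> (pt x y) (pt x (y + 1))" for x y
  have sep': "q \<in> A" if "p \<in> A" "q \<in> D" "r \<notin> D" "adjacent r q" "linf (p - q) \<le> 1" for p q r
    using that sep[of p q] by (auto simp: inner_boundary_def)
  have "((h x y \<noteq> v (x + 1) y) \<noteq> (h x (y + 1) \<noteq> v x y)) = False" for x y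
  proof -
    define p1 p2 p3 p4 where "p1 = pt x y" "p2 = pt (x + 1) y" "p3 = pt (x + 1) (y + 1)" "p4 = pt x (y + 1)"
    note p = this
    have adj: "adjacent p1 p2" "adjacent p2 p3" "adjacent p4 p3" "adjacent p1 p4"
      by (simp_all add: p adjacent_pt)
    hence adj': "adjacent p2 p1" "adjacent p3 p2" "adjacent p3 p4" "adjacent p4 p1"
      by (auto intro: adjacent_sym)
    have near: "linf (r - r') \<le> 1" if "r \<in> {p1, p2, p3, p4}" "r' \<in> {p1, p2, p3, p4}" for r r'
      using that by (auto simp: p linf_pt)
    have \<sigma>: "h x y = \<sigma> p1 p2" "v (x + 1) y = \<sigma> p2 p3" "h x (y + 1) = \<sigma> p4 p3" "v x y = \<sigma> p1 p4"
      by (simp_all add: h_def v_def p)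
    \<comment> \<open>In a square that meets \<open>A\<close> every cut edge ends in
      \<open>A\<close>, so there the cochain is the coboundary of the indicator of \<open>D\<close>
      and sums to zero around the square. In any other square it vanishes.\<close>
    have all: "\<sigma> r r' \<longleftrightarrow> (r \<in> D) \<noteq> (r' \<in> D)"
      if "r \<in> {p1, p2, p3, p4}" "r' \<in> {p1, p2, p3, p4}" "adjacent r r'"
        and s: "s \<in> {p1, p2, p3, p4}" "s \<in> A" for r r' s
    proof -
      have "adjacent r' r" using that adjacent_sym by blast
      hence "r \<in> A" if "r \<in> D" "r' \<notin> D"
        using that sep'[OF s(2), of r r'] near[OF s(1) \<open>r \<in> {p1, p2, p3, p4}\<close>] by blast
      moreover have "r' \<in> A" if "r' \<in> D" "r \<notin> D"
        using that \<open>adjacent r r'\<close> sep'[OF s(2), of r' r] near[OF s(1) \<open>r' \<in> {p1, p2, p3, p4}\<close>] by blast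
      moreover have "r \<in> A \<Longrightarrow> r \<in> D" "r' \<in> A \<Longrightarrow> r' \<in> D" using AD by auto
      ultimately show ?thesis using that(3) unfolding \<sigma>_def by argo
    qed
    show ?thesis
    proof (cases "\<exists>s\<in>{p1, p2, p3, p4}. s \<in> A")
      case True
      then obtain s where s: "s \<in> {p1, p2, p3, p4}" "s \<in> A" by blast
      have "\<sigma> p1 p2 = ((p1 \<in> D) \<noteq> (p2 \<in> D))" "\<sigma> p2 p3 = ((p2 \<in> D) \<noteq> (p3 \<in> D))"
        "\<sigma> p4 p3 = ((p4 \<in> D) \<noteq> (p3 \<in> D))" "\<sigma> p1 p4 = ((p1 \<in> D) \<noteq> (p4 \<in> D))"
        by (rule all[OF _ _ _ s]; use adj in simp)+
      thus ?thesis unfolding \<sigma> by argo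
    next
      case False
      hence "\<not> \<sigma> p1 p2" "\<not> \<sigma> p2 p3" "\<not> \<sigma> p4 p3" "\<not> \<sigma> p1 p4" by (auto simp: \<sigma>_def)
      thus ?thesis unfolding \<sigma> by (simp only: simp_thms)
    qed
  qed
  from closed_imp_exact[of h v, OF this] obtain F
    where F: "\<And>x y. F (x + 1) y = (F x y \<noteq> h x y)" "\<And>x y. F x (y + 1) = (F x y \<noteq> v x y)" by blast
  define f where "f p = F (p $ 1) (p $ 2)" for p :: "int ^ 2"
  have \<sigma>_sym: "\<sigma> p q = \<sigma> q p" for p q
    unfolding \<sigma>_def adjacent_commute[of p q] by blast
  have f: "f q = (f p \<noteq> \<sigma> p q)" if adj: "adjacent p q" for p q
  proof -
    obtain x y where p: "p = pt x y" by (rule pt_cases)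
    obtain x' y' where q: "q = pt x' y'" by (rule pt_cases)
    from adj have "\<bar>x - x'\<bar> + \<bar>y - y'\<bar> = 1" by (simp add: p q adjacent_pt)
    hence "x' = x + 1 \<and> y' = y \<or> x = x' + 1 \<and> y' = y \<or> x' = x \<and> y' = y + 1 \<or> x' = x \<and> y = y' + 1"
      by linarith
    then consider "x' = x + 1" "y' = y" | "x = x' + 1" "y' = y" | "x' = x" "y' = y + 1" | "x' = x" "y = y' + 1"
      by blast
    thus ?thesis
    proof cases
      case 1
      thus ?thesis using F(1)[of x y] by (simp add: f_def p q h_def)
    next
      case 2
      thus ?thesis using F(1)[of x' y'] \<sigma>_sym[of p q] by (auto simp: f_def p q h_def)
    next
      case 3
      thus ?thesis using F(2)[of x y] by (simp add: f_def p q v_def)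
    next
      case 4
      thus ?thesis using F(2)[of x' y'] \<sigma>_sym[of p q] by (auto simp: f_def p q v_def)
    qed
  qed
  have fD: "f p = f q" if "p \<in> D" "q \<in> D" for p q
  proof (rule const_on_connected[OF D _ that])
    fix a b assume "a \<in> D" "b \<in> D" and ab: "adjacent a b"
    thus "f a = f b" using f[OF ab] unfolding \<sigma>_def by blast
  qed
  have fC: "f p = f q" if "p \<notin> D" "q \<notin> D" for p q
  proof (rule const_on_connected[OF C])
    fix a b assume "a \<in> - D" "b \<in> - D" and ab: "adjacent a b"
    thus "f a = f b" using f[OF ab] AD unfolding \<sigma>_def by blast
  qed (use that in auto)
  obtain a1 where a1: "a1 \<notin> D" "adjacent a1 a0" using a0 A by (auto simp: inner_boundary_def)
  obtain b1 where b1: "b1 \<notin> D" "adjacent b1 b0" using b0 by (auto simp: inner_boundary_def)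
  have "\<sigma> a1 a0" using a0 a1 by (simp add: \<sigma>_def)
  moreover have "\<not> \<sigma> b1 b0" using b0 b1 AD by (auto simp: \<sigma>_def)
  moreover have "f a0 = f b0" using fD a0 b0 AD by (auto simp: inner_boundary_def)
  moreover have "f a1 = f b1" using fC a1 b1 by blast
  ultimately show False using f[OF a1(2)] f[OF b1(2)] by simp
qed

text \<open>The star-component of a boundary point is a part with no star-neighbour in the rest of
  the boundary, so it is everything.\<close>

lemma inner_boundary_star_connected:
  fixes D :: "(int ^ 2) set"
  assumes "nn_connected D" "nn_connected (- D)"
  shows "star_connected (inner_boundary D)"
  unfolding star_connected_def
proof (intro ballI)
  let ?R = "\<lambda>a b. a \<in> inner_boundary D \<and> b \<in> inner_boundary D \<and> linf (a - b) \<le> 1"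
  fix x y assume x: "x \<in> inner_boundary D" and y: "y \<in> inner_boundary D"
  let ?A = "{z \<in> inner_boundary D. ?R\<^sup>*\<^sup>* x z}"
  have "?A = inner_boundary D"
  proof (rule inner_boundary_no_split[OF assms])
    fix a b assume a: "a \<in> ?A" and b: "b \<in> inner_boundary D - ?A"
    show "\<not> linf (a - b) \<le> 1"
    proof
      assume "linf (a - b) \<le> 1"
      hence "?R a b" using a b by auto
      moreover have "?R\<^sup>*\<^sup>* x a" using a by auto
      ultimately have "?R\<^sup>*\<^sup>* x b" by (rule rtranclp.rtrancl_into_rtrancl[rotated])
      thus False using b by auto
    qed
  qed (use x in auto)
  thus "?R\<^sup>*\<^sup>* x y" using y by blast
qed

lemma nn_path_step: "nn_path E x y \<Longrightarrow> y \<in> E \<Longrightarrow> z \<in> E \<Longrightarrow> adjacent y z \<Longrightarrow> nn_path E x z"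
  by (rule rtranclp.rtrancl_into_rtrancl) (assumption, intro conjI)

lemma nn_path_sym:
  assumes "nn_path E x y"
  shows "nn_path E y x"
  using assms
proof (induction rule: rtranclp_induct)
  case (step y z)
  have "adjacent z y" using step.hyps(2) adjacent_sym by blast
  thus ?case
    by (intro converse_rtranclp_into_rtranclp[OF _ step.IH]) (use step.hyps(2) in simp)
qed simp

lemma nn_path_mono: "nn_path A x y \<Longrightarrow> A \<subseteq> B \<Longrightarrow> nn_path B x y"
  by (erule rtranclp_mono[THEN predicate2D, rotated]) (rule predicate2I, blast)

lemma nn_path_trans: "nn_path E x y \<Longrightarrow> nn_path E y z \<Longrightarrow> nn_path E x z"
  by (rule rtranclp_trans)

lemma nn_path_in:
  assumes "nn_path E x y" "x \<in> E"
  shows "y \<in> E"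
  using assms by (induction rule: rtranclp_induct) blast+

lemma reachable_subset:
  assumes "x \<in> E"
  shows "{y. nn_path E x y} \<subseteq> E"
proof
  fix y assume "y \<in> {y. nn_path E x y}"
  hence "nn_path E x y" by simp
  thus "y \<in> E" using assms by (rule nn_path_in)
qed

lemma nn_path_within_reachable:
  assumes "nn_path E x y"
  shows "nn_path {z. nn_path E x z} x y"
  using assms
proof (induction rule: rtranclp_induct)
  case (step y z)
  have "nn_path E x z" using step.hyps by (rule rtranclp.rtrancl_into_rtrancl)
  thus ?case using step.hyps by (intro nn_path_step[OF step.IH]) simp_all
qed simp

lemma nn_connected_reachable: "nn_connected {y. nn_path E x y}"
  unfolding nn_connected_def
proof (intro ballI)
  fix y z assume yz: "y \<in> {y. nn_path E x y}" "z \<in> {y. nn_path E x y}"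
  have "nn_path {y. nn_path E x y} x y" "nn_path {y. nn_path E x y} x z"
    using yz nn_path_within_reachable[of E x] by simp_all
  from nn_path_trans[OF nn_path_sym[OF this(1)] this(2)] show "nn_path {y. nn_path E x y} y z" .
qed

lemma nn_path_segment:
  fixes f :: "int \<Rightarrow> int ^ 'n::finite"
  assumes "i \<le> j" and "\<And>t. i \<le> t \<Longrightarrow> t \<le> j \<Longrightarrow> f t \<in> E" and "\<And>t. adjacent (f t) (f (t + 1))"
  shows "nn_path E (f i) (f j)"
  using assms(1,2)
proof (induction j rule: int_ge_induct)
  case (step j)
  have "nn_path E (f i) (f j)" by (rule step.IH) (use step.prems in simp)
  moreover have "f j \<in> E" "f (j + 1) \<in> E" using step.hyps step.prems by simp_all
  ultimately show ?case using assms(3) by (rule nn_path_step)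
qed simp

lemma nn_path_horizontal:
  assumes "\<And>t. min x x' \<le> t \<Longrightarrow> t \<le> max x x' \<Longrightarrow> pt t y \<in> E"
  shows "nn_path E (pt x y) (pt x' y)"
proof (cases "x \<le> x'")
  case True
  show ?thesis
    by (rule nn_path_segment[of x x' "\<lambda>t. pt t y"]) (use True assms in \<open>simp_all add: adjacent_pt\<close>)
next
  case False
  show ?thesis
    by (rule nn_path_sym, rule nn_path_segment[of x' x "\<lambda>t. pt t y"]) (use False assms in \<open>simp_all add: adjacent_pt\<close>)
qed

lemma nn_path_vertical:
  assumes "\<And>t. min y y' \<le> t \<Longrightarrow> t \<le> max y y' \<Longrightarrow> pt x t \<in> E"
  shows "nn_path E (pt x y) (pt x y')"
proof (cases "y \<le> y'")
  case True
  show ?thesis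
    by (rule nn_path_segment[of y y' "\<lambda>t. pt x t"]) (use True assms in \<open>simp_all add: adjacent_pt\<close>)
next
  case False
  show ?thesis
    by (rule nn_path_sym, rule nn_path_segment[of y' y "\<lambda>t. pt x t"]) (use False assms in \<open>simp_all add: adjacent_pt\<close>)
qed

lemma nn_path_plane: "nn_path UNIV p (q :: int ^ 2)"
proof -
  obtain x y where p: "p = pt x y" by (rule pt_cases)
  obtain x' y' where q: "q = pt x' y'" by (rule pt_cases)
  have "nn_path UNIV (pt x y) (pt x' y)" by (rule nn_path_horizontal) simp
  moreover have "nn_path UNIV (pt x' y) (pt x' y')" by (rule nn_path_vertical) simp
  ultimately show ?thesis unfolding p q by (rule nn_path_trans)
qed

lemma axis_boundary_point:
  fixes f :: "nat \<Rightarrow> int ^ 2"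
  assumes "f 0 \<notin> D" "f m \<in> D" "\<And>k. adjacent (f k) (f (Suc k))"
  shows "\<exists>k\<ge>1. f k \<in> inner_boundary D"
proof -
  define k where "k = (LEAST k. f k \<in> D)"
  have k: "f k \<in> D" unfolding k_def by (rule LeastI[of "\<lambda>k. f k \<in> D"]) fact
  hence "k \<noteq> 0" using assms(1) by metis
  then obtain j where j: "k = Suc j" using not0_implies_Suc by blast
  have "f j \<notin> D" using not_less_Least[of j "\<lambda>k. f k \<in> D"] j k_def by auto
  hence "f k \<in> inner_boundary D" using k j assms(3) by (auto simp: inner_boundary_def)
  thus ?thesis using j by auto
qed

text \<open>\<open>D\<close> is the unbounded component of the complement of the cluster, and its
  inner boundary surrounds the cluster. The points on the two half-axes show that this boundary,
  seen from \<open>pt a 0\<close>, extends beyond distance \<open>a\<close>, which is what a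
  crossing needs.\<close>

lemma finite_component_blocking:
  fixes V :: "(int ^ 2) set"
  assumes fin: "finite (component V 0)" and "0 \<in> V"
  obtains B a b where "star_connected B" "B \<inter> V = {}" "pt a 0 \<in> B" "pt (- b) 0 \<in> B" "1 \<le> a" "1 \<le> b"
proof -
  define C where "C = component V 0"
  have C_eq: "C = {y. nn_path V 0 y}" using \<open>0 \<in> V\<close> by (simp add: C_def component_def)
  have C0: "0 \<in> C" by (simp add: C_eq)
  have CV: "C \<subseteq> V"
    unfolding C_eq using \<open>0 \<in> V\<close> by (rule reachable_subset)
  have C_conn: "nn_connected C" unfolding C_eq by (rule nn_connected_reachable)
  define r where "r = Max (linf ` C)"
  have r: "linf c \<le> r" if "c \<in> C" for c
    unfolding r_def using fin that by (intro Max_ge) (auto simp: C_def)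
  have r0: "0 \<le> r" using r[OF C0] by simp
  have out: "pt x y \<notin> C" if "r < \<bar>x\<bar> \<or> r < \<bar>y\<bar>" for x y
    using r[of "pt x y"] component_le_linf[of "pt x y" 1] component_le_linf[of "pt x y" 2] that by auto
  define D where "D = {y. nn_path (- C) (pt (r + 1) 0) y}"
  have far: "pt (r + 1) 0 \<in> - C" using out r0 by auto
  have DC: "D \<subseteq> - C"
    unfolding D_def using far by (rule reachable_subset)
  have D_step: "y \<in> D" if "x \<in> D" "y \<notin> C" "adjacent x y" for x y
  proof -
    have "nn_path (- C) (pt (r + 1) 0) y"
    proof (rule nn_path_step)
      show "nn_path (- C) (pt (r + 1) 0) x" using that(1) by (simp add: D_def)
      show "x \<in> - C" "y \<in> - C" using that DC by blast+
    qed fact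
    thus ?thesis by (simp add: D_def)
  qed
  have D_conn: "nn_connected D" unfolding D_def by (rule nn_connected_reachable)
  \<comment> \<open>On the way to the origin, a point outside of both \<open>D\<close> and
    \<open>C\<close> has no neighbour in \<open>D\<close>, so the path stays off \<open>D\<close>
    until it meets \<open>C\<close>. Hence holes of the cluster are attached to it and the
    complement of \<open>D\<close> is connected.\<close>
  have to_C: "\<exists>c\<in>C. nn_path (- D) x c" if "x \<notin> D" for x
  proof -
    have "nn_path UNIV x 0" by (rule nn_path_plane)
    thus ?thesis using that
    proof (induction rule: converse_rtranclp_induct)
      case base
      show ?case by (rule bexI[OF _ C0]) simp
    next
      case (step x y)
      have xy: "adjacent x y" "adjacent y x"
        using step.hyps(1) adjacent_commute by blast+
      show ?case
      proof (cases "x \<in> C")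
        case True
        show ?thesis by (rule bexI[OF _ True]) simp
      next
        case False
        have y: "y \<notin> D" using D_step[OF _ False xy(2)] step.prems by blast
        obtain c where c: "c \<in> C" "nn_path (- D) y c" using step.IH[OF y] by blast
        have "nn_path (- D) x c"
          by (rule converse_rtranclp_into_rtranclp[OF _ c(2)]) (use xy y step.prems in simp)
        thus ?thesis using c(1) by blast
      qed
    qed
  qed
  have D_co: "nn_connected (- D)"
    unfolding nn_connected_def
  proof (intro ballI)
    fix x y assume xy: "x \<in> - D" "y \<in> - D"
    obtain c where c: "c \<in> C" "nn_path (- D) x c" using to_C[of x] xy by blast
    obtain c' where c': "c' \<in> C" "nn_path (- D) y c'" using to_C[of y] xy by blast
    have "nn_path C c c'" using C_conn c(1) c'(1) unfolding nn_connected_def by blast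
    hence "nn_path (- D) c c'" by (rule nn_path_mono) (use DC in blast)
    thus "nn_path (- D) x y"
      by (rule nn_path_trans[OF nn_path_trans[OF c(2)] nn_path_sym[OF c'(2)]])
  qed
  have conn: "star_connected (inner_boundary D)"
    by (rule inner_boundary_star_connected[OF D_conn D_co])
  have disj: "inner_boundary D \<inter> V = {}"
  proof (rule ccontr)
    assume "inner_boundary D \<inter> V \<noteq> {}"
    then obtain x y where x: "x \<in> D" "y \<notin> D" "adjacent y x" "x \<in> V" unfolding inner_boundary_def by blast
    have "adjacent x y" using x(3) adjacent_commute by blast
    hence "y \<in> C" using D_step[OF x(1)] x(2) by blast
    hence "nn_path V 0 y" by (simp add: C_eq)
    hence "nn_path V 0 x"
      by (rule nn_path_step) (use x CV \<open>y \<in> C\<close> in blast)+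
    hence "x \<in> C" by (simp add: C_eq)
    thus False using x(1) DC by blast
  qed
  have "0 \<notin> D" using DC C0 by auto
  have p0: "pt 0 0 = 0" by (simp add: vec_eq_iff forall_2)
  have "pt (int (nat (r + 1))) 0 \<in> D" using r0 by (simp add: D_def)
  hence "\<exists>k\<ge>1. pt (int k) 0 \<in> inner_boundary D"
    using \<open>0 \<notin> D\<close> by (intro axis_boundary_point[where m = "nat (r + 1)"]) (simp_all add: adjacent_pt p0)
  then obtain k where k: "1 \<le> k" "pt (int k) 0 \<in> inner_boundary D" by blast
  have "pt (- int (nat (r + 1))) 0 \<in> D"
  proof -
    have "nn_path (- C) (pt (r + 1) 0) (pt (r + 1) (r + 1))"
      using out r0 by (intro nn_path_vertical) auto
    moreover have "nn_path (- C) (pt (r + 1) (r + 1)) (pt (- (r + 1)) (r + 1))"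
      using out r0 by (intro nn_path_horizontal) auto
    moreover have "nn_path (- C) (pt (- (r + 1)) (r + 1)) (pt (- (r + 1)) 0)"
      using out r0 by (intro nn_path_vertical) auto
    ultimately have "nn_path (- C) (pt (r + 1) 0) (pt (- (r + 1)) 0)"
      by (rule nn_path_trans[OF nn_path_trans])
    thus ?thesis using r0 by (simp add: D_def)
  qed
  hence "\<exists>k\<ge>1. pt (- int k) 0 \<in> inner_boundary D"
    using \<open>0 \<notin> D\<close> by (intro axis_boundary_point[where m = "nat (r + 1)"]) (simp_all add: adjacent_pt p0)
  then obtain l where l: "1 \<le> l" "pt (- int l) 0 \<in> inner_boundary D" by blast
  show ?thesis
    by (rule that[OF conn disj k(2) l(2)]) (use k l in simp_all)
qed

section \<open>Trees in infinite clusters and in blocking circuits\<close>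

lemma scale_bracket:
  assumes "1 \<le> m"
  shows "\<exists>n. scale s n \<le> m \<and> m < scale s (Suc n)"
proof -
  have "m < 2 ^ nat m" using of_nat_less_two_power[of "nat m", where 'a = int] assms by simp
  also have "(2::int) ^ nat m \<le> scale s (nat m)"
    unfolding scale_def by (intro power_mono) auto
  finally have ex: "\<exists>n. m < scale s n" by blast
  define n where "n = (LEAST n. m < scale s n)"
  have n: "m < scale s n" unfolding n_def using ex by (rule LeastI_ex)
  have "n \<noteq> 0"
  proof
    assume "n = 0"
    thus False using n assms by (simp add: scale_def)
  qed
  then obtain j where j: "n = Suc j" using not0_implies_Suc by blast
  have "\<not> m < scale s j" using not_less_Least[of j "\<lambda>n. m < scale s n"] j n_def by auto
  thus ?thesis using n j by (intro exI[of _ j]) auto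
qed

text \<open>A circuit through \<open>pt a 0\<close> has diameter larger than \<open>a\<close>, so
  the depth may be taken with \<open>scale s n \<le> a < scale s (Suc n)\<close>. At depth
  \<open>n\<close> this leaves only \<open>scale s (Suc n)\<close> possible roots, few against a
  probability that decays exponentially in \<open>2 ^ n\<close>.\<close>

lemma not_percolates_imp_blocking_tree:
  fixes V :: "(int ^ 2) set"
  assumes "\<not> percolates V" and s: "2 \<le> s"
  shows "\<exists>n a. 0 \<le> a \<and> a < scale s (Suc n) \<and> (\<exists>A\<in>trees s n (pt a 0). A \<inter> V = {})"
proof (cases "0 \<in> V")
  case False
  have p0: "pt 0 0 = 0" by (simp add: vec_eq_iff forall_2)
  \<comment> \<open>A closed origin is itself a blocking tree of depth 0.\<close>
  show ?thesis using False by (intro exI[of _ "0::nat"] exI[of _ "0::int"]) (auto simp: p0)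
next
  case True
  have "finite (component V 0)" using assms by (simp add: percolates_def)
  from this True obtain B a b where B: "star_connected B" "B \<inter> V = {}" "pt a 0 \<in> B" "pt (- b) 0 \<in> B"
    "1 \<le> a" "1 \<le> b" by (rule finite_component_blocking)
  obtain n where n: "scale s n \<le> a" "a < scale s (Suc n)" using scale_bracket[OF B(5)] by blast
  have "\<not> linf (pt (- b) 0 - pt a 0) \<le> a" using B by (simp add: linf_pt)
  hence "\<exists>A\<in>trees s n (pt a 0). A \<subseteq> B"
    using B n s less_imp_le[OF scale_pos[of s n]] by (intro crossing_contains_tree[of B "pt a 0" _ _ _ "pt (- b) 0"]) auto
  then obtain A where "A \<in> trees s n (pt a 0)" "A \<inter> V = {}" using B(2) by blast
  thus ?thesis using B(5) n by (intro exI[of _ n] exI[of _ a]) auto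
qed

lemma percolates_imp_tree:
  fixes V :: "(int ^ 'n::finite) set"
  assumes "percolates V" and s: "2 \<le> s"
  shows "\<exists>A\<in>trees s n 0. A \<subseteq> V"
proof -
  define C where "C = component V 0"
  have inf: "infinite C" using assms by (simp add: percolates_def C_def)
  hence V0: "0 \<in> V" by (auto simp: C_def component_def)
  hence C_eq: "C = {y. nn_path V 0 y}" by (simp add: C_def component_def)
  have CV: "C \<subseteq> V"
    unfolding C_eq using V0 by (rule reachable_subset)
  have "star_connected C"
    unfolding star_connected_def
  proof (intro ballI)
    fix x y assume "x \<in> C" "y \<in> C"
    hence "nn_path C x y" using nn_connected_reachable[of V 0] by (simp add: nn_connected_def C_eq)
    thus "(\<lambda>a b. a \<in> C \<and> b \<in> C \<and> linf (a - b) \<le> 1)\<^sup>*\<^sup>* x y"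
    proof (rule rtranclp_mono[THEN predicate2D, rotated], intro predicate2I)
      fix a b assume ab: "a \<in> C \<and> b \<in> C \<and> adjacent a b"
      have "\<bar>(a - b) $ i\<bar> \<le> (\<Sum>i\<in>UNIV. \<bar>a $ i - b $ i\<bar>)" for i
        using member_le_sum[of i UNIV "\<lambda>i. \<bar>a $ i - b $ i\<bar>"] by auto
      hence "linf (a - b) \<le> 1" using ab by (simp add: linf_le_iff adjacent_def)
      thus "a \<in> C \<and> b \<in> C \<and> linf (a - b) \<le> 1" using ab by blast
    qed
  qed
  moreover obtain q where "q \<in> C" "scale s n \<le> linf q"
  proof -
    have "\<not> C \<subseteq> {a. linf a \<le> scale s n}" using inf finite_linf_ball finite_subset by blast
    then obtain q where "q \<in> C" "\<not> linf q \<le> scale s n" by blast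
    thus ?thesis by (intro that[of q]) auto
  qed
  moreover have "0 \<in> C" by (simp add: C_eq)
  ultimately have "\<exists>A\<in>trees s n 0. A \<subseteq> C"
    using s less_imp_le[OF scale_pos[of s n]] by (intro crossing_contains_tree[of C 0 _ _ _ q]) auto
  thus ?thesis using CV by blast
qed

subsection \<open>Probability that the interlacement hits many sparse obstacles\<close>

lemma random_interlacement_measurable:
  assumes "random_interlacement M u I"
  shows "Measurable.pred M (\<lambda>\<omega>. x \<in> I \<omega>)"
proof -
  have "(\<lambda>\<omega> x. x \<in> I \<omega>) \<in> measurable M config_space"
    using assms unfolding random_interlacement_def by (rule conjunct1)
  from measurable_compose[OF this measurable_component_singleton[of x UNIV]] show ?thesis by simp
qed

lemma random_interlacement_avoid:
  assumes "random_interlacement M u I" "finite K"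
  shows "measure M {\<omega> \<in> space M. I \<omega> \<inter> K = {}} = exp (- u * cap K)"
  using assms by (simp add: random_interlacement_def)

lemma random_interlacement_avoid_pred:
  assumes "random_interlacement M u I" "finite K"
  shows "Measurable.pred M (\<lambda>\<omega>. I \<omega> \<inter> K = {})"
proof -
  note random_interlacement_measurable[OF assms(1), measurable]
  have "Measurable.pred M (\<lambda>\<omega>. \<forall>x\<in>K. x \<notin> I \<omega>)" using assms(2) by measurable
  moreover have "I \<omega> \<inter> K = {} \<longleftrightarrow> (\<forall>x\<in>K. x \<notin> I \<omega>)" for \<omega> by blast
  ultimately show ?thesis by simp
qed

context sparse_obstacles
begin

definition hit_set :: "'d site set \<Rightarrow> 'i set" where
  "hit_set J = {z \<in> S. J \<inter> K z \<noteq> {}}"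

definition hit_prob :: "'w measure \<Rightarrow> ('w \<Rightarrow> 'd site set) \<Rightarrow> 'i set \<Rightarrow> real" where
  "hit_prob M J B = measure M {\<omega> \<in> space M. hit_set (J \<omega>) = B}"

lemma hit_set_subset: "hit_set J \<subseteq> S"
  by (auto simp: hit_set_def)

lemma hit_set_pred:
  assumes "random_interlacement M u J"
  shows "Measurable.pred M (\<lambda>\<omega>. hit_set (J \<omega>) = B)"
proof (cases "B \<subseteq> S")
  case True
  note random_interlacement_avoid_pred[OF assms finite_K, measurable]
  have "Measurable.pred M (\<lambda>\<omega>. \<forall>z\<in>S. \<not> J \<omega> \<inter> K z = {} \<longleftrightarrow> z \<in> B)"
    using finite_S by measurable
  moreover have "hit_set (J \<omega>) = B \<longleftrightarrow> (\<forall>z\<in>S. \<not> J \<omega> \<inter> K z = {} \<longleftrightarrow> z \<in> B)" for \<omega>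
    using True by (auto simp: hit_set_def)
  ultimately show ?thesis by simp
next
  case False
  hence "(\<lambda>\<omega>. hit_set (J \<omega>) = B) = (\<lambda>_. False)" using hit_set_subset by blast
  thus ?thesis by simp
qed

text \<open>All obstacles of \<open>A\<close> are avoided exactly when the hit set lies in
  \<open>S - A\<close>. So capacities of unions determine the law of the hit set.\<close>

lemma exp_cap_eq:
  assumes "prob_space M" and J: "random_interlacement M u J" and A: "A \<subseteq> S"
  shows "exp (- u * cap (\<Union>z\<in>A. K z)) = (\<Sum>B\<in>Pow (S - A). hit_prob M J B)"
proof -
  interpret prob_space M by fact
  have finA: "finite (\<Union>z\<in>A. K z)" using A finite_S finite_K finite_subset by blast
  have [measurable]: "Measurable.pred M (\<lambda>\<omega>. hit_set (J \<omega>) = B)" for B by (rule hit_set_pred[OF J])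
  have "exp (- u * cap (\<Union>z\<in>A. K z)) = prob {\<omega> \<in> space M. J \<omega> \<inter> (\<Union>z\<in>A. K z) = {}}"
    by (rule random_interlacement_avoid[OF J finA, symmetric])
  also have "{\<omega> \<in> space M. J \<omega> \<inter> (\<Union>z\<in>A. K z) = {}} = (\<Union>B\<in>Pow (S - A). {\<omega> \<in> space M. hit_set (J \<omega>) = B})"
  proof -
    have "J \<omega> \<inter> (\<Union>z\<in>A. K z) = {} \<longleftrightarrow> hit_set (J \<omega>) \<in> Pow (S - A)" for \<omega>
      using A unfolding hit_set_def by blast
    thus ?thesis by blast
  qed
  also have "prob \<dots> = (\<Sum>B\<in>Pow (S - A). hit_prob M J B)"
    unfolding hit_prob_def using finite_S
    by (intro finite_measure_finite_Union) (auto simp: disjoint_family_on_def)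
  finally show ?thesis .
qed

definition weight :: "'i set \<Rightarrow> 'i set \<Rightarrow> real" where
  "weight R A = \<rho> ^ card (R - A) * (1 - \<rho>) ^ card A"

lemma sum_weight: "R \<subseteq> S \<Longrightarrow> (\<Sum>A\<in>Pow R. weight R A) = 1"
  unfolding weight_def using sum_Pow_weights finite_subset[OF _ finite_S] by blast

text \<open>Only the \<open>A\<close> disjoint from the hit set \<open>B\<close> survive the
  exchange of sums, and for them the weight splits off \<open>\<rho> ^ card B\<close>. With
  \<open>g = 1\<close> this is the generating function of the number of hit obstacles, with
  \<open>g A = - cap (\<Union>z\<in>A. K z)\<close> its derivative in the level.\<close>

lemma weighted_sum_eq:
  assumes "prob_space M" and J: "random_interlacement M u J"
  shows "(\<Sum>A\<in>Pow S. weight S A * g A * exp (- u * cap (\<Union>z\<in>A. K z))) =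
     (\<Sum>B\<in>Pow S. hit_prob M J B * \<rho> ^ card B * (\<Sum>A\<in>Pow (S - B). weight (S - B) A * g A))"
proof -
  have "(\<Sum>A\<in>Pow S. weight S A * g A * exp (- u * cap (\<Union>z\<in>A. K z))) =
      (\<Sum>A\<in>Pow S. \<Sum>B\<in>Pow (S - A). weight S A * g A * hit_prob M J B)"
    using exp_cap_eq[OF assms] by (intro sum.cong) (auto simp: sum_distrib_left)
  also have "\<dots> = (\<Sum>A\<in>Pow S. \<Sum>B\<in>Pow S. if A \<inter> B = {} then weight S A * g A * hit_prob M J B else 0)"
    using finite_S by (intro sum.cong sum.mono_neutral_cong_left) auto
  also have "\<dots> = (\<Sum>B\<in>Pow S. \<Sum>A\<in>Pow S. if A \<inter> B = {} then weight S A * g A * hit_prob M J B else 0)"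
    by (rule sum.swap)
  also have "\<dots> = (\<Sum>B\<in>Pow S. \<Sum>A\<in>Pow (S - B). weight S A * g A * hit_prob M J B)"
    using finite_S by (intro sum.cong sum.mono_neutral_cong_right) auto
  also have "\<dots> = (\<Sum>B\<in>Pow S. hit_prob M J B * \<rho> ^ card B * (\<Sum>A\<in>Pow (S - B). weight (S - B) A * g A))"
  proof (intro sum.cong refl)
    fix B assume B: "B \<in> Pow S"
    have "weight S A = \<rho> ^ card B * weight (S - B) A" if "A \<in> Pow (S - B)" for A
    proof -
      have fin: "finite B" "finite (S - B - A)" using B finite_S finite_subset by auto
      have "S - A = B \<union> (S - B - A)" "B \<inter> (S - B - A) = {}" using that B by auto
      hence "card (S - A) = card B + card (S - B - A)" using fin by (simp only: card_Un_disjoint)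
      thus ?thesis by (simp add: weight_def power_add)
    qed
    thus "(\<Sum>A\<in>Pow (S - B). weight S A * g A * hit_prob M J B) =
        hit_prob M J B * \<rho> ^ card B * (\<Sum>A\<in>Pow (S - B). weight (S - B) A * g A)"
      by (simp add: sum_distrib_left mult_ac)
  qed
  finally show ?thesis .
qed

text \<open>The generating function \<open>E[\<rho> ^ card (hit_set I\<^sup>u)]\<close> satisfies \<open>F' \<le> c F\<close>.\<close>

lemma prob_hit_all_le:
  assumes M: "prob_space M" and J: "\<And>u. 0 \<le> u \<Longrightarrow> random_interlacement M u (J u)" and u: "0 \<le> u"
  shows "measure M {\<omega> \<in> space M. \<forall>z\<in>S. J u \<omega> \<inter> K z \<noteq> {}} \<le> (exp (2 * (\<rho> - 1) * k * u) / \<rho>) ^ card S"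
proof -
  define c where "c = 2 * (\<rho> - 1) * k * card S"
  define F where "F v = (\<Sum>A\<in>Pow S. weight S A * 1 * exp (- v * cap (\<Union>z\<in>A. K z)))" for v
  define F' where "F' v = (\<Sum>A\<in>Pow S. weight S A * - cap (\<Union>z\<in>A. K z) * exp (- v * cap (\<Union>z\<in>A. K z)))" for v
  have p_nonneg: "0 \<le> hit_prob M (J v) B" for v B by (simp add: hit_prob_def)
  have deriv: "(F has_real_derivative F' v) (at v)" for v
    unfolding F_def F'_def
    by (rule DERIV_sum) (auto intro!: derivative_eq_intros simp del: mult_minus_left mult_minus_right)
  have F_eq: "F v = (\<Sum>B\<in>Pow S. hit_prob M (J v) B * \<rho> ^ card B)" if "0 \<le> v" for v
  proof -
    have "F v = (\<Sum>B\<in>Pow S. hit_prob M (J v) B * \<rho> ^ card B * (\<Sum>A\<in>Pow (S - B). weight (S - B) A * 1))"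
      unfolding F_def by (rule weighted_sum_eq[OF M J[OF that]])
    thus ?thesis by (simp add: sum_weight)
  qed
  have F'_le: "F' v \<le> c * F v" if "0 \<le> v" for v
  proof -
    have "F' v = (\<Sum>B\<in>Pow S. hit_prob M (J v) B * \<rho> ^ card B *
        (\<Sum>A\<in>Pow (S - B). weight (S - B) A * - cap (\<Union>z\<in>A. K z)))"
      unfolding F'_def by (rule weighted_sum_eq[OF M J[OF that]])
    also have "\<dots> \<le> (\<Sum>B\<in>Pow S. hit_prob M (J v) B * \<rho> ^ card B * c)"
    proof (intro sum_mono mult_left_mono)
      fix B
      \<comment> \<open>When exactly \<open>B\<close> is hit, the growth comes from the obstacles
        outside \<open>B\<close>; \<open>cap_alternating_le\<close> bounds their contribution
        uniformly in \<open>B\<close>.\<close>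
      have "(\<Sum>A\<in>Pow (S - B). weight (S - B) A * - cap (\<Union>z\<in>A. K z)) \<le> 2 * (\<rho> - 1) * k * card (S - B)"
        using cap_alternating_le[of "S - B"] by (simp add: weight_def sum_negf)
      also have "\<dots> \<le> c"
        unfolding c_def using lambda finite_S by (intro mult_left_mono) (auto intro: card_mono)
      finally show "(\<Sum>A\<in>Pow (S - B). weight (S - B) A * - cap (\<Union>z\<in>A. K z)) \<le> c" .
      show "0 \<le> hit_prob M (J v) B * \<rho> ^ card B" using p_nonneg lambda by auto
    qed
    also have "\<dots> = c * F v" by (simp add: F_eq[OF that] sum_distrib_left mult_ac)
    finally show ?thesis .
  qed
  \<comment> \<open>Gronwall's argument for \<open>F' \<le> c * F\<close>.\<close>
  have "F u * exp (- c * u) \<le> F 0 * exp (- c * 0)"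
  proof (rule DERIV_nonpos_imp_nonincreasing[OF u])
    fix v assume v: "0 \<le> v" "v \<le> u"
    have "((\<lambda>v. F v * exp (- c * v)) has_real_derivative (F' v - c * F v) * exp (- c * v)) (at v)"
      by (auto intro!: derivative_eq_intros deriv simp: algebra_simps)
    moreover have "(F' v - c * F v) * exp (- c * v) \<le> 0"
      using F'_le[OF v(1)] by (simp add: mult_le_0_iff)
    ultimately show "\<exists>y. ((\<lambda>v. F v * exp (- c * v)) has_real_derivative y) (at v) \<and> y \<le> 0" by blast
  qed
  moreover have "F 0 = 1" by (simp add: F_def sum_weight)
  ultimately have F_le: "F u \<le> exp (c * u)" by (simp add: exp_minus field_simps)
  \<comment> \<open>Markov's inequality: only the term in which every obstacle is hit is
    kept.\<close>
  have "hit_prob M (J u) S * \<rho> ^ card S \<le> F u"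
    unfolding F_eq[OF u] using p_nonneg lambda finite_S
    by (intro member_le_sum[of S _ "\<lambda>B. hit_prob M (J u) B * \<rho> ^ card B"]) auto
  hence "hit_prob M (J u) S \<le> exp (c * u) / \<rho> ^ card S"
    using F_le lambda by (simp add: field_simps)
  also have "exp (c * u) = exp (2 * (\<rho> - 1) * k * u) ^ card S"
    by (simp add: exp_of_nat_mult[symmetric] c_def mult_ac)
  also have "\<dots> / \<rho> ^ card S = (exp (2 * (\<rho> - 1) * k * u) / \<rho>) ^ card S"
    by (simp add: power_divide)
  also have "hit_prob M (J u) S = measure M {\<omega> \<in> space M. \<forall>z\<in>S. J u \<omega> \<inter> K z \<noteq> {}}"
    unfolding hit_prob_def by (intro arg_cong[where f = "measure M"]) (auto simp: hit_set_def)
  finally show ?thesis .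
qed

end

subsection \<open>Noise\<close>

lemma bernoulli_field_prob:
  assumes "prob_space M" "bernoulli_field M \<epsilon> \<theta>" "0 \<le> \<epsilon>" "\<epsilon> \<le> 1" "finite A"
  shows "measure M {\<omega> \<in> space M. \<forall>x\<in>A. \<theta> x \<omega>} = \<epsilon> ^ card A"
proof (cases "A = {}")
  case True
  thus ?thesis using prob_space.prob_space[OF assms(1)] by simp
next
  case False
  interpret prob_space M by fact
  have ind: "indep_vars (\<lambda>_. count_space UNIV) \<theta> UNIV"
    and d: "\<And>x. distr M (count_space UNIV) (\<theta> x) = measure_pmf (bernoulli_pmf \<epsilon>)"
    using assms(2) by (auto simp: bernoulli_field_def)
  have rv: "random_variable (count_space UNIV) (\<theta> x)" for x
    using ind by (auto simp: indep_vars_def)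
  have "prob (\<theta> x -` {True} \<inter> space M) = \<epsilon>" for x
  proof -
    have "prob (\<theta> x -` {True} \<inter> space M) = measure (distr M (count_space UNIV) (\<theta> x)) {True}"
      by (subst measure_distr[OF rv]) auto
    also have "\<dots> = \<epsilon>" unfolding d using assms(3,4) by (simp add: measure_pmf_single)
    finally show ?thesis .
  qed
  moreover have "prob (\<Inter>x\<in>A. \<theta> x -` {True} \<inter> space M) = (\<Prod>x\<in>A. prob (\<theta> x -` {True} \<inter> space M))"
    using ind False assms(5) by (intro indep_varsD) auto
  moreover have "(\<Inter>x\<in>A. \<theta> x -` {True} \<inter> space M) = {\<omega> \<in> space M. \<forall>x\<in>A. \<theta> x \<omega>}"
    using False by auto
  ultimately show ?thesis by simp
qed

lemma bernoulli_field_pred: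
  assumes "prob_space M" "bernoulli_field M \<epsilon> \<theta>"
  shows "Measurable.pred M (\<theta> x)"
  using assms by (auto simp: bernoulli_field_def prob_space.indep_vars_def)

text \<open>Union bound over the choice of one noisy site in each \<open>K z\<close>. Disjointness
  makes every choice injective, so its probability is exactly
  \<open>\<epsilon> ^ card B\<close>.\<close>

lemma bernoulli_field_hits_all_le:
  assumes M: "prob_space M" and \<theta>: "bernoulli_field M \<epsilon> \<theta>" and \<epsilon>: "0 \<le> \<epsilon>" "\<epsilon> \<le> 1"
    and B: "finite B" and K: "\<And>z. finite (K z)" "\<And>z. card (K z) \<le> k" and disj: "disjoint_family_on K B"
  shows "measure M {\<omega> \<in> space M. \<forall>z\<in>B. \<exists>y\<in>K z. \<theta> y \<omega>} \<le> (k * \<epsilon>) ^ card B"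
proof -
  interpret prob_space M by fact
  note bernoulli_field_pred[OF M \<theta>, measurable]
  have "{\<omega> \<in> space M. \<forall>z\<in>B. \<exists>y\<in>K z. \<theta> y \<omega>} = (\<Union>f\<in>Pi\<^sub>E B K. {\<omega> \<in> space M. \<forall>x\<in>f ` B. \<theta> x \<omega>})"
    (is "?L = ?R")
  proof (intro equalityI subsetI)
    fix \<omega> assume \<omega>: "\<omega> \<in> ?L"
    hence "\<exists>f. \<forall>z\<in>B. f z \<in> K z \<and> \<theta> (f z) \<omega>" by (intro bchoice) auto
    then obtain f where f: "\<forall>z\<in>B. f z \<in> K z \<and> \<theta> (f z) \<omega>" by blast
    thus "\<omega> \<in> ?R" using \<omega> by (intro UN_I[of "restrict f B"]) auto
  qed (auto simp: PiE_iff)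
  also have "prob \<dots> \<le> (\<Sum>f\<in>Pi\<^sub>E B K. prob {\<omega> \<in> space M. \<forall>x\<in>f ` B. \<theta> x \<omega>})"
  proof (intro finite_measure_subadditive_finite finite_PiE B K image_subsetI)
    fix f assume "f \<in> Pi\<^sub>E B K"
    show "{\<omega> \<in> space M. \<forall>x\<in>f ` B. \<theta> x \<omega>} \<in> events" using B by measurable
  qed
  also have "\<dots> = (\<Sum>f\<in>Pi\<^sub>E B K. \<epsilon> ^ card B)"
  proof (intro sum.cong refl)
    fix f assume f: "f \<in> Pi\<^sub>E B K"
    have "inj_on f B"
    proof (rule inj_onI)
      fix x y assume xy: "x \<in> B" "y \<in> B" "f x = f y"
      hence "f x \<in> K x \<inter> K y" using f by (auto simp: PiE_iff)
      thus "x = y" using disj xy by (auto simp: disjoint_family_on_def)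
    qed
    thus "prob {\<omega> \<in> space M. \<forall>x\<in>f ` B. \<theta> x \<omega>} = \<epsilon> ^ card B"
      using bernoulli_field_prob[OF M \<theta> \<epsilon>, of "f ` B"] B by (simp add: card_image)
  qed
  also have "\<dots> = (\<Prod>z\<in>B. card (K z)) * \<epsilon> ^ card B" using B by (simp add: card_PiE)
  also have "\<dots> \<le> k ^ card B * \<epsilon> ^ card B"
  proof (intro mult_right_mono)
    have "(\<Prod>z\<in>B. card (K z)) \<le> (\<Prod>z\<in>B. k)" by (intro prod_mono) (auto intro: K)
    thus "real (\<Prod>z\<in>B. card (K z)) \<le> real (k ^ card B)" by (simp only: of_nat_le_iff prod_constant)
  qed (use \<epsilon> in auto)
  finally show ?thesis by (simp add: power_mult_distrib)
qed

text \<open>The event is split according to the set \<open>T\<close> of indices served by the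
  interlacement; the others must be served by the noise. Independence gives a product for each
  \<open>T\<close>, and the binomial theorem sums them. \<open>Q\<close> is vacancy of a site in one
  application and being hit in the other.\<close>

lemma interlacement_or_noise_le:
  assumes M: "prob_space M" and ind: "noise_independent M J \<theta>"
    and \<theta>: "bernoulli_field M \<epsilon> \<theta>" and \<epsilon>: "0 \<le> \<epsilon>" "\<epsilon> \<le> 1"
    and A: "finite A" and K: "\<And>z. finite (K z)" "\<And>z. card (K z) \<le> k" and disj: "disjoint_family_on K A"
    and Q: "\<And>z. Measurable.pred config_space (Q z)"
    and bound: "\<And>T. T \<subseteq> A \<Longrightarrow> measure M {\<omega> \<in> space M. \<forall>z\<in>T. Q z (\<lambda>x. x \<in> J \<omega>)} \<le> q ^ card T"
  shows "measure M {\<omega> \<in> space M. \<forall>z\<in>A. Q z (\<lambda>x. x \<in> J \<omega>) \<or> (\<exists>y\<in>K z. \<theta> y \<omega>)} \<le> (q + k * \<epsilon>) ^ card A"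
proof -
  interpret prob_space M by fact
  have iv: "indep_var config_space (\<lambda>\<omega> x. x \<in> J \<omega>) config_space (\<lambda>\<omega> x. \<theta> x \<omega>)"
    using ind by (simp add: noise_independent_def)
  note Jm = indep_var_rv1[OF iv]
  note [measurable] = bernoulli_field_pred[OF M \<theta>] Q Jm
  have sp: "space config_space = UNIV" by (simp add: space_PiM)
  have [measurable]: "Measurable.pred M (\<lambda>\<omega>. Q z (\<lambda>x. x \<in> J \<omega>))" for z
    using measurable_compose[OF Jm Q] by simp
  have split: "{\<omega> \<in> space M. \<forall>z\<in>A. Q z (\<lambda>x. x \<in> J \<omega>) \<or> (\<exists>y\<in>K z. \<theta> y \<omega>)} \<subseteq>
      (\<Union>T\<in>Pow A. {\<omega> \<in> space M. (\<forall>z\<in>T. Q z (\<lambda>x. x \<in> J \<omega>)) \<and> (\<forall>z\<in>A - T. \<exists>y\<in>K z. \<theta> y \<omega>)})" (is "?L \<subseteq> ?R")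
  proof
    fix \<omega> assume "\<omega> \<in> ?L"
    thus "\<omega> \<in> ?R" by (intro UN_I[of "{z\<in>A. Q z (\<lambda>x. x \<in> J \<omega>)}"]) auto
  qed
  have ev: "{\<omega> \<in> space M. (\<forall>z\<in>T. Q z (\<lambda>x. x \<in> J \<omega>)) \<and> (\<forall>z\<in>A - T. \<exists>y\<in>K z. \<theta> y \<omega>)} \<in> events" if "T \<in> Pow A" for T
  proof -
    have fin: "finite T" "finite (A - T)" using that A finite_subset by auto
    have [measurable]: "Measurable.pred M (\<lambda>\<omega>. \<exists>y\<in>K z. \<theta> y \<omega>)" for z
      using K(1)[of z] by measurable
    have [measurable]: "Measurable.pred M (\<lambda>\<omega>. \<forall>z\<in>A - T. \<exists>y\<in>K z. \<theta> y \<omega>)"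
      using fin(2) by measurable
    show ?thesis using fin by measurable
  qed
  have "prob ?L \<le> prob ?R" using split ev A by (intro finite_measure_mono) auto
  also have "\<dots> \<le> (\<Sum>T\<in>Pow A. prob {\<omega> \<in> space M. (\<forall>z\<in>T. Q z (\<lambda>x. x \<in> J \<omega>)) \<and> (\<forall>z\<in>A - T. \<exists>y\<in>K z. \<theta> y \<omega>)})"
    using A ev by (intro finite_measure_subadditive_finite) auto
  also have "\<dots> \<le> (\<Sum>T\<in>Pow A. q ^ card T * (k * \<epsilon>) ^ card (A - T))"
  proof (intro sum_mono)
    fix T assume T: "T \<in> Pow A"
    have finT: "finite T" using T A finite_subset by auto
    let ?X = "{i. \<forall>z\<in>T. Q z i}" and ?Y = "{t. \<forall>z\<in>A - T. \<exists>y\<in>K z. t y}"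
    have "{i \<in> space config_space. \<forall>z\<in>T. Q z i} \<in> sets config_space" using finT by measurable
    hence X: "?X \<in> sets config_space" by (simp add: sp)
    have [measurable]: "Measurable.pred config_space (\<lambda>t. \<exists>y\<in>K z. t y)" for z
      using K(1)[of z] by measurable
    have "finite (A - T)" using A by simp
    hence "{t \<in> space config_space. \<forall>z\<in>A - T. \<exists>y\<in>K z. t y} \<in> sets config_space" by measurable
    hence Y: "?Y \<in> sets config_space" by (simp add: sp)
    have "prob {\<omega> \<in> space M. (\<forall>z\<in>T. Q z (\<lambda>x. x \<in> J \<omega>)) \<and> (\<forall>z\<in>A - T. \<exists>y\<in>K z. \<theta> y \<omega>)} =
      prob ((\<lambda>\<omega>. (\<lambda>x. x \<in> J \<omega>, \<lambda>x. \<theta> x \<omega>)) -` (?X \<times> ?Y) \<inter> space M)"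
      by (intro arg_cong[where f = prob]) auto
    also have "\<dots> = prob ((\<lambda>\<omega> x. x \<in> J \<omega>) -` ?X \<inter> space M) * prob ((\<lambda>\<omega> x. \<theta> x \<omega>) -` ?Y \<inter> space M)"
      by (rule indep_varD[OF iv X Y])
    also have "(\<lambda>\<omega> x. x \<in> J \<omega>) -` ?X \<inter> space M = {\<omega> \<in> space M. \<forall>z\<in>T. Q z (\<lambda>x. x \<in> J \<omega>)}" by auto
    also have "(\<lambda>\<omega> x. \<theta> x \<omega>) -` ?Y \<inter> space M = {\<omega> \<in> space M. \<forall>z\<in>A - T. \<exists>y\<in>K z. \<theta> y \<omega>}" by auto
    also have "prob {\<omega> \<in> space M. \<forall>z\<in>T. Q z (\<lambda>x. x \<in> J \<omega>)} * prob {\<omega> \<in> space M. \<forall>z\<in>A - T. \<exists>y\<in>K z. \<theta> y \<omega>}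
        \<le> q ^ card T * (k * \<epsilon>) ^ card (A - T)"
    proof (intro mult_mono)
      show "prob {\<omega> \<in> space M. \<forall>z\<in>T. Q z (\<lambda>x. x \<in> J \<omega>)} \<le> q ^ card T" using T bound by auto
      show "prob {\<omega> \<in> space M. \<forall>z\<in>A - T. \<exists>y\<in>K z. \<theta> y \<omega>} \<le> (k * \<epsilon>) ^ card (A - T)"
        using A by (intro bernoulli_field_hits_all_le[OF M \<theta> \<epsilon> _ K] disjoint_family_on_mono[OF _ disj]) auto
      show "0 \<le> q ^ card T" using T bound[of T] measure_nonneg order_trans by blast
    qed auto
    finally show "prob {\<omega> \<in> space M. (\<forall>z\<in>T. Q z (\<lambda>x. x \<in> J \<omega>)) \<and> (\<forall>z\<in>A - T. \<exists>y\<in>K z. \<theta> y \<omega>)}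
        \<le> q ^ card T * (k * \<epsilon>) ^ card (A - T)" .
  qed
  also have "\<dots> = (q + k * \<epsilon>) ^ card A"
    using prod_add[OF A, of "\<lambda>_. q" "\<lambda>_. k * \<epsilon>"] by simp
  finally show ?thesis .
qed

subsection \<open>Monotonicity in the level\<close>

text \<open>The law of a random set is determined by its avoidance probabilities: avoidance events
  of finite sets are stable under intersection and generate the product sigma-algebra.\<close>

lemma config_measure_eqI:
  fixes N N' :: "('d::finite site \<Rightarrow> bool) measure"
  assumes "prob_space N" "sets N = sets config_space" "sets N' = sets config_space"
    and eq: "\<And>K. finite K \<Longrightarrow> emeasure N {i. \<forall>x\<in>K. \<not> i x} = emeasure N' {i. \<forall>x\<in>K. \<not> i x}"
  shows "N = N'"
proof -
  let ?E = "{{i :: 'd site \<Rightarrow> bool. \<forall>x\<in>K. \<not> i x} | K. finite K}"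
  have sp: "space config_space = (UNIV :: ('d site \<Rightarrow> bool) set)" by (simp add: space_PiM)
  have "{i. \<forall>x\<in>K. \<not> i x} \<in> sets config_space" if "finite K" for K :: "'d site set"
  proof -
    have "{i \<in> space config_space. \<forall>x\<in>K. \<not> i x} \<in> sets config_space" using that by measurable
    thus ?thesis by (simp add: sp)
  qed
  note a = this
  have b: "{f. f x \<in> A} \<in> sigma_sets UNIV ?E" for x :: "'d site" and A
  proof -
    have f: "{i. \<not> i x} \<in> sigma_sets UNIV ?E"
      by (intro sigma_sets.Basic CollectI exI[of _ "{x}"]) auto
    have t: "{i. i x} \<in> sigma_sets UNIV ?E"
    proof -
      have "UNIV - {i. \<not> i x} \<in> sigma_sets UNIV ?E" by (rule sigma_sets.Compl[OF f])
      moreover have "UNIV - {i. \<not> i x} = {i. i x}" by auto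
      ultimately show ?thesis by simp
    qed
    have "A = {} \<or> A = {True} \<or> A = {False} \<or> A = UNIV"
      by (cases "True \<in> A"; cases "False \<in> A") (auto simp: UNIV_bool, (metis (full_types))+)
    thus ?thesis
    proof (elim disjE)
      assume "A = UNIV"
      thus ?thesis by (simp add: sigma_sets_top)
    qed (use f t in \<open>simp_all add: sigma_sets.Empty\<close>)
  qed
  have G: "sets config_space = sigma_sets UNIV {{f :: 'd site \<Rightarrow> bool. f x \<in> A} | x A. True}"
    using sets_PiM_single[of "UNIV :: 'd site set" "\<lambda>_. count_space (UNIV :: bool set)"] by (simp add: PiE_UNIV_domain)
  have sigma: "sets config_space = sigma_sets UNIV ?E"
    unfolding G
  proof (rule sigma_sets_eqI)
    fix X assume "X \<in> {{f :: 'd site \<Rightarrow> bool. f x \<in> A} | x A. True}"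
    thus "X \<in> sigma_sets UNIV ?E" using b by auto
  next
    fix X assume "X \<in> ?E"
    thus "X \<in> sigma_sets UNIV {{f :: 'd site \<Rightarrow> bool. f x \<in> A} | x A. True}" using a unfolding G by auto
  qed
  show ?thesis
  proof (rule measure_eqI_generator_eq)
    show "Int_stable ?E"
    proof (rule Int_stableI)
      fix a b assume "a \<in> ?E" "b \<in> ?E"
      then obtain K L where "finite K" "finite L" "a = {i. \<forall>x\<in>K. \<not> i x}" "b = {i. \<forall>x\<in>L. \<not> i x}" by auto
      thus "a \<inter> b \<in> ?E" by (intro CollectI exI[of _ "K \<union> L"]) auto
    qed
    show "?E \<subseteq> Pow UNIV" by auto
    show "emeasure N X = emeasure N' X" if "X \<in> ?E" for X using that eq by auto
    show "sets N = sigma_sets UNIV ?E" "sets N' = sigma_sets UNIV ?E" using assms(2,3) sigma by simp_all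
    show "range (\<lambda>_::nat. UNIV) \<subseteq> ?E" by (auto intro!: exI[of _ "{}"])
    show "emeasure N UNIV \<noteq> \<infinity>"
      using prob_space.emeasure_space_1[OF assms(1)] sets_eq_imp_space_eq[OF assms(2)] sp by simp
  qed auto
qed

definition interlacement_law :: "'w measure \<Rightarrow> ('w \<Rightarrow> 'd::finite site set) \<Rightarrow> ('d site \<Rightarrow> bool) measure" where
  "interlacement_law M I = distr M config_space (\<lambda>\<omega> x. x \<in> I \<omega>)"

abbreviation noise_law :: "real \<Rightarrow> ('d::finite site \<Rightarrow> bool) measure" where
  "noise_law \<epsilon> \<equiv> PiM UNIV (\<lambda>_. measure_pmf (bernoulli_pmf \<epsilon>))"

lemma space_config [simp]: "space config_space = UNIV"
  by (simp add: space_PiM)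

lemma avoid_in_sets_config: "finite K \<Longrightarrow> {i. \<forall>x\<in>K. \<not> i x} \<in> sets config_space"
proof -
  assume "finite K"
  hence "{i \<in> space config_space. \<forall>x\<in>K. \<not> i x} \<in> sets config_space" by measurable
  thus ?thesis by simp
qed

lemma prob_space_interlacement_law:
  assumes "prob_space M" "random_interlacement M u I"
  shows "prob_space (interlacement_law M I)"
  unfolding interlacement_law_def using assms
  by (intro prob_space.prob_space_distr) (auto simp: random_interlacement_def)

lemma interlacement_law_avoid:
  assumes "prob_space M" "random_interlacement M u I" "finite K"
  shows "emeasure (interlacement_law M I) {i. \<forall>x\<in>K. \<not> i x} = ennreal (exp (- u * cap K))"
proof -
  interpret prob_space M by fact
  have "emeasure (interlacement_law M I) {i. \<forall>x\<in>K. \<not> i x} =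
      emeasure M ((\<lambda>\<omega> x. x \<in> I \<omega>) -` {i. \<forall>x\<in>K. \<not> i x} \<inter> space M)"
    unfolding interlacement_law_def using assms avoid_in_sets_config[OF assms(3)]
    by (subst emeasure_distr) (auto simp: random_interlacement_def)
  also have "(\<lambda>\<omega> x. x \<in> I \<omega>) -` {i. \<forall>x\<in>K. \<not> i x} \<inter> space M = {\<omega> \<in> space M. I \<omega> \<inter> K = {}}"
    by auto
  finally show ?thesis using assms by (simp add: random_interlacement_def emeasure_eq_measure)
qed

lemma or_measurable:
  "(\<lambda>(i, j) x. i x \<or> j x) \<in> measurable (config_space \<Otimes>\<^sub>M config_space) (config_space :: ('d::finite site \<Rightarrow> bool) measure)"
proof (rule measurable_PiM_single')
  fix x :: "'d site"
  have "Measurable.pred (config_space \<Otimes>\<^sub>M config_space) (\<lambda>p :: ('d site \<Rightarrow> bool) \<times> ('d site \<Rightarrow> bool). fst p x \<or> snd p x)"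
    by measurable
  thus "(\<lambda>p. (case p of (i, j) \<Rightarrow> \<lambda>x. i x \<or> j x) x) \<in> config_space \<Otimes>\<^sub>M config_space \<rightarrow>\<^sub>M count_space UNIV"
    by (simp add: split_beta')
qed auto

lemma interlacement_law_add:
  fixes I J L :: "'w \<Rightarrow> 'd::finite site set"
  assumes M: "prob_space M" and I: "random_interlacement M u I" and J: "random_interlacement M v J"
    and L: "random_interlacement M (u + v) L"
  shows "interlacement_law M L =
     distr (interlacement_law M I \<Otimes>\<^sub>M interlacement_law M J) config_space (\<lambda>(i, j) x. i x \<or> j x)"
proof (rule config_measure_eqI)
  interpret NI: prob_space "interlacement_law M I" by (rule prob_space_interlacement_law[OF M I])
  interpret NJ: prob_space "interlacement_law M J" by (rule prob_space_interlacement_law[OF M J])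
  interpret NP: pair_prob_space "interlacement_law M I" "interlacement_law M J" ..
  show "prob_space (interlacement_law M L)" by (rule prob_space_interlacement_law[OF M L])
  show "sets (interlacement_law M L) = sets config_space" by (simp add: interlacement_law_def)
  have sets_eq: "sets (interlacement_law M I \<Otimes>\<^sub>M interlacement_law M J) = sets (config_space \<Otimes>\<^sub>M config_space)"
    by (intro sets_pair_measure_cong) (auto simp: interlacement_law_def)
  have meas: "(\<lambda>(i, j) x. i x \<or> j x) \<in> measurable (interlacement_law M I \<Otimes>\<^sub>M interlacement_law M J) (config_space :: ('d site \<Rightarrow> bool) measure)"
    using or_measurable by (simp only: measurable_cong_sets[OF sets_eq refl])
  fix K :: "'d site set" assume K: "finite K"
  let ?E = "{i. \<forall>x\<in>K. \<not> i x}"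
  have "emeasure (distr (interlacement_law M I \<Otimes>\<^sub>M interlacement_law M J) config_space (\<lambda>(i, j) x. i x \<or> j x)) ?E =
      emeasure (interlacement_law M I \<Otimes>\<^sub>M interlacement_law M J)
       ((\<lambda>(i, j) x. i x \<or> j x) -` ?E \<inter> space (interlacement_law M I \<Otimes>\<^sub>M interlacement_law M J))"
    by (rule emeasure_distr[OF meas avoid_in_sets_config[OF K]])
  also have "(\<lambda>(i, j) x. i x \<or> j x) -` ?E \<inter> space (interlacement_law M I \<Otimes>\<^sub>M interlacement_law M J) = ?E \<times> ?E"
    by (auto simp: space_pair_measure interlacement_law_def)
  also have "emeasure (interlacement_law M I \<Otimes>\<^sub>M interlacement_law M J) (?E \<times> ?E) =
      emeasure (interlacement_law M I) ?E * emeasure (interlacement_law M J) ?E"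
    using avoid_in_sets_config[OF K]
    by (intro NJ.emeasure_pair_measure_Times) (auto simp: interlacement_law_def)
  also have "\<dots> = ennreal (exp (- u * cap K) * exp (- v * cap K))"
    using interlacement_law_avoid[OF M I K] interlacement_law_avoid[OF M J K] by (simp add: ennreal_mult)
  also have "\<dots> = emeasure (interlacement_law M L) ?E"
    using interlacement_law_avoid[OF M L K] by (simp add: exp_add[symmetric] algebra_simps)
  finally show "emeasure (interlacement_law M L) ?E =
     emeasure (distr (interlacement_law M I \<Otimes>\<^sub>M interlacement_law M J) config_space (\<lambda>(i, j) x. i x \<or> j x)) ?E" ..
qed simp

lemma sets_noise_law: "sets (noise_law \<epsilon>) = sets config_space"
  by (intro sets_PiM_cong) auto

lemma prob_space_noise_law: "prob_space (noise_law \<epsilon>)"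
  by (intro prob_space_PiM measure_pmf.prob_space_axioms)

lemma distr_bernoulli_field:
  assumes M: "prob_space M" and \<theta>: "bernoulli_field M \<epsilon> \<theta>"
  shows "distr M config_space (\<lambda>\<omega> x. \<theta> x \<omega>) = noise_law \<epsilon>"
proof -
  interpret prob_space M by fact
  have ind: "indep_vars (\<lambda>_. count_space UNIV) \<theta> UNIV"
    and d: "\<And>x. distr M (count_space UNIV) (\<theta> x) = measure_pmf (bernoulli_pmf \<epsilon>)"
    using \<theta> by (auto simp: bernoulli_field_def)
  have rv: "random_variable (count_space UNIV) (\<theta> x)" for x
    using ind by (auto simp: indep_vars_def)
  have "distr M config_space (\<lambda>\<omega>. \<lambda>x\<in>UNIV. \<theta> x \<omega>) = PiM UNIV (\<lambda>x. distr M (count_space UNIV) (\<theta> x))"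
    using ind by (subst (asm) indep_vars_iff_distr_eq_PiM'[OF _ rv]) auto
  thus ?thesis by (simp add: d restrict_UNIV)
qed

text \<open>The map may differ from site to site as long as every marginal is pushed to
  \<open>q\<close>. This is the form that the coupling of two noise fields takes.\<close>

lemma distr_PiM_pmf:
  fixes p :: "'b pmf" and q :: "'c pmf" and g :: "'i \<Rightarrow> 'b \<Rightarrow> 'c"
  assumes g: "\<And>x. map_pmf (g x) p = q"
  shows "distr (PiM UNIV (\<lambda>_. measure_pmf p)) (PiM UNIV (\<lambda>_. measure_pmf q)) (\<lambda>\<omega> x. g x (\<omega> x)) =
     PiM UNIV (\<lambda>_. measure_pmf q)"
proof -
  interpret P: product_prob_space "\<lambda>_::'i. measure_pmf p" UNIV ..
  interpret Q: product_prob_space "\<lambda>_::'i. measure_pmf q" UNIV ..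
  let ?P = "PiM (UNIV::'i set) (\<lambda>_. measure_pmf p)" and ?Q = "PiM (UNIV::'i set) (\<lambda>_. measure_pmf q)"
  have meas: "(\<lambda>\<omega> x. g x (\<omega> x)) \<in> measurable ?P ?Q"
  proof (rule measurable_PiM_single')
    fix x :: 'i
    have "(\<lambda>\<omega>. \<omega> x) \<in> measurable ?P (measure_pmf p)" by measurable
    moreover have "g x \<in> measurable (measure_pmf p) (measure_pmf q)" by simp
    ultimately show "(\<lambda>\<omega>. g x (\<omega> x)) \<in> measurable ?P (measure_pmf q)"
      by (rule measurable_compose)
  qed (auto simp: space_PiM)
  show ?thesis
  proof (rule Q.PiM_eq)
    fix J :: "'i set" and F :: "'i \<Rightarrow> 'c set"
    assume J: "finite J" "J \<subseteq> UNIV"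
    have ev: "prod_emb UNIV (\<lambda>_. measure_pmf q) J (Pi\<^sub>E J F) \<in> sets ?Q"
      using J by (intro sets_PiM_I) auto
    have "emeasure (distr ?P ?Q (\<lambda>\<omega> x. g x (\<omega> x))) (prod_emb UNIV (\<lambda>_. measure_pmf q) J (Pi\<^sub>E J F)) =
       emeasure ?P ((\<lambda>\<omega> x. g x (\<omega> x)) -` prod_emb UNIV (\<lambda>_. measure_pmf q) J (Pi\<^sub>E J F) \<inter> space ?P)"
      by (rule emeasure_distr[OF meas ev])
    also have "(\<lambda>\<omega> x. g x (\<omega> x)) -` prod_emb UNIV (\<lambda>_. measure_pmf q) J (Pi\<^sub>E J F) \<inter> space ?P =
       prod_emb UNIV (\<lambda>_. measure_pmf p) J (\<Pi>\<^sub>E x\<in>J. g x -` F x)"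
      by (auto simp: prod_emb_def space_PiM PiE_iff)
    also have "emeasure ?P \<dots> = (\<Prod>x\<in>J. emeasure (measure_pmf p) (g x -` F x))"
      using J by (intro P.emeasure_PiM_emb) auto
    also have "\<dots> = (\<Prod>x\<in>J. emeasure (measure_pmf q) (F x))"
    proof (intro prod.cong refl)
      fix x
      have "emeasure (measure_pmf q) (F x) = emeasure (measure_pmf (map_pmf (g x) p)) (F x)" by (simp add: g)
      also have "\<dots> = emeasure (measure_pmf p) (g x -` F x)" by (simp add: emeasure_map_pmf)
      finally show "emeasure (measure_pmf p) (g x -` F x) = emeasure (measure_pmf q) (F x)" ..
    qed
    finally show "emeasure (distr ?P ?Q (\<lambda>\<omega> x. g x (\<omega> x))) (prod_emb UNIV (\<lambda>_. measure_pmf q) J (Pi\<^sub>E J F)) =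
      (\<Prod>x\<in>J. emeasure (measure_pmf q) (F x))" .
  qed simp
qed

lemma percolates_mono: "percolates V \<Longrightarrow> V \<subseteq> V' \<Longrightarrow> percolates V'"
proof -
  assume V: "percolates V" and le: "V \<subseteq> V'"
  have "(\<lambda>a b. a \<in> V \<and> b \<in> V \<and> adjacent a b)\<^sup>*\<^sup>* \<le> (\<lambda>a b. a \<in> V' \<and> b \<in> V' \<and> adjacent a b)\<^sup>*\<^sup>*"
    using le by (intro rtranclp_mono) blast
  hence "component V 0 \<subseteq> component V' 0" using le by (auto simp: component_def)
  thus ?thesis using V finite_subset unfolding percolates_def by blast
qed

text \<open>Given the interlacement \<open>i\<close> and the noise \<open>t\<close>, a site is open
  after flipping exactly when \<open>i x = t x\<close>.\<close>

definition quenched_perc :: "real \<Rightarrow> ('d::finite site \<Rightarrow> bool) \<Rightarrow> ennreal" where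
  "quenched_perc \<epsilon> i = emeasure (noise_law \<epsilon>) {t. percolates {x. i x = t x}}"

lemma percolates_eq_measurable:
  "{(i, t :: 'd::finite site \<Rightarrow> bool). percolates {x. i x = t x}} \<in> sets (config_space \<Otimes>\<^sub>M config_space)"
proof -
  have "(\<lambda>p x. fst p x = snd p x) \<in> measurable (config_space \<Otimes>\<^sub>M config_space) (config_space :: ('d site \<Rightarrow> bool) measure)"
  proof (rule measurable_PiM_single')
    fix x :: "'d site"
    show "(\<lambda>p. fst p x = snd p x) \<in> (config_space :: ('d site \<Rightarrow> bool) measure) \<Otimes>\<^sub>M config_space \<rightarrow>\<^sub>M count_space UNIV"
      by measurable
  qed auto
  from measurable_compose[OF this measurable_percolates]
  have "Measurable.pred (config_space \<Otimes>\<^sub>M config_space) (\<lambda>p :: ('d site \<Rightarrow> bool) \<times> ('d site \<Rightarrow> bool). percolates {x. fst p x = snd p x})" .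
  hence "{p \<in> space (config_space \<Otimes>\<^sub>M config_space). percolates {x :: 'd site. fst p x = snd p x}} \<in> sets (config_space \<Otimes>\<^sub>M config_space)"
    by measurable
  thus ?thesis by (simp add: space_pair_measure split_beta')
qed

text \<open>
  Coupling of the two noise fields: at sites of \<open>i'\<close> outside \<open>i\<close> the noise of \<open>i'\<close> may only be
  present where that of \<open>i\<close> is absent. It is kept there with probability \<open>\<epsilon> / (1 - \<epsilon>)\<close>, which is at
  most 1 because \<open>\<epsilon> \<le> 1/2\<close>.
\<close>

lemma quenched_perc_antimono:
  fixes i i' :: "'d::finite site \<Rightarrow> bool"
  assumes \<epsilon>: "0 < \<epsilon>" "\<epsilon> < 1/2" and le: "\<And>x. i x \<Longrightarrow> i' x"
  shows "quenched_perc \<epsilon> i' \<le> quenched_perc \<epsilon> i"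
proof -
  define \<eta> where "\<eta> = \<epsilon> / (1 - \<epsilon>)"
  have \<eta>: "0 \<le> \<eta>" "\<eta> \<le> 1" using \<epsilon> by (auto simp: \<eta>_def field_simps)
  define p where "p = pair_pmf (bernoulli_pmf \<epsilon>) (bernoulli_pmf \<eta>)"
  \<comment> \<open>At an added obstacle the site is open for \<open>i'\<close> only if the second
    branch is true; then \<open>fst q\<close> is false and the site is open for \<open>i\<close> as
    well.\<close>
  define g where "g x = (\<lambda>q. if i x \<or> \<not> i' x then fst q else \<not> fst q \<and> snd q)" for x
  have map_fst: "map_pmf fst p = bernoulli_pmf \<epsilon>" by (simp add: p_def map_fst_pair_pmf)
  have "map_pmf (\<lambda>q. \<not> fst q \<and> snd q) p = bernoulli_pmf \<epsilon>"
  proof -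
    have eq: "(\<lambda>q. \<not> fst q \<and> snd q) -` {True} = {(False, True)}"
    proof (rule set_eqI)
      fix q :: "bool \<times> bool"
      show "q \<in> (\<lambda>q. \<not> fst q \<and> snd q) -` {True} \<longleftrightarrow> q \<in> {(False, True)}"
        by (cases q) simp
    qed
    have "pmf (map_pmf (\<lambda>q. \<not> fst q \<and> snd q) p) True = measure (measure_pmf p) ((\<lambda>q. \<not> fst q \<and> snd q) -` {True})"
      by (rule pmf_map)
    also have "\<dots> = pmf p (False, True)" by (simp only: eq measure_pmf_single)
    also have "\<dots> = (1 - \<epsilon>) * \<eta>" unfolding p_def pmf_pair using \<epsilon> \<eta> by simp
    also have "\<dots> = \<epsilon>" using \<epsilon> by (simp add: \<eta>_def)
    finally have T: "pmf (map_pmf (\<lambda>q. \<not> fst q \<and> snd q) p) True = \<epsilon>" .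
    have F: "pmf (map_pmf (\<lambda>q. \<not> fst q \<and> snd q) p) False = 1 - \<epsilon>"
      unfolding pmf_False_conv_True T ..
    show ?thesis
    proof (rule pmf_eqI)
      fix b show "pmf (map_pmf (\<lambda>q. \<not> fst q \<and> snd q) p) b = pmf (bernoulli_pmf \<epsilon>) b"
        using T F \<epsilon> by (cases b) auto
    qed
  qed
  hence map_g: "map_pmf (g x) p = bernoulli_pmf \<epsilon>" for x
    using map_fst by (cases "i x \<or> \<not> i' x") (auto simp: g_def)
  let ?P = "PiM (UNIV :: 'd site set) (\<lambda>_. measure_pmf p)"
  have ev: "{t. percolates {x. j x = t x}} \<in> sets (noise_law \<epsilon>)" for j :: "'d site \<Rightarrow> bool"
  proof -
    have "Pair j -` {(i, t). percolates {x. i x = t x}} \<in> sets config_space"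
      by (rule sets_Pair1[OF percolates_eq_measurable])
    thus ?thesis by (simp add: sets_noise_law)
  qed
  have law: "emeasure (noise_law \<epsilon>) {t. percolates {x. j x = t x}} =
      emeasure ?P {\<omega>. percolates {x. j x = h x (\<omega> x)}}"
    and meas: "{\<omega>. percolates {x. j x = h x (\<omega> x)}} \<in> sets ?P"
    if h: "\<And>x. map_pmf (h x) p = bernoulli_pmf \<epsilon>" for j :: "'d site \<Rightarrow> bool" and h
  proof -
    have m: "(\<lambda>\<omega> x. h x (\<omega> x)) \<in> measurable ?P (noise_law \<epsilon>)"
    proof (rule measurable_PiM_single')
      fix x :: "'d site"
      have "(\<lambda>\<omega>. \<omega> x) \<in> measurable ?P (measure_pmf p)" by measurable
      moreover have "h x \<in> measurable (measure_pmf p) (measure_pmf (bernoulli_pmf \<epsilon>))" by simp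
      ultimately show "(\<lambda>\<omega>. h x (\<omega> x)) \<in> measurable ?P (measure_pmf (bernoulli_pmf \<epsilon>))"
        by (rule measurable_compose)
    qed (auto simp: space_PiM)
    have eq: "(\<lambda>\<omega> x. h x (\<omega> x)) -` {t. percolates {x. j x = t x}} \<inter> space ?P = {\<omega>. percolates {x. j x = h x (\<omega> x)}}"
      by (auto simp: space_PiM)
    show "{\<omega>. percolates {x. j x = h x (\<omega> x)}} \<in> sets ?P"
      using measurable_sets[OF m ev[of j]] unfolding eq .
    show "emeasure (noise_law \<epsilon>) {t. percolates {x. j x = t x}} =
      emeasure ?P {\<omega>. percolates {x. j x = h x (\<omega> x)}}"
      using emeasure_distr[OF m ev, of j] unfolding distr_PiM_pmf[OF h] eq .
  qed
  have "quenched_perc \<epsilon> i' = emeasure ?P {\<omega>. percolates {x. i' x = g x (\<omega> x)}}"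
    unfolding quenched_perc_def by (rule law[OF map_g])
  also have "\<dots> \<le> emeasure ?P {\<omega>. percolates {x. i x = fst (\<omega> x)}}"
  proof (rule emeasure_mono)
    show "{\<omega>. percolates {x. i x = fst (\<omega> x)}} \<in> sets ?P"
      by (rule meas[of "\<lambda>_. fst", OF map_fst])
    show "{\<omega>. percolates {x. i' x = g x (\<omega> x)}} \<subseteq> {\<omega>. percolates {x. i x = fst (\<omega> x)}}"
    proof
      fix \<omega> assume "\<omega> \<in> {\<omega>. percolates {x. i' x = g x (\<omega> x)}}"
      moreover have "{x. i' x = g x (\<omega> x)} \<subseteq> {x. i x = fst (\<omega> x)}"
        using le by (auto simp: g_def split_beta split: if_splits)
      ultimately show "\<omega> \<in> {\<omega>. percolates {x. i x = fst (\<omega> x)}}" using percolates_mono by blast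
    qed
  qed
  also have "\<dots> = quenched_perc \<epsilon> i"
    unfolding quenched_perc_def by (rule law[of "\<lambda>_. fst", OF map_fst, symmetric])
  finally show ?thesis .
qed

lemma quenched_perc_measurable:
  "(quenched_perc \<epsilon> :: ('d::finite site \<Rightarrow> bool) \<Rightarrow> ennreal) \<in> borel_measurable config_space"
proof -
  interpret prob_space "noise_law \<epsilon> :: ('d site \<Rightarrow> bool) measure" by (rule prob_space_noise_law)
  have "sets (config_space \<Otimes>\<^sub>M noise_law \<epsilon>) = sets (config_space \<Otimes>\<^sub>M (config_space :: ('d site \<Rightarrow> bool) measure))"
    by (intro sets_pair_measure_cong sets_noise_law refl)
  note eq = this
  have "{(i, t :: 'd site \<Rightarrow> bool). percolates {x. i x = t x}} \<in> sets (config_space \<Otimes>\<^sub>M noise_law \<epsilon>)"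
    using percolates_eq_measurable by (simp only: eq)
  hence "(\<lambda>i. emeasure (noise_law \<epsilon>) (Pair i -` {(i, t :: 'd site \<Rightarrow> bool). percolates {x. i x = t x}}))
     \<in> borel_measurable config_space"
    by (rule measurable_emeasure_Pair)
  thus ?thesis by (simp add: quenched_perc_def[abs_def] vimage_def)
qed

text \<open>Fubini for the independent pair. The right-hand side involves the interlacement only
  through its law, which leaves the choice of coupling free.\<close>

lemma perc_prob_eq:
  fixes I :: "'w \<Rightarrow> 'd::finite site set"
  assumes M: "prob_space M" and I: "random_interlacement M u I" and \<theta>: "bernoulli_field M \<epsilon> \<theta>"
    and ind: "noise_independent M I \<theta>"
  shows "ennreal (perc_prob M I \<theta>) = (\<integral>\<^sup>+i. quenched_perc \<epsilon> i \<partial>interlacement_law M I)"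
proof -
  interpret prob_space M by fact
  interpret N: prob_space "noise_law \<epsilon> :: ('d site \<Rightarrow> bool) measure" by (rule prob_space_noise_law)
  let ?G = "{(i, t :: 'd site \<Rightarrow> bool). percolates {x. i x = t x}}"
  have iv: "indep_var config_space (\<lambda>\<omega> x. x \<in> I \<omega>) config_space (\<lambda>\<omega> x. \<theta> x \<omega>)"
    using ind by (simp add: noise_independent_def)
  have rv: "(\<lambda>\<omega>. (\<lambda>x. x \<in> I \<omega>, \<lambda>x. \<theta> x \<omega>)) \<in> measurable M (config_space \<Otimes>\<^sub>M config_space)"
    by (intro measurable_Pair indep_var_rv1[OF iv] indep_var_rv2[OF iv])
  have joint: "interlacement_law M I \<Otimes>\<^sub>M noise_law \<epsilon> =
      distr M (config_space \<Otimes>\<^sub>M config_space) (\<lambda>\<omega>. (\<lambda>x. x \<in> I \<omega>, \<lambda>x. \<theta> x \<omega>))"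
    using iv unfolding indep_var_distribution_eq distr_bernoulli_field[OF M \<theta>] interlacement_law_def by blast
  have "ennreal (perc_prob M I \<theta>) = emeasure M {\<omega> \<in> space M. percolates (disordered_vacant I \<theta> \<omega>)}"
    by (simp add: perc_prob_def emeasure_eq_measure)
  also have "{\<omega> \<in> space M. percolates (disordered_vacant I \<theta> \<omega>)} = (\<lambda>\<omega>. (\<lambda>x. x \<in> I \<omega>, \<lambda>x. \<theta> x \<omega>)) -` ?G \<inter> space M"
  proof -
    have "disordered_vacant I \<theta> \<omega> = {x. (x \<in> I \<omega>) = \<theta> x \<omega>}" for \<omega>
      by (auto simp: disordered_vacant_def disordered_interlacement_def)
    thus ?thesis by auto
  qed
  also have "emeasure M \<dots> = emeasure (interlacement_law M I \<Otimes>\<^sub>M noise_law \<epsilon>) ?G"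
    unfolding joint by (rule emeasure_distr[OF rv percolates_eq_measurable, symmetric])
  also have "\<dots> = (\<integral>\<^sup>+i. emeasure (noise_law \<epsilon>) (Pair i -` ?G) \<partial>interlacement_law M I)"
  proof (rule N.emeasure_pair_measure_alt)
    show "?G \<in> sets (interlacement_law M I \<Otimes>\<^sub>M noise_law \<epsilon>)"
      unfolding joint using percolates_eq_measurable by (simp only: sets_distr)
  qed
  finally show ?thesis by (simp add: quenched_perc_def vimage_def)
qed

text \<open>\<open>L\<close> and \<open>I\<close> come with no inclusion between them on
  \<open>M\<close>. In the integral, \<open>L\<close> may be replaced by the union of independent
  copies of \<open>I\<close> and \<open>J\<close>, which contains the copy of \<open>I\<close>, and
  the comparison is made there.\<close>

lemma perc_prob_antimono:
  fixes I J L :: "'w \<Rightarrow> 'd::finite site set"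
  assumes M: "prob_space M" and I: "random_interlacement M u I" and J: "random_interlacement M v J"
    and L: "random_interlacement M (u + v) L" and \<theta>: "bernoulli_field M \<epsilon> \<theta>"
    and ind: "noise_independent M I \<theta>" "noise_independent M L \<theta>" and \<epsilon>: "0 < \<epsilon>" "\<epsilon> < 1/2"
  shows "perc_prob M L \<theta> \<le> perc_prob M I \<theta>"
proof -
  interpret NI: prob_space "interlacement_law M I" by (rule prob_space_interlacement_law[OF M I])
  interpret NJ: prob_space "interlacement_law M J" by (rule prob_space_interlacement_law[OF M J])
  interpret NP: pair_prob_space "interlacement_law M I" "interlacement_law M J" ..
  have sets_eq: "sets (interlacement_law M I \<Otimes>\<^sub>M interlacement_law M J) = sets (config_space \<Otimes>\<^sub>M config_space)"
    by (intro sets_pair_measure_cong) (auto simp: interlacement_law_def)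
  have meas: "(\<lambda>(i, j) x. i x \<or> j x) \<in> measurable (interlacement_law M I \<Otimes>\<^sub>M interlacement_law M J) (config_space :: ('d site \<Rightarrow> bool) measure)"
    using or_measurable by (simp only: measurable_cong_sets[OF sets_eq refl])
  have qm: "quenched_perc \<epsilon> \<in> borel_measurable (interlacement_law M I)"
    using quenched_perc_measurable by (simp add: interlacement_law_def)
  have "ennreal (perc_prob M L \<theta>) = (\<integral>\<^sup>+i. quenched_perc \<epsilon> i \<partial>interlacement_law M L)"
    by (rule perc_prob_eq[OF M L \<theta> ind(2)])
  also have "\<dots> = (\<integral>\<^sup>+p. quenched_perc \<epsilon> (case p of (i, j) \<Rightarrow> \<lambda>x. i x \<or> j x) \<partial>(interlacement_law M I \<Otimes>\<^sub>M interlacement_law M J))"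
    unfolding interlacement_law_add[OF M I J L]
    by (rule nn_integral_distr[OF meas]) (simp add: quenched_perc_measurable)
  also have "\<dots> \<le> (\<integral>\<^sup>+p. quenched_perc \<epsilon> (fst p) \<partial>(interlacement_law M I \<Otimes>\<^sub>M interlacement_law M J))"
    by (intro nn_integral_mono) (auto intro!: quenched_perc_antimono \<epsilon> split: prod.splits)
  also have "\<dots> = (\<integral>\<^sup>+i. \<integral>\<^sup>+j. quenched_perc \<epsilon> i \<partial>interlacement_law M J \<partial>interlacement_law M I)"
    using measurable_compose[OF measurable_fst qm] by (subst NJ.nn_integral_fst[symmetric]) auto
  also have "\<dots> = ennreal (perc_prob M I \<theta>)"
    unfolding perc_prob_eq[OF M I \<theta> ind(1)] by (simp add: NJ.emeasure_space_1)
  finally show ?thesis by (simp add: perc_prob_def)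
qed

subsection \<open>The two phases\<close>

lemma pot_le_linf:
  fixes x :: "'d::finite site"
  assumes "0 < linf x"
  shows "pot x \<le> 1 / real_of_int (linf x)"
proof -
  obtain i where i: "linf x = \<bar>x $ i\<bar>" using linf_attained by blast
  have "(real_of_int (linf x))\<^sup>2 = (of_int (x $ i))\<^sup>2" by (simp add: i)
  also have "\<dots> \<le> normsq x" unfolding normsq_def by (rule member_le_sum) auto
  finally have "(real_of_int (linf x))\<^sup>2 \<le> normsq x + 5" by simp
  hence "real_of_int (linf x) \<le> sqrt (normsq x + 5)" by (rule real_le_rsqrt)
  thus ?thesis unfolding pot_def using assms by (intro frac_le) auto
qed

locale interlacement_model = prob_space M
  for M :: "'w measure" +
  fixes I :: "real \<Rightarrow> 'w \<Rightarrow> 'd::finite site set"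
    and \<theta> :: "real \<Rightarrow> 'd site \<Rightarrow> 'w \<Rightarrow> bool"
  assumes dim: "3 \<le> CARD('d)"
    and interlacement: "\<And>u. 0 \<le> u \<Longrightarrow> random_interlacement M u (I u)"
    and bernoulli: "\<And>\<epsilon>. 0 < \<epsilon> \<Longrightarrow> \<epsilon> < 1 \<Longrightarrow> bernoulli_field M \<epsilon> (\<theta> \<epsilon>)"
    and independent: "\<And>u \<epsilon>. 0 \<le> u \<Longrightarrow> 0 < \<epsilon> \<Longrightarrow> \<epsilon> < 1 \<Longrightarrow> noise_independent M (I u) (\<theta> \<epsilon>)"
begin

lemma vacant_eq: "disordered_vacant (I u) (\<theta> \<epsilon>) \<omega> = {x. (x \<in> I u \<omega>) = \<theta> \<epsilon> x \<omega>}"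
  by (auto simp: disordered_vacant_def disordered_interlacement_def)

lemma fields_pred:
  assumes "0 \<le> u" "0 < \<epsilon>" "\<epsilon> < 1"
  shows "Measurable.pred M (\<lambda>\<omega>. x \<in> I u \<omega>)" "Measurable.pred M (\<theta> \<epsilon> x)"
  using random_interlacement_measurable[OF interlacement] bernoulli_field_pred[OF prob_space_axioms bernoulli] assms
  by auto

lemma percolation_event:
  assumes "0 \<le> u" "0 < \<epsilon>" "\<epsilon> < 1"
  shows "{\<omega> \<in> space M. percolates (disordered_vacant (I u) (\<theta> \<epsilon>) \<omega>)} \<in> events"
proof -
  have "indep_var config_space (\<lambda>\<omega> x. x \<in> I u \<omega>) config_space (\<lambda>\<omega> x. \<theta> \<epsilon> x \<omega>)"
    using independent[OF assms] by (simp add: noise_independent_def)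
  from percolation_event_measurable[OF indep_var_rv1[OF this] indep_var_rv2[OF this]] show ?thesis .
qed

lemma subcritical:
  "\<exists>\<epsilon>\<^sub>1>0. \<forall>\<epsilon>. 0 < \<epsilon> \<longrightarrow> \<epsilon> < 1 \<longrightarrow> \<epsilon> \<le> \<epsilon>\<^sub>1 \<longrightarrow> (\<exists>u\<ge>0. perc_prob M (I u) (\<theta> \<epsilon>) = 0)"
proof -
  \<comment> \<open>Half of the gap \<open>1 - sqrt 5 / sqrt 6\<close>. The other half pays for the
    interaction of the leaves, which the choice of \<open>s\<close> below keeps under
    \<open>\<kappa>\<close>.\<close>
  define \<kappa> :: real where "\<kappa> = (1 - sqrt 5 / sqrt 6) / 2"
  have \<kappa>: "0 < \<kappa>" by (simp add: \<kappa>_def)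
  obtain s :: nat where s: "2 * sqrt 5 / \<kappa> < real s" using reals_Archimedean2 by blast
  define s' where "s' = max s 2"
  have s': "2 * sqrt 5 / \<kappa> \<le> real s'" "2 \<le> s'" using s by (auto simp: s'_def)
  have s_delta: "sqrt 5 * (2 / s') \<le> \<kappa>" using s' \<kappa> by (simp add: field_simps)
  define c where "c = real (tree_entropy TYPE('d) s')"
  have c: "1 \<le> c" by (simp add: c_def tree_entropy_def)
  have cap: "\<kappa> * card T \<le> cap T" if A: "A \<in> trees s' n z" and T: "T \<subseteq> A" for A T n and z :: "'d site"
  proof -
    have fin: "finite A" using trees_finite_card[OF _ A] s' by auto
    have "(1 - sqrt 5 / sqrt 6 - \<kappa>) * card T \<le> cap T"
    proof (rule cap_ge[OF dim])
      show "finite T" using fin T finite_subset by blast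
      fix x assume x: "x \<in> T"
      have "(\<Sum>y\<in>T - {x}. sqrt 5 * pot (x - y)) \<le> (\<Sum>y\<in>A - {x}. sqrt 5 * pot (x - y))"
        using fin T by (intro sum_mono2) (auto simp: less_imp_le[OF pot_pos])
      also have "\<dots> \<le> (\<Sum>y\<in>A - {x}. sqrt 5 * (1 / real_of_int (linf (x - y))))"
      proof (intro sum_mono mult_left_mono pot_le_linf)
        fix y assume "y \<in> A - {x}"
        hence "int s' \<le> linf (x - y)" using trees_spread[OF _ A, of x y] x T s' by auto
        thus "0 < linf (x - y)" using s' by linarith
      qed auto
      also have "\<dots> = sqrt 5 * (\<Sum>y\<in>A - {x}. 1 / real_of_int (linf (x - y)))" by (simp only: sum_distrib_left)
      also have "\<dots> \<le> sqrt 5 * (2 / s')"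
      proof (intro mult_left_mono)
        have "(\<Sum>y\<in>A - {x}. 1 / real_of_int (linf (x - y))) \<le> 2 / s' * (1 - (1/2) ^ n)"
          using trees_energy[OF _ A, of x] x T s' by auto
        also have "\<dots> \<le> 2 / s' * 1" by (intro mult_left_mono) auto
        finally show "(\<Sum>y\<in>A - {x}. 1 / real_of_int (linf (x - y))) \<le> 2 / s'" by simp
      qed auto
      finally show "(\<Sum>y\<in>T - {x}. sqrt 5 * pot (x - y)) \<le> \<kappa>" using s_delta by linarith
    qed
    moreover have "h - h / 2 = h / 2" for h :: real by simp
    hence "1 - sqrt 5 / sqrt 6 - \<kappa> = \<kappa>" unfolding \<kappa>_def .
    ultimately show ?thesis by (simp only:)
  qed
  \<comment> \<open>Chosen so that a leaf is vacant at cost \<open>1 / (4 * c)\<close>. The noise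
    may add as much again, and the entropy \<open>c\<close> then leaves a factor 1/2 per
    leaf.\<close>
  define u where "u = ln (4 * c) / \<kappa>"
  have u: "0 \<le> u" unfolding u_def using c \<kappa> by (intro divide_nonneg_pos ln_ge_zero) auto
  have "- u * \<kappa> = - ln (4 * c)" using \<kappa> by (simp add: u_def)
  hence eu: "exp (- u * \<kappa>) = 1 / (4 * c)" using c by (simp add: exp_minus inverse_eq_divide)
  show ?thesis
  proof (rule exI[of _ "1 / (4 * c)"], intro conjI allI impI)
    show "0 < 1 / (4 * c)" using c by simp
    fix \<epsilon> :: real assume \<epsilon>: "0 < \<epsilon>" "\<epsilon> < 1" "\<epsilon> \<le> 1 / (4 * c)"
    note [measurable] = fields_pred[OF u \<epsilon>(1,2)]
    \<comment> \<open>A site open after flipping is off the interlacement or noisy. The weaker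
      disjunction is used, since it fits \<open>interlacement_or_noise_le\<close> with
      singletons.\<close>
    let ?E = "\<lambda>A. {\<omega> \<in> space M. \<forall>z\<in>A. (\<not> z \<in> I u \<omega>) \<or> (\<exists>y\<in>{z}. \<theta> \<epsilon> y \<omega>)}"
    have E: "?E A \<in> events" if "finite A" for A using that by measurable
    have bound: "perc_prob M (I u) (\<theta> \<epsilon>) \<le> (1/2) ^ n" for n
    proof -
      have fin_A: "finite A" if "A \<in> trees s' n 0" for A :: "'d site set" using trees_finite_card[OF _ that] s' by auto
      have PA: "prob (?E A) \<le> (1 / (4 * c) + \<epsilon>) ^ (2 ^ n)" if A: "A \<in> trees s' n 0" for A
      proof -
        have "prob (?E A) \<le> (exp (- u * \<kappa>) + real 1 * \<epsilon>) ^ card A"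
        proof (rule interlacement_or_noise_le[OF prob_space_axioms independent[OF u \<epsilon>(1,2)] bernoulli[OF \<epsilon>(1,2)],
              where K = "\<lambda>z. {z}" and Q = "\<lambda>z i. \<not> i z"])
          show "disjoint_family_on (\<lambda>z. {z}) A" by (auto simp: disjoint_family_on_def)
          show "Measurable.pred config_space (\<lambda>i. \<not> i z)" for z :: "'d site" by measurable
          fix T assume T: "T \<subseteq> A"
          have "{\<omega> \<in> space M. \<forall>z\<in>T. z \<notin> I u \<omega>} = {\<omega> \<in> space M. I u \<omega> \<inter> T = {}}" by auto
          hence "prob {\<omega> \<in> space M. \<forall>z\<in>T. z \<notin> I u \<omega>} = exp (- u * cap T)"
            using random_interlacement_avoid[OF interlacement[OF u], of T] finite_subset[OF T fin_A[OF A]] by simp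
          also have "\<dots> \<le> exp (- u * (\<kappa> * card T))"
            using mult_left_mono[OF cap[OF A T] u] by simp
          also have "\<dots> = exp (- u * \<kappa>) ^ card T" by (simp add: exp_of_nat_mult[symmetric] mult_ac)
          finally show "prob {\<omega> \<in> space M. \<forall>z\<in>T. z \<notin> I u \<omega>} \<le> exp (- u * \<kappa>) ^ card T" .
        qed (use \<epsilon> fin_A[OF A] in auto)
        also have "card A = 2 ^ n" using trees_finite_card[OF _ A] s' by auto
        finally show ?thesis by (simp only: eu of_nat_1 mult_1_left)
      qed
      have "perc_prob M (I u) (\<theta> \<epsilon>) \<le> prob (\<Union>A\<in>trees s' n 0. ?E A)"
        unfolding perc_prob_def
      proof (rule finite_measure_mono)
        show "{\<omega> \<in> space M. percolates (disordered_vacant (I u) (\<theta> \<epsilon>) \<omega>)} \<subseteq> (\<Union>A\<in>trees s' n 0. ?E A)"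
        proof
          fix \<omega> assume \<omega>: "\<omega> \<in> {\<omega> \<in> space M. percolates (disordered_vacant (I u) (\<theta> \<epsilon>) \<omega>)}"
          then obtain A where "A \<in> trees s' n 0" "A \<subseteq> disordered_vacant (I u) (\<theta> \<epsilon>) \<omega>"
            using percolates_imp_tree s'(2) by blast
          thus "\<omega> \<in> (\<Union>A\<in>trees s' n 0. ?E A)" using \<omega> by (intro UN_I[of A]) (auto simp: vacant_eq)
        qed
        show "(\<Union>A\<in>trees s' n 0. ?E A) \<in> events"
          using card_trees[of s' n "0 :: 'd site"] E fin_A by (intro sets.finite_UN) auto
      qed
      also have "\<dots> \<le> (\<Sum>A\<in>trees s' n 0. prob (?E A))"
        using card_trees[of s' n "0 :: 'd site"] E fin_A by (intro finite_measure_subadditive_finite) auto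
      also have "\<dots> \<le> (\<Sum>A\<in>trees s' n (0 :: 'd site). (1 / (4 * c) + \<epsilon>) ^ (2 ^ n))"
        by (intro sum_mono PA)
      also have "\<dots> = card (trees s' n (0 :: 'd site)) * (1 / (4 * c) + \<epsilon>) ^ (2 ^ n)" by simp
      also have "\<dots> \<le> c ^ (2 ^ n) * (1 / (2 * c)) ^ (2 ^ n)"
      proof (intro mult_mono power_mono)
        show "real (card (trees s' n (0 :: 'd site))) \<le> c ^ (2 ^ n)"
          using card_trees_le[of s' n "0 :: 'd site"] unfolding c_def by (metis of_nat_le_iff of_nat_power)
        show "1 / (4 * c) + \<epsilon> \<le> 1 / (2 * c)" using \<epsilon>(3) by simp
      qed (use c \<epsilon> in auto)
      also have "\<dots> = (1/2) ^ (2 ^ n)" using c by (simp add: power_mult_distrib[symmetric])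
      also have "\<dots> \<le> (1/2) ^ n" by (intro power_decreasing) (auto intro: less_imp_le)
      finally show ?thesis .
    qed
    have "perc_prob M (I u) (\<theta> \<epsilon>) \<le> 0"
      by (rule LIMSEQ_le_const[OF LIMSEQ_power_zero[of "1/2 :: real"]]) (use bound in auto)
    hence "perc_prob M (I u) (\<theta> \<epsilon>) = 0"
      using measure_nonneg unfolding perc_prob_def by (rule antisym)
    thus "\<exists>u\<ge>0. perc_prob M (I u) (\<theta> \<epsilon>) = 0" using u by blast
  qed
qed

end

subsection \<open>A coarse planar lattice\<close>

lemma sum_if_two:
  assumes "i1 \<noteq> (i2 :: 'd::finite)"
  shows "(\<Sum>i\<in>UNIV. if i = i1 then a else if i = i2 then b else 0) = (a + b :: 'b::comm_monoid_add)"
proof -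
  have "(\<Sum>i\<in>UNIV. if i = i1 then a else if i = i2 then b else 0) = (\<Sum>i\<in>UNIV. (if i = i1 then a else 0) + (if i = i2 then b else 0))"
    using assms by (intro sum.cong) auto
  thus ?thesis by (simp add: sum.distrib)
qed

lemma harmonic_unbounded: "\<exists>R::nat. B \<le> (\<Sum>t\<le>R. 1 / (real t + 3))"
proof (rule ccontr)
  assume "\<not> ?thesis"
  hence le: "(\<Sum>t\<le>R. 1 / (real t + 3)) \<le> B" for R by (meson linear)
  have "summable (\<lambda>t. 1 / (real t + 3))"
  proof (rule summableI_nonneg_bounded)
    show "(\<Sum>t<n. 1 / (real t + 3)) \<le> B" for n
    proof -
      have "(\<Sum>t<n. 1 / (real t + 3)) \<le> (\<Sum>t\<le>n. 1 / (real t + 3))" by (intro sum_mono2) auto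
      thus ?thesis using le[of n] by linarith
    qed
  qed auto
  hence "summable (\<lambda>t. inverse (real (t + 3)))" by (simp add: divide_inverse)
  hence "summable (\<lambda>t. inverse (real t))" by (rule summable_iff_shift[THEN iffD1])
  thus False using not_summable_harmonic[where 'a = real] by simp
qed

locale coarse_plane =
  fixes i1 i2 :: "'d::finite" and R :: nat
  assumes i12: "i1 \<noteq> i2" and R: "1 \<le> R"
begin

definition emb :: "int ^ 2 \<Rightarrow> 'd site" where
  "emb p = (\<chi> i. if i = i1 then p $ 1 else if i = i2 then p $ 2 else 0)"

abbreviation N :: int where "N \<equiv> 2 * int R"

text \<open>Two segments from \<open>N *s z\<close> to the positions of the right and upper coarse
  neighbours, so that every coarse edge is realised by the cross of one of its ends.
  \<open>N\<close> is even so that each point of a segment has at least \<open>R\<close> further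
  points on one side.\<close>

definition cross :: "int ^ 2 \<Rightarrow> 'd site set" where
  "cross z = (\<lambda>j. emb (N *s z + pt j 0)) ` {0..N} \<union> (\<lambda>j. emb (N *s z + pt 0 j)) ` {0..N}"

text \<open>A lower bound, of order \<open>log R\<close>, for the potential that a segment exerts on
  each of its own points: at distance \<open>t\<close> one has
  \<open>sqrt (t\<^sup>2 + 5) \<le> t + 3\<close>.\<close>

definition mass :: real where
  "mass = (\<Sum>t\<le>R. 1 / (real t + 3))"

definition cross_pot :: "int ^ 2 \<Rightarrow> 'd site \<Rightarrow> real" where
  "cross_pot z x = (\<Sum>y\<in>cross z. 1 / mass * pot (x - y))"

lemma emb_diff: "emb p - emb q = emb (p - q)"
  by (auto simp: emb_def vec_eq_iff)

lemma emb_0 [simp]: "emb 0 = 0"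
  by (auto simp: emb_def vec_eq_iff)

lemma emb_nth: "emb p $ i1 = p $ 1" "emb p $ i2 = p $ 2"
  using i12 by (auto simp: emb_def)

lemma emb_inj: "emb p = emb q \<longleftrightarrow> p = q"
proof
  assume "emb p = emb q"
  hence "p $ 1 = q $ 1" "p $ 2 = q $ 2" using emb_nth[of p] emb_nth[of q] by simp_all
  thus "p = q" unfolding vec_eq_iff forall_2 by blast
qed simp

lemma emb_adjacent: "adjacent p q \<Longrightarrow> adjacent (emb p) (emb q)"
proof -
  assume a: "adjacent p q"
  have "(\<Sum>i\<in>UNIV. \<bar>emb p $ i - emb q $ i\<bar>) = (\<Sum>i\<in>UNIV. if i = i1 then \<bar>p $ 1 - q $ 1\<bar> else if i = i2 then \<bar>p $ 2 - q $ 2\<bar> else 0)"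
    using i12 by (intro sum.cong) (auto simp: emb_def)
  thus ?thesis using a i12 by (simp add: adjacent_def sum_if_two sum_2)
qed

lemma linf_emb: "linf (emb p) = linf p"
proof (rule antisym)
  show "linf (emb p) \<le> linf p"
    unfolding linf_le_iff using component_le_linf[of p] by (auto simp: emb_def)
  show "linf p \<le> linf (emb p)"
    unfolding linf_le_iff forall_2 using component_le_linf[of "emb p" i1] component_le_linf[of "emb p" i2]
    by (simp add: emb_nth)
qed

lemma normsq_emb: "normsq (emb p) = (of_int (p $ 1))\<^sup>2 + (of_int (p $ 2))\<^sup>2"
proof -
  have "normsq (emb p) = (\<Sum>i\<in>UNIV. if i = i1 then (of_int (p $ 1))\<^sup>2 else if i = i2 then (of_int (p $ 2))\<^sup>2 else 0)"
    unfolding normsq_def using i12 by (intro sum.cong) (auto simp: emb_def)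
  thus ?thesis using i12 by (simp add: sum_if_two)
qed

lemma finite_cross: "finite (cross z)"
  by (simp add: cross_def)

lemma card_cross: "card (cross z) \<le> 4 * R + 2"
proof -
  have "card (cross z) \<le> card ((\<lambda>j. emb (N *s z + pt j 0)) ` {0..N}) + card ((\<lambda>j. emb (N *s z + pt 0 j)) ` {0..N})"
    unfolding cross_def by (rule card_Un_le)
  also have "\<dots> \<le> card {0..N} + card {0..N}" by (intro add_mono card_image_le) auto
  also have "\<dots> = 4 * R + 2" by simp
  finally show ?thesis .
qed

lemma crossE:
  assumes "x \<in> cross z"
  obtains a where "x = emb (N *s z + a)" "0 \<le> a $ 1" "a $ 1 \<le> N" "0 \<le> a $ 2" "a $ 2 \<le> N"
  using assms unfolding cross_def by force

lemma mass_pos: "0 < mass"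
  unfolding mass_def by (intro sum_pos) auto

text \<open>The corners are \<open>2 * R * l\<close> apart for \<open>l = linf (z - z')\<close>, and
  the positions within the crosses change this by at most \<open>2 * R\<close>, which is at most
  half of it when \<open>l \<ge> 2\<close>.\<close>

lemma cross_far:
  assumes x: "x \<in> cross z" and y: "y \<in> cross z'" and far: "2 \<le> linf (z - z')"
  shows "int R * linf (z - z') \<le> linf (x - y)"
proof -
  obtain a where a: "x = emb (N *s z + a)" "0 \<le> a $ 1" "a $ 1 \<le> N" "0 \<le> a $ 2" "a $ 2 \<le> N"
    using x by (rule crossE)
  obtain b where b: "y = emb (N *s z' + b)" "0 \<le> b $ 1" "b $ 1 \<le> N" "0 \<le> b $ 2" "b $ 2 \<le> N"
    using y by (rule crossE)
  have xy: "x - y = emb (N *s (z - z') - (b - a))"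
    unfolding a(1) b(1) emb_diff by (rule arg_cong[where f = emb]) (simp add: vec_eq_iff algebra_simps)
  have ba: "linf (b - a) \<le> N" unfolding linf_le_iff forall_2 using a b by auto
  have "N * linf (z - z') = linf (N *s (z - z'))" by (rule linf_scale[symmetric]) simp
  also have "\<dots> \<le> linf (N *s (z - z') - (b - a)) + linf (b - a)"
    using linf_add[of "N *s (z - z') - (b - a)" "b - a"] by simp
  also have "linf (N *s (z - z') - (b - a)) = linf (x - y)" unfolding xy linf_emb ..
  finally have "N * linf (z - z') \<le> linf (x - y) + N" using ba by linarith
  moreover have "int R * 2 \<le> int R * linf (z - z')" using far by (intro mult_left_mono) auto
  ultimately show ?thesis by (simp add: algebra_simps)
qed

text \<open>Half of the segment through \<open>x\<close> already carries the harmonic sum \<open>mass\<close>.\<close>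

lemma segment_pot_ge:
  assumes j0: "0 \<le> j0" "j0 \<le> N" and f: "\<And>j. f j - f j0 = emb (pt (j - j0) 0) \<or> f j - f j0 = emb (pt 0 (j - j0))"
    and inj: "inj_on f {0..N}"
  shows "mass \<le> (\<Sum>y\<in>f ` {0..N}. pot (f j0 - y))"
proof -
  have pot: "1 / (real t + 3) \<le> pot (f j0 - f j)" if "\<bar>j - j0\<bar> = int t" for j t
  proof -
    have n: "normsq (f j0 - f j) = (real t)\<^sup>2"
    proof -
      have "normsq (f j0 - f j) = normsq (f j - f j0)"
        by (simp add: normsq_def power2_commute)
      also have "\<dots> = (of_int (j - j0))\<^sup>2" using f[of j] by (auto simp: normsq_emb)
      also have "\<dots> = (of_int \<bar>j - j0\<bar>)\<^sup>2" by (simp only: of_int_abs power2_abs)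
      finally show ?thesis using that by simp
    qed
    have "sqrt ((real t)\<^sup>2 + 5) \<le> real t + 3"
      by (rule real_le_lsqrt) (auto simp: power2_eq_square algebra_simps)
    thus ?thesis unfolding pot_def n by (intro frac_le) (auto simp: add_nonneg_pos)
  qed
  \<comment> \<open>Points are counted from \<open>j0\<close> towards an end at distance at least
    \<open>R\<close>.\<close>
  define g where "g t = (if int R \<le> j0 then j0 - int t else j0 + int t)" for t :: nat
  have g: "g ` {..R} \<subseteq> {0..N}" "inj_on g {..R}" "\<And>t. \<bar>g t - j0\<bar> = int t"
    using j0 by (auto simp: g_def inj_on_def)
  have "mass \<le> (\<Sum>t\<le>R. pot (f j0 - f (g t)))"
    unfolding mass_def by (intro sum_mono pot g)
  also have "\<dots> = (\<Sum>j\<in>g ` {..R}. pot (f j0 - f j))" using g(2) by (simp add: sum.reindex)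
  also have "\<dots> \<le> (\<Sum>j\<in>{0..N}. pot (f j0 - f j))"
    using g(1) by (intro sum_mono2) (auto intro: less_imp_le pot_pos)
  also have "\<dots> = (\<Sum>y\<in>f ` {0..N}. pot (f j0 - y))" using inj by (simp add: sum.reindex)
  finally show ?thesis .
qed

lemma cross_pot_ge_1:
  assumes x: "x \<in> cross z"
  shows "1 \<le> cross_pot z x"
proof -
  have "mass \<le> (\<Sum>y\<in>cross z. pot (x - y))"
  proof -
    have "\<exists>f j0. 0 \<le> j0 \<and> j0 \<le> N \<and> x = f j0 \<and> f ` {0..N} \<subseteq> cross z \<and> inj_on f {0..N} \<and>
      (\<forall>j. f j - f j0 = emb (pt (j - j0) 0) \<or> f j - f j0 = emb (pt 0 (j - j0)))"
    proof -
      from x consider j0 where "0 \<le> j0" "j0 \<le> N" "x = emb (N *s z + pt j0 0)" | j0 where "0 \<le> j0" "j0 \<le> N" "x = emb (N *s z + pt 0 j0)"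
        by (auto simp: cross_def)
      thus ?thesis
      proof cases
        case 1
        have "emb (N *s z + pt j 0) - emb (N *s z + pt j0 0) = emb (pt (j - j0) 0)" for j
          unfolding emb_diff by (rule arg_cong[where f = emb]) (simp add: vec_eq_iff forall_2)
        moreover have "inj_on (\<lambda>j. emb (N *s z + pt j 0)) {0..N}"
        proof (rule inj_onI)
          fix j j' assume "emb (N *s z + pt j 0) = emb (N *s z + pt j' 0)"
          hence "pt j 0 = pt j' 0" by (simp only: emb_inj add_left_cancel)
          hence "pt j 0 $ 1 = pt j' 0 $ 1" by (simp only:)
          thus "j = j'" by simp
        qed
        ultimately show ?thesis using 1
          by (intro exI[of _ "\<lambda>j. emb (N *s z + pt j 0)"] exI[of _ j0]) (auto simp: cross_def)
      next
        case 2
        have "emb (N *s z + pt 0 j) - emb (N *s z + pt 0 j0) = emb (pt 0 (j - j0))" for j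
          unfolding emb_diff by (rule arg_cong[where f = emb]) (simp add: vec_eq_iff forall_2)
        moreover have "inj_on (\<lambda>j. emb (N *s z + pt 0 j)) {0..N}"
        proof (rule inj_onI)
          fix j j' assume "emb (N *s z + pt 0 j) = emb (N *s z + pt 0 j')"
          hence "pt 0 j = pt 0 j'" by (simp only: emb_inj add_left_cancel)
          hence "pt 0 j $ 2 = pt 0 j' $ 2" by (simp only:)
          thus "j = j'" by simp
        qed
        ultimately show ?thesis using 2
          by (intro exI[of _ "\<lambda>j. emb (N *s z + pt 0 j)"] exI[of _ j0]) (auto simp: cross_def)
      qed
    qed
    then obtain f j0 where f: "0 \<le> j0" "j0 \<le> N" "x = f j0" "f ` {0..N} \<subseteq> cross z" "inj_on f {0..N}"
      "\<And>j. f j - f j0 = emb (pt (j - j0) 0) \<or> f j - f j0 = emb (pt 0 (j - j0))" by blast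
    have "mass \<le> (\<Sum>y\<in>f ` {0..N}. pot (f j0 - y))" by (rule segment_pot_ge[OF f(1,2,6,5)])
    also have "\<dots> \<le> (\<Sum>y\<in>cross z. pot (f j0 - y))"
      using f(4) finite_cross by (intro sum_mono2) (auto intro: less_imp_le pot_pos)
    finally show ?thesis by (simp add: f(3))
  qed
  hence "1 \<le> 1 / mass * (\<Sum>y\<in>cross z. pot (x - y))" using mass_pos by (simp add: field_simps)
  thus ?thesis by (simp only: cross_pot_def sum_distrib_left)
qed

text \<open>At most \<open>6 * R\<close> points, each with potential at most
  \<open>1 / (R * l)\<close>: the length cancels, and the normalisation by \<open>mass\<close>
  remains as a logarithmic gain.\<close>

lemma cross_pot_far:
  assumes x: "x \<in> cross z" and far: "2 \<le> linf (z - z')"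
  shows "cross_pot z' x \<le> 6 / mass * (1 / real_of_int (linf (z - z')))"
proof -
  define l where "l = real_of_int (linf (z - z'))"
  have l: "0 < l" using far by (simp add: l_def)
  have R': "1 \<le> real R" using R by simp
  have "pot (x - y) \<le> 1 / (real R * l)" if y: "y \<in> cross z'" for y
  proof -
    have "int R * linf (z - z') \<le> linf (x - y)" by (rule cross_far[OF x y far])
    hence le: "real R * l \<le> real_of_int (linf (x - y))"
      unfolding l_def by (metis of_int_le_iff of_int_mult of_int_of_nat_eq)
    moreover have pos: "0 < real R * l" using l R' by simp
    ultimately have "0 < linf (x - y)" by linarith
    hence "pot (x - y) \<le> 1 / real_of_int (linf (x - y))" by (rule pot_le_linf)
    also have "\<dots> \<le> 1 / (real R * l)" using le pos by (intro frac_le) auto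
    finally show ?thesis .
  qed
  hence "cross_pot z' x \<le> (\<Sum>y\<in>cross z'. 1 / mass * (1 / (real R * l)))"
    unfolding cross_pot_def using mass_pos by (intro sum_mono mult_left_mono) auto
  also have "\<dots> = real (card (cross z')) * (1 / mass * (1 / (real R * l)))" by simp
  also have "\<dots> \<le> (6 * real R) * (1 / mass * (1 / (real R * l)))"
  proof (intro mult_right_mono)
    have "real (card (cross z')) \<le> real (4 * R + 2)" using card_cross[of z'] by (simp only: of_nat_le_iff)
    also have "\<dots> \<le> 6 * real R" using R' by simp
    finally show "real (card (cross z')) \<le> 6 * real R" .
  qed (use mass_pos l R' in auto)
  also have "\<dots> = 6 / mass * (1 / l)" using R' by (simp add: field_simps)
  finally show ?thesis by (simp only: l_def)
qed

lemma cross_disjoint: "2 \<le> linf (z - z') \<Longrightarrow> cross z \<inter> cross z' = {}"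
proof (rule ccontr)
  assume far: "2 \<le> linf (z - z')" and "cross z \<inter> cross z' \<noteq> {}"
  then obtain x where x: "x \<in> cross z" "x \<in> cross z'" by blast
  have "int R * linf (z - z') \<le> linf (x - x)" by (rule cross_far[OF x far])
  hence "int R * linf (z - z') \<le> 0" by simp
  moreover have "0 < int R * linf (z - z')" using far R by simp
  ultimately show False by linarith
qed

lemma cross_step:
  assumes V: "cross z \<subseteq> V" "cross z' \<subseteq> V" and adj: "adjacent z z'"
  shows "nn_path V (emb (N *s z)) (emb (N *s z'))"
proof -
  have seg: "nn_path V (emb (N *s w)) (emb (N *s w'))"
    if w: "cross w \<subseteq> V" and e: "w' = w + pt 1 0 \<or> w' = w + pt 0 1" for w w'
  proof -
    have 0: "w + pt 0 0 = w" for w :: "int ^ 2" by (simp add: vec_eq_iff forall_2)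
    show ?thesis using e
    proof
      assume e: "w' = w + pt 1 0"
      have "nn_path V (emb (N *s w + pt 0 0)) (emb (N *s w + pt N 0))"
      proof (rule nn_path_segment[of 0 N "\<lambda>j. emb (N *s w + pt j 0)"])
        fix t
        show "adjacent (emb (N *s w + pt t 0)) (emb (N *s w + pt (t + 1) 0))"
          by (intro emb_adjacent) (simp add: adjacent_def sum_2)
        assume "0 \<le> t" "t \<le> N"
        thus "emb (N *s w + pt t 0) \<in> V" using w by (auto simp: cross_def)
      qed simp
      moreover have "N *s w + pt N 0 = N *s w'" unfolding e by (simp add: vec_eq_iff forall_2 algebra_simps)
      ultimately show ?thesis by (simp only: 0)
    next
      assume e: "w' = w + pt 0 1"
      have "nn_path V (emb (N *s w + pt 0 0)) (emb (N *s w + pt 0 N))"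
      proof (rule nn_path_segment[of 0 N "\<lambda>j. emb (N *s w + pt 0 j)"])
        fix t
        show "adjacent (emb (N *s w + pt 0 t)) (emb (N *s w + pt 0 (t + 1)))"
          by (intro emb_adjacent) (simp add: adjacent_def sum_2)
        assume "0 \<le> t" "t \<le> N"
        thus "emb (N *s w + pt 0 t) \<in> V" using w by (auto simp: cross_def)
      qed simp
      moreover have "N *s w + pt 0 N = N *s w'" unfolding e by (simp add: vec_eq_iff forall_2 algebra_simps)
      ultimately show ?thesis by (simp only: 0)
    qed
  qed
  have "\<bar>z $ 1 - z' $ 1\<bar> + \<bar>z $ 2 - z' $ 2\<bar> = 1" using adj by (simp add: adjacent_def sum_2)
  hence "z' = z + pt 1 0 \<or> z' = z + pt 0 1 \<or> z = z' + pt 1 0 \<or> z = z' + pt 0 1"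
    unfolding vec_eq_iff forall_2 by simp linarith
  thus ?thesis using seg[OF V(1), of z'] seg[OF V(2), of z] nn_path_sym by blast
qed

lemma coarse_percolates:
  assumes "percolates {z. cross z \<subseteq> V}"
  shows "percolates V"
proof -
  let ?O = "{z. cross z \<subseteq> V}"
  have inf: "infinite (component ?O 0)" using assms by (simp add: percolates_def)
  then obtain z0 where "z0 \<in> component ?O 0" by fastforce
  hence O0: "0 \<in> ?O" by (simp add: component_def)
  have center: "emb (N *s z) \<in> cross z" for z
  proof -
    have "N *s z + pt 0 0 = N *s z" by (simp add: vec_eq_iff forall_2)
    hence "emb (N *s z) = (\<lambda>j. emb (N *s z + pt j 0)) 0" by simp
    moreover have "0 \<in> {0..N}" by simp
    ultimately show ?thesis unfolding cross_def by blast
  qed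
  have "N *s 0 = (0 :: int ^ 2)" by (simp add: vec_eq_iff)
  hence V0: "0 \<in> V" using center[of 0] O0 by auto
  have path: "nn_path V 0 (emb (N *s z))" if "nn_path ?O 0 z" for z
    using that
  proof (induction rule: rtranclp_induct)
    case base
    show ?case unfolding \<open>N *s 0 = 0\<close> emb_0 by (rule rtranclp.rtrancl_refl)
  next
    case (step y z)
    have "nn_path V (emb (N *s y)) (emb (N *s z))"
      by (rule cross_step) (use step.hyps(2) in simp_all)
    thus ?case by (rule nn_path_trans[OF step.IH])
  qed
  have "(\<lambda>z. emb (N *s z)) ` component ?O 0 \<subseteq> component V 0"
  proof (rule image_subsetI)
    fix z assume "z \<in> component ?O 0"
    hence "nn_path ?O 0 z" by (simp add: component_def)
    thus "emb (N *s z) \<in> component V 0" using path V0 by (simp add: component_def)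
  qed
  moreover have "inj (\<lambda>z. emb (N *s z))"
  proof (rule injI)
    fix z z' assume "emb (N *s z) = emb (N *s z')"
    hence "N *s z = N *s z'" by (simp only: emb_inj)
    thus "z = z'" using R by (simp add: vec_eq_iff)
  qed
  hence "infinite ((\<lambda>z. emb (N *s z)) ` component ?O 0)"
    using inf finite_imageD inj_on_subset by blast
  ultimately show ?thesis unfolding percolates_def using finite_subset by blast
qed

text \<open>For \<open>s = 2\<close> the energy of a leaf set is at most 1, so
  \<open>\<delta> = 6 / mass\<close>; the condition \<open>12 * \<rho> \<le> mass\<close> is then
  \<open>\<rho> * \<delta> \<le> 1/2\<close>.\<close>

lemma sparse_crosses:
  assumes d: "3 \<le> CARD('d)" and A: "A \<in> trees 2 n z" and T: "T \<subseteq> A"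
    and \<rho>: "1 \<le> \<rho>" "12 * \<rho> \<le> mass"
  shows "sparse_obstacles cross T cross_pot \<rho> (6 / mass) (4 * R + 2)"
proof
  have finA: "finite A" using trees_finite_card[OF _ A] by simp
  show "finite T" using finA T finite_subset by blast
  show "finite (cross z)" "card (cross z) \<le> 4 * R + 2" for z by (rule finite_cross card_cross)+
  show "avg (cross_pot z) x \<le> cross_pot z x" for z x
  proof -
    have "avg (cross_pot z) x = (\<Sum>y\<in>cross z. 1 / mass * avg pot (x - y))"
      unfolding cross_pot_def avg_sum avg_cmult avg_translate[of pot] ..
    also have "\<dots> \<le> cross_pot z x"
      unfolding cross_pot_def using mass_pos d by (intro sum_mono mult_left_mono avg_pot_le) auto
    finally show ?thesis .
  qed
  show "0 \<le> cross_pot z x" for z x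
    unfolding cross_pot_def using mass_pos pot_pos by (intro sum_nonneg mult_nonneg_nonneg) (auto intro: less_imp_le)
  show "x \<in> cross z \<Longrightarrow> 1 \<le> cross_pot z x" for z x by (rule cross_pot_ge_1)
  show "1 \<le> \<rho>" by fact
  show "\<rho> * (6 / mass) \<le> 1/2" using \<rho> mass_pos by (simp add: field_simps)
  fix z x assume z: "z \<in> T" and x: "x \<in> cross z"
  have far: "2 \<le> linf (z - z')" if "z' \<in> A - {z}" for z'
    using trees_spread[OF _ A, of z z'] z T that by auto
  have "(\<Sum>z'\<in>T - {z}. cross_pot z' x) \<le> (\<Sum>z'\<in>T - {z}. 6 / mass * (1 / real_of_int (linf (z - z'))))"
    using far T by (intro sum_mono cross_pot_far[OF x]) auto
  also have "\<dots> \<le> (\<Sum>z'\<in>A - {z}. 6 / mass * (1 / real_of_int (linf (z - z'))))"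
    using finA T mass_pos by (intro sum_mono2) auto
  also have "\<dots> = 6 / mass * (\<Sum>z'\<in>A - {z}. 1 / real_of_int (linf (z - z')))"
    by (simp only: sum_distrib_left)
  also have "\<dots> \<le> 6 / mass * 1"
  proof (intro mult_left_mono)
    have "(\<Sum>z'\<in>A - {z}. 1 / real_of_int (linf (z - z'))) \<le> 2 / real 2 * (1 - (1/2) ^ n)"
      using z T by (intro trees_energy[OF _ A]) auto
    also have "\<dots> \<le> 1" by simp
    finally show "(\<Sum>z'\<in>A - {z}. 1 / real_of_int (linf (z - z'))) \<le> 1" .
  qed (use mass_pos in auto)
  finally show "(\<Sum>z'\<in>T - {z}. cross_pot z' x) \<le> 6 / mass" by simp
qed

end

section \<open>Percolation at small levels\<close>

context interlacement_model
begin

lemma supercritical: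
  "\<exists>u\<^sub>0>0. \<exists>\<epsilon>\<^sub>0>0. \<forall>u \<epsilon>. 0 \<le> u \<longrightarrow> u \<le> u\<^sub>0 \<longrightarrow> 0 < \<epsilon> \<longrightarrow> \<epsilon> < 1 \<longrightarrow> \<epsilon> \<le> \<epsilon>\<^sub>0 \<longrightarrow> 0 < perc_prob M (I u) (\<theta> \<epsilon>)"
proof -
  obtain i1 i2 :: 'd where i12: "i1 \<noteq> i2"
  proof -
    have "\<not> (\<forall>i1 i2 :: 'd. i1 = i2)"
    proof
      assume "\<forall>i1 i2 :: 'd. i1 = i2"
      hence "CARD('d) \<le> 1" by (intro card_le_Suc0_iff_eq[THEN iffD2, unfolded One_nat_def[symmetric]]) auto
      thus False using dim by simp
    qed
    thus ?thesis using that by blast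
  qed
  define c where "c = real (tree_entropy TYPE(2) 2)"
  have c: "1 \<le> c" by (simp add: c_def tree_entropy_def)
  \<comment> \<open>The budget per leaf is \<open>2 / \<rho> = 1 / (96 * c)\<close> for the
    interlacement and as much for the noise, together \<open>1 / (48 * c)\<close>. The entropy
    leaves 1/48, and the \<open>12 ^ Suc n\<close> roots at depth \<open>n\<close> leave 1/4, so the
    failure probabilities sum to at most 1/3.\<close>
  define \<rho> where "\<rho> = 192 * c"
  obtain R0 :: nat where R0: "12 * \<rho> \<le> (\<Sum>t\<le>R0. 1 / (real t + 3))" using harmonic_unbounded by blast
  define R where "R = max R0 1"
  interpret C: coarse_plane i1 i2 R by standard (use i12 in \<open>auto simp: R_def\<close>)
  have mass: "12 * \<rho> \<le> C.mass"
  proof -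
    have "(\<Sum>t\<le>R0. 1 / (real t + 3)) \<le> C.mass" unfolding C.mass_def by (intro sum_mono2) (auto simp: R_def)
    thus ?thesis using R0 by linarith
  qed
  define k :: nat where "k = 4 * R + 2"
  have k: "1 \<le> real k" by (simp add: k_def)
  \<comment> \<open>The level up to which the exponential factor in \<open>prob_hit_all_le\<close>
    is at most 2 per obstacle.\<close>
  define u0 where "u0 = ln 2 / (2 * (\<rho> - 1) * k)"
  have \<rho>: "1 < \<rho>" using c by (simp add: \<rho>_def)
  have den: "0 < 2 * (\<rho> - 1) * k" using \<rho> k by simp
  have u0: "0 < u0" using den by (simp add: u0_def)
  define \<epsilon>0 where "\<epsilon>0 = 1 / (96 * c * k)"
  have \<epsilon>0: "0 < \<epsilon>0" using c k by (simp add: \<epsilon>0_def)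
  have "0 < perc_prob M (I u) (\<theta> \<epsilon>)"
    if u: "0 \<le> u" "u \<le> u0" and \<epsilon>: "0 < \<epsilon>" "\<epsilon> < 1" "\<epsilon> \<le> \<epsilon>0" for u \<epsilon>
  proof -
    note [measurable] = fields_pred[OF u(1) \<epsilon>(1,2)]
    define V where "V \<omega> = disordered_vacant (I u) (\<theta> \<epsilon>) \<omega>" for \<omega>
    let ?Q = "\<lambda>z i. \<exists>y\<in>C.cross z. i y"
    define E where "E A = {\<omega> \<in> space M. \<forall>z\<in>A. ?Q z (\<lambda>x. x \<in> I u \<omega>) \<or> (\<exists>y\<in>C.cross z. \<theta> \<epsilon> y \<omega>)}" for A
    have E_event: "E A \<in> events" if "finite A" for A
    proof -
      have [measurable]: "Measurable.pred M (\<lambda>\<omega>. \<exists>y\<in>C.cross z. y \<in> I u \<omega>)" "Measurable.pred M (\<lambda>\<omega>. \<exists>y\<in>C.cross z. \<theta> \<epsilon> y \<omega>)" for z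
        using C.finite_cross[of z] by measurable
      show ?thesis unfolding E_def using that by measurable
    qed
    have fin_A: "finite A" if "A \<in> trees 2 n z" for A n and z :: "int ^ 2" using trees_finite_card[OF _ that] by simp
    have PE: "prob (E A) \<le> (1 / (48 * c)) ^ (2 ^ n)" if A: "A \<in> trees 2 n z" for A n z
    proof -
      define q where "q = exp (2 * (\<rho> - 1) * k * u) / \<rho>"
      have "prob (E A) \<le> (q + k * \<epsilon>) ^ card A"
        unfolding E_def
      proof (rule interlacement_or_noise_le[OF prob_space_axioms independent[OF u(1) \<epsilon>(1,2)] bernoulli[OF \<epsilon>(1,2)]])
        show "disjoint_family_on C.cross A"
        proof (unfold disjoint_family_on_def, intro ballI impI)
          fix z z' assume "z \<in> A" "z' \<in> A" "z \<noteq> z'"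
          hence "2 \<le> linf (z - z')" using trees_spread[OF _ A, of z z'] by simp
          thus "C.cross z \<inter> C.cross z' = {}" by (rule C.cross_disjoint)
        qed
        show "Measurable.pred config_space (?Q z)" for z
          using C.finite_cross[of z] by measurable
        fix T assume T: "T \<subseteq> A"
        interpret S: sparse_obstacles C.cross T C.cross_pot \<rho> "6 / C.mass" "4 * R + 2"
          by (rule C.sparse_crosses[OF dim A T]) (use \<rho> mass in auto)
        have "{\<omega> \<in> space M. \<forall>z\<in>T. ?Q z (\<lambda>x. x \<in> I u \<omega>)} = {\<omega> \<in> space M. \<forall>z\<in>T. I u \<omega> \<inter> C.cross z \<noteq> {}}" by blast
        thus "prob {\<omega> \<in> space M. \<forall>z\<in>T. ?Q z (\<lambda>x. x \<in> I u \<omega>)} \<le> q ^ card T"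
          using S.prob_hit_all_le[OF prob_space_axioms interlacement u(1)] by (simp add: q_def k_def)
      qed (use \<epsilon> fin_A[OF A] C.finite_cross C.card_cross in \<open>auto simp: k_def\<close>)
      also have "card A = 2 ^ n" using trees_finite_card[OF _ A] by simp
      also have "(q + k * \<epsilon>) ^ (2 ^ n) \<le> (1 / (48 * c)) ^ (2 ^ n)"
      proof (rule power_mono)
        have "2 * (\<rho> - 1) * k * u \<le> 2 * (\<rho> - 1) * k * u0" using u den by (intro mult_left_mono) auto
        also have "\<dots> = ln 2"
        proof -
          have "D * (ln 2 / D) = ln 2" if "0 < D" for D :: real using that by simp
          thus ?thesis using den unfolding u0_def by blast
        qed
        finally have "exp (2 * (\<rho> - 1) * k * u) \<le> exp (ln 2)" by (simp only: exp_le_cancel_iff)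
        hence "q \<le> 2 / \<rho>" unfolding q_def using \<rho> by (intro divide_right_mono) auto
        also have "2 / \<rho> = 1 / (96 * c)" by (simp add: \<rho>_def)
        finally have 1: "q \<le> 1 / (96 * c)" .
        have "k * \<epsilon> \<le> k * \<epsilon>0" using \<epsilon> by (intro mult_left_mono) auto
        also have "\<dots> = 1 / (96 * c)" using k by (simp add: \<epsilon>0_def)
        finally have "q + k * \<epsilon> \<le> 1 / (96 * c) + 1 / (96 * c)" using 1 by linarith
        also have "\<dots> = 1 / (48 * c)" by simp
        finally show "q + k * \<epsilon> \<le> 1 / (48 * c)" .
        show "0 \<le> q + k * \<epsilon>" using \<rho> \<epsilon> by (simp add: q_def)
      qed
      finally show ?thesis .
    qed
    define B where "B n = (\<Union>a\<in>{0..<scale 2 (Suc n)}. \<Union>A\<in>trees 2 n (pt a 0). E A)" for n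
    have fin_trees: "finite (trees 2 n z)" for n and z :: "int ^ 2" using card_trees[of 2 n z] by simp
    have B_event: "B n \<in> events" for n
      unfolding B_def using E_event fin_A fin_trees by (intro sets.finite_UN) auto
    have PB: "prob (B n) \<le> (1/4) ^ Suc n" for n
    proof -
      have one: "prob (\<Union>A\<in>trees 2 n z. E A) \<le> (1/48) ^ (2 ^ n)" for z :: "int ^ 2"
      proof -
        have "prob (\<Union>A\<in>trees 2 n z. E A) \<le> (\<Sum>A\<in>trees 2 n z. prob (E A))"
          using E_event fin_A fin_trees by (intro finite_measure_subadditive_finite) auto
        also have "\<dots> \<le> (\<Sum>A\<in>trees 2 n z. (1 / (48 * c)) ^ (2 ^ n))" by (intro sum_mono PE)
        also have "\<dots> = card (trees 2 n z) * (1 / (48 * c)) ^ (2 ^ n)" by simp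
        also have "\<dots> \<le> c ^ (2 ^ n) * (1 / (48 * c)) ^ (2 ^ n)"
        proof (rule mult_right_mono)
          show "real (card (trees 2 n z)) \<le> c ^ (2 ^ n)"
            using card_trees_le[of 2 n z] unfolding c_def by (metis of_nat_le_iff of_nat_power)
        qed (use c in simp)
        also have "\<dots> = (1/48) ^ (2 ^ n)" using c by (simp add: power_mult_distrib[symmetric])
        finally show ?thesis .
      qed
      have "prob (B n) \<le> (\<Sum>a\<in>{0..<scale 2 (Suc n)}. prob (\<Union>A\<in>trees 2 n (pt a 0). E A))"
        unfolding B_def using E_event fin_A fin_trees
        by (intro finite_measure_subadditive_finite) (auto intro!: sets.finite_UN)
      also have "\<dots> \<le> (\<Sum>a\<in>{0..<scale 2 (Suc n)}. (1/48) ^ (2 ^ n))" by (intro sum_mono one)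
      also have "\<dots> = real (nat (scale 2 (Suc n))) * (1/48) ^ (2 ^ n)" by simp
      also have "real (nat (scale 2 (Suc n))) = 12 ^ Suc n"
        by (simp add: scale_def nat_power_eq)
      \<comment> \<open>Uses \<open>Suc n \<le> 2 ^ n\<close>: already one factor 1/48 per level
        outweighs the number of roots.\<close>
      also have "12 ^ Suc n * (1/48 :: real) ^ (2 ^ n) \<le> 12 ^ Suc n * (1/48) ^ Suc n"
        by (intro mult_left_mono power_decreasing) (auto simp: Suc_le_eq)
      also have "\<dots> = (1/4) ^ Suc n" by (subst power_mult_distrib[symmetric]) simp
      finally show ?thesis .
    qed
    have sums: "(\<lambda>n. (1/4 :: real) ^ Suc n) sums (1/3)"
      using sums_mult[OF geometric_sums[of "1/4 :: real"], of "1/4"] by simp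
    have summ: "summable (\<lambda>n. prob (B n))"
      by (rule summable_comparison_test'[OF sums_summable[OF sums], of 0]) (use PB in auto)
    have "prob (\<Union>n. B n) \<le> (\<Sum>n. prob (B n))"
      using B_event summ by (intro finite_measure_subadditive_countably) auto
    also have "\<dots> \<le> (\<Sum>n. (1/4 :: real) ^ Suc n)"
      by (intro suminf_le PB summ sums_summable[OF sums])
    also have "\<dots> = 1/3" using sums by (rule sums_unique[symmetric])
    finally have small: "prob (\<Union>n. B n) \<le> 1/3" .
    let ?P = "{\<omega> \<in> space M. percolates (V \<omega>)}"
    have P: "?P \<in> events" unfolding V_def by (rule percolation_event[OF u(1) \<epsilon>(1,2)])
    have "space M \<subseteq> ?P \<union> (\<Union>n. B n)"
    proof
      fix \<omega> assume \<omega>: "\<omega> \<in> space M"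
      show "\<omega> \<in> ?P \<union> (\<Union>n. B n)"
      proof (cases "percolates (V \<omega>)")
        case False
        hence "\<not> percolates {z. C.cross z \<subseteq> V \<omega>}" using C.coarse_percolates by blast
        then obtain n a A where A: "0 \<le> a" "a < scale 2 (Suc n)" "A \<in> trees 2 n (pt a 0)"
          "A \<inter> {z. C.cross z \<subseteq> V \<omega>} = {}"
          using not_percolates_imp_blocking_tree[of _ 2] by blast
        have "\<omega> \<in> E A"
          unfolding E_def
        proof (intro CollectI conjI ballI \<omega>)
          fix z assume "z \<in> A"
          then obtain y where "y \<in> C.cross z" "y \<notin> V \<omega>" using A(4) by blast
          thus "?Q z (\<lambda>x. x \<in> I u \<omega>) \<or> (\<exists>y\<in>C.cross z. \<theta> \<epsilon> y \<omega>)" by (auto simp: V_def vacant_eq)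
        qed
        hence "\<omega> \<in> B n" unfolding B_def using A by (intro UN_I[of a] UN_I[of A]) auto
        thus ?thesis by blast
      qed (use \<omega> in blast)
    qed
    hence "prob (space M) \<le> prob (?P \<union> (\<Union>n. B n))"
      using P B_event by (intro finite_measure_mono) auto
    also have "\<dots> \<le> prob ?P + prob (\<Union>n. B n)"
      using P B_event by (intro measure_Un_le) auto
    finally have "2/3 \<le> prob ?P" using small by (simp add: prob_space)
    thus ?thesis by (simp add: perc_prob_def V_def)
  qed
  thus ?thesis using u0 \<epsilon>0 by blast
qed

end

section \<open>Phase transition and bounds on the critical level\<close>

theorem theorem3:
  fixes M :: "'w measure"
    and I :: "real \<Rightarrow> 'w \<Rightarrow> (int ^ 'd::finite) set"
    and \<theta> :: "real \<Rightarrow> int ^ 'd \<Rightarrow> 'w \<Rightarrow> bool"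
  assumes "CARD('d) \<ge> 3"
    and "prob_space M"
    and "\<And>u. 0 \<le> u \<Longrightarrow> random_interlacement M u (I u)"
    and "\<And>\<epsilon>. 0 < \<epsilon> \<Longrightarrow> \<epsilon> < 1 \<Longrightarrow> bernoulli_field M \<epsilon> (\<theta> \<epsilon>)"
    and "\<And>u \<epsilon>. 0 \<le> u \<Longrightarrow> 0 < \<epsilon> \<Longrightarrow> \<epsilon> < 1 \<Longrightarrow> noise_independent M (I u) (\<theta> \<epsilon>)"
  shows "(\<forall>\<epsilon> u. 0 < \<epsilon> \<longrightarrow> \<epsilon> < 1/2 \<longrightarrow> u_star M I \<theta> \<epsilon> < ereal u \<longrightarrow>
            perc_prob M (I u) (\<theta> \<epsilon>) = 0)
       \<and> (\<exists>\<epsilon>\<^sub>0>0. \<forall>\<epsilon>. 0 < \<epsilon> \<longrightarrow> \<epsilon> \<le> \<epsilon>\<^sub>0 \<longrightarrow>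
            0 < u_star M I \<theta> \<epsilon> \<and> u_star M I \<theta> \<epsilon> < \<infinity>)"
proof (intro conjI allI impI)
  interpret interlacement_model M I \<theta>
    using assms by (intro interlacement_model.intro interlacement_model_axioms.intro)
  fix \<epsilon> u :: real
  assume \<epsilon>: "0 < \<epsilon>" "\<epsilon> < 1/2" and u: "u_star M I \<theta> \<epsilon> < ereal u"
  then obtain v where v: "0 \<le> v" "perc_prob M (I v) (\<theta> \<epsilon>) = 0" "v < u"
    unfolding u_star_def by (auto simp: Inf_less_iff)
  \<comment> \<open>The interlacement of level \<open>u - v\<close> plays the role of the
    independent set added to level \<open>v\<close>.\<close>
  have "perc_prob M (I u) (\<theta> \<epsilon>) \<le> perc_prob M (I v) (\<theta> \<epsilon>)"
    using v \<epsilon> interlacement[of u]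
    by (intro perc_prob_antimono[OF prob_space_axioms interlacement[of v] interlacement[of "u - v"] _ bernoulli
          independent independent]) auto
  thus "perc_prob M (I u) (\<theta> \<epsilon>) = 0" using v by (simp add: perc_prob_def measure_le_0_iff)
next
  interpret interlacement_model M I \<theta>
    using assms by (intro interlacement_model.intro interlacement_model_axioms.intro)
  obtain \<epsilon>\<^sub>1 where \<epsilon>\<^sub>1: "0 < \<epsilon>\<^sub>1"
    "\<And>\<epsilon>. 0 < \<epsilon> \<Longrightarrow> \<epsilon> < 1 \<Longrightarrow> \<epsilon> \<le> \<epsilon>\<^sub>1 \<Longrightarrow> \<exists>u\<ge>0. perc_prob M (I u) (\<theta> \<epsilon>) = 0"
    using subcritical by blast
  obtain u\<^sub>0 \<epsilon>\<^sub>2 where \<epsilon>\<^sub>2: "0 < u\<^sub>0" "0 < \<epsilon>\<^sub>2"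
    "\<And>u \<epsilon>. 0 \<le> u \<Longrightarrow> u \<le> u\<^sub>0 \<Longrightarrow> 0 < \<epsilon> \<Longrightarrow> \<epsilon> < 1 \<Longrightarrow> \<epsilon> \<le> \<epsilon>\<^sub>2 \<Longrightarrow> 0 < perc_prob M (I u) (\<theta> \<epsilon>)"
    using supercritical by blast
  \<comment> \<open>The cap 1/2 keeps every admissible \<open>\<epsilon>\<close> below 1, as the two
    phase lemmas require.\<close>
  define \<epsilon>\<^sub>0 where "\<epsilon>\<^sub>0 = min (min \<epsilon>\<^sub>1 \<epsilon>\<^sub>2) (1/2)"
  show "\<exists>\<epsilon>\<^sub>0>0. \<forall>\<epsilon>. 0 < \<epsilon> \<longrightarrow> \<epsilon> \<le> \<epsilon>\<^sub>0 \<longrightarrow> 0 < u_star M I \<theta> \<epsilon> \<and> u_star M I \<theta> \<epsilon> < \<infinity>"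
  proof (intro exI[of _ \<epsilon>\<^sub>0] conjI allI impI)
    show "0 < \<epsilon>\<^sub>0" using \<epsilon>\<^sub>1(1) \<epsilon>\<^sub>2(2) by (simp add: \<epsilon>\<^sub>0_def)
    fix \<epsilon> :: real assume "0 < \<epsilon>" "\<epsilon> \<le> \<epsilon>\<^sub>0"
    hence \<epsilon>: "0 < \<epsilon>" "\<epsilon> < 1" "\<epsilon> \<le> \<epsilon>\<^sub>1" "\<epsilon> \<le> \<epsilon>\<^sub>2" by (auto simp: \<epsilon>\<^sub>0_def)
    have "ereal u\<^sub>0 \<le> u_star M I \<theta> \<epsilon>"
      unfolding u_star_def
    proof (rule Inf_greatest)
      fix x assume "x \<in> {ereal u |u. 0 \<le> u \<and> perc_prob M (I u) (\<theta> \<epsilon>) = 0}"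
      then obtain u where u: "x = ereal u" "0 \<le> u" "perc_prob M (I u) (\<theta> \<epsilon>) = 0" by blast
      have "\<not> u \<le> u\<^sub>0" using \<epsilon>\<^sub>2(3)[OF u(2) _ \<epsilon>(1,2,4)] u(3) by auto
      thus "ereal u\<^sub>0 \<le> x" using u(1) by simp
    qed
    moreover have "0 < ereal u\<^sub>0" using \<epsilon>\<^sub>2(1) by simp
    ultimately show "0 < u_star M I \<theta> \<epsilon>" by (rule less_le_trans[rotated])
    obtain u where u: "0 \<le> u" "perc_prob M (I u) (\<theta> \<epsilon>) = 0" using \<epsilon>\<^sub>1(2)[OF \<epsilon>(1-3)] by blast
    have "u_star M I \<theta> \<epsilon> \<le> ereal u"
      unfolding u_star_def by (rule Inf_lower) (use u in blast)
    thus "u_star M I \<theta> \<epsilon> < \<infinity>" by (rule le_less_trans) simp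
  qed
qed

end
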